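(* Let $\mathcal{G}$ be a locally compact Hausdorff étale ample groupoid. Consider the following conditions. (i) $\mathcal{G}$ is purely infinite. (ii) $\mathcal{G}$ has paradoxical comparison. (iii) Every non-empty compact open set in $\mathcal{G}^{(0)}$ is $(2,1)$-paradoxical. (iv) The groupoid semigroup $\mathcal{W}(\mathcal{G})$ is purely infinite. (v) The type semigroup $\mathcal{V}(\mathcal{G})$ is purely infinite. (vi) $\mathcal{W}(\mathcal{G})$ is almost unperforated and there is no non-trivial state on $\mathcal{W}(\mathcal{G})$. (vii) $\mathcal{V}(\mathcal{G})$ is almost unperforated and there is no non-trivial state on $\mathcal{V}(\mathcal{G})$. (viii) $\mathcal{G}$ is weakly purely infinite. Then (i)–(vii) are equivalent. If furthermore $\mathcal{G}$ has no global fixed unit in $\mathcal{G}^{(0)}$, then all of the conditions (i)–(viii) are equivalent.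
   Context: Standing assumption: all groupoids have infinite unit space. $\mathcal{G}^{(0)}$ is the unit space, $s(\gamma)=\gamma^{-1}\gamma$, $r(\gamma)=\gamma\gamma^{-1}$; for $D\subset \mathcal G^{(0)}$, $\mathcal G D=\{\gamma: s(\gamma)\in D\}$. An open bisection is an open set $U\subset\mathcal G$ such that $s|_U$ and $r|_U$ are homeomorphisms onto open subsets of $\mathcal G^{(0)}$. $\mathcal G$ is ample if its topology has a basis of compact open bisections. A unit $u$ is a global fixed unit if $s(\gamma)=u$ implies $r(\gamma)=u$ for all $\gamma\in\mathcal G$. For $K\subset\mathcal G^{(0)}$ compact and $V\subset\mathcal G^{(0)}$ open, $K\prec_{\mathcal G}V$ means there are open bisections $A_1,\dots,A_n$ with $K\subset\bigcup_i s(A_i)$ and with $r(A_1),\dots,r(A_n)$ pairwise disjoint subsets of $V$. For open $U,V$: $U\prec_{\mathcal G}V$ means $K\prec_{\mathcal G}V$ for every compact $K\subset U$; for non-empty open $U,V$, $U\prec_{\mathcal G,2}V$ means that for every compact $F\subset U$ there are disjoint non-empty open $O_1,O_2\subset V$ with $F\prec_{\mathcal G}O_1$ and $F\prec_{\mathcal G}O_2$. $\mathcal G$ is purely infinite (resp. weakly purely infinite) if $O_1\prec_{\mathcal G,2}O_2$ (resp. $O_1\prec_{\mathcal G}O_2$) for all non-empty open $O_1,O_2\subset\mathcal G^{(0)}$ with $O_1\subset r(\mathcal G O_2)$. $\mathcal G$ has paradoxical comparison if $O\prec_{\mathcal G,2}O$ for every non-empty open $O\subset\mathcal G^{(0)}$.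 A non-empty compact open set $A\subset\mathcal G^{(0)}$ is $(2,1)$-paradoxical (Bönicke–Li) if for $i=1,2$ there are compact open bisections $V_{i,1},\dots,V_{i,n_i}$ with $A=\bigcup_{j}s(V_{i,j})$ such that all the sets $r(V_{i,j})$ ($i=1,2$, $1\le j\le n_i$) are pairwise disjoint subsets of $A$. Groupoid semigroup: let $\mathcal K(\mathcal G)$ be the set of all finite sequences (length $\ge1$) of open subsets of $\mathcal G^{(0)}$ (the empty set is allowed). For $a=(O_1,\dots,O_n)$, $b=(V_1,\dots,V_m)$ in $\mathcal K(\mathcal G)$ write $a\preccurlyeq b$ if for all compact sets $F_i\subset O_i$ ($i=1,\dots,n$) there are open bisections $W^{(i)}_1,\dots,W^{(i)}_{J_i}$ and $k^{(i)}_1,\dots,k^{(i)}_{J_i}\in\{1,\dots,m\}$ with $F_i\subset\bigcup_j s(W^{(i)}_j)$ for each $i$, such that the sets $r(W^{(i)}_j)\times\{k^{(i)}_j\}$ (over all $i,j$) are pairwise disjoint subsets of $\bigsqcup_{l=1}^mV_l\times\{l\}$. Put $a\approx b$ if $a\preccurlyeq b\preccurlyeq a$, and $\mathcal W(\mathcal G)=\mathcal K(\mathcal G)/\approx$, with addition induced by concatenation, order $[a]\le[b]$ iff $a\preccurlyeq b$, and neutral element $[(\emptyset)]$; it is a partially ordered commutative monoid. Type semigroup: let $\mathcal C(\mathcal G)\subset\mathcal K(\mathcal G)$ be the sequences of compact open sets. For $a=(A_1,\dots,A_n)$, $b=(B_1,\dots,B_m)$ in $\mathcal C(\mathcal G)$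 write $a\sim_{\mathcal G}b$ if for each $i\le n$ there are compact open bisections $W^{(i)}_1,\dots,W^{(i)}_{J_i}$ and $k^{(i)}_1,\dots,k^{(i)}_{J_i}\in\{1,\dots,m\}$ with $A_i=\bigsqcup_j s(W^{(i)}_j)$ and $\bigsqcup_{l}B_l\times\{l\}=\bigsqcup_{i}\bigsqcup_{j}r(W^{(i)}_j)\times\{k^{(i)}_j\}$ (disjoint unions). This is an equivalence relation; $\mathcal V(\mathcal G)=\mathcal C(\mathcal G)/\sim_{\mathcal G}$ with addition induced by concatenation and the algebraic preorder ($x\le y$ iff $y=x+z$ for some $z$). For a preordered commutative monoid $W$: $W$ is purely infinite if $2x\le x$ for every $x\in W$; almost unperforated if $(n+1)x\le ny$ for some $n\in\mathbb N$ (with $x,y\in W$) implies $x\le y$; a state is an order preserving additive map $f:W\to[0,\infty]$ with $f(0)=0$, and it is non-trivial if it takes a value different from $0$ and $\infty$. *)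

theory Defs
  imports "HOL-Analysis.Analysis" "HOL-Algebra.Group"
begin

section \<open>Topological groupoids\<close>

text \<open>The set of arrows is the underlying set \<^term>\<open>topspace (arrow_top G)\<close> of the topology.
  Multiplication is partial: only its values on \<^term>\<open>composable G\<close> are meaningful.\<close>

record 'a groupoid =
  arrow_top :: "'a topology"
  composable :: "('a \<times> 'a) set"
  gmult :: "'a \<Rightarrow> 'a \<Rightarrow> 'a"
  ginv :: "'a \<Rightarrow> 'a"

abbreviation arrows :: "'a groupoid \<Rightarrow> 'a set" where
  "arrows G \<equiv> topspace (arrow_top G)"

locale topological_groupoid =
  fixes G :: "'a groupoid"
  assumes composable_subset: "composable G \<subseteq> arrows G \<times> arrows G"
    and gmult_closed: "(x, y) \<in> composable G \<Longrightarrow> gmult G x y \<in> arrows G"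
    and ginv_closed: "x \<in> arrows G \<Longrightarrow> ginv G x \<in> arrows G"
    and ginv_ginv: "x \<in> arrows G \<Longrightarrow> ginv G (ginv G x) = x"
    and composable_left: "(x, y) \<in> composable G \<Longrightarrow> (y, z) \<in> composable G
           \<Longrightarrow> (gmult G x y, z) \<in> composable G"
    and composable_right: "(x, y) \<in> composable G \<Longrightarrow> (y, z) \<in> composable G
           \<Longrightarrow> (x, gmult G y z) \<in> composable G"
    and gmult_assoc: "(x, y) \<in> composable G \<Longrightarrow> (y, z) \<in> composable G
           \<Longrightarrow> gmult G (gmult G x y) z = gmult G x (gmult G y z)"
    and composable_ginv: "x \<in> arrows G \<Longrightarrow> (x, ginv G x) \<in> composable G"
    and ginv_cancel_left: "(x, y) \<in> composable G \<Longrightarrow> gmult G (ginv G x) (gmult G x y) = y"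
    and ginv_cancel_right: "(x, y) \<in> composable G \<Longrightarrow> gmult G (gmult G x y) (ginv G y) = x"
    and continuous_gmult:
      "continuous_map
         (subtopology (prod_topology (arrow_top G) (arrow_top G)) (composable G))
         (arrow_top G) (\<lambda>(x, y). gmult G x y)"
    and continuous_ginv: "continuous_map (arrow_top G) (arrow_top G) (ginv G)"

definition src :: "'a groupoid \<Rightarrow> 'a \<Rightarrow> 'a" where
  "src G x = gmult G (ginv G x) x"

definition rng :: "'a groupoid \<Rightarrow> 'a \<Rightarrow> 'a" where
  "rng G x = gmult G x (ginv G x)"

definition units :: "'a groupoid \<Rightarrow> 'a set" where
  "units G = src G ` arrows G"

definition unit_top :: "'a groupoid \<Rightarrow> 'a topology" where
  "unit_top G = subtopology (arrow_top G) (units G)"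

definition arrows_from :: "'a groupoid \<Rightarrow> 'a set \<Rightarrow> 'a set" where
  "arrows_from G D = {x \<in> arrows G. src G x \<in> D}"

definition global_fixed_unit :: "'a groupoid \<Rightarrow> 'a \<Rightarrow> bool" where
  "global_fixed_unit G u \<longleftrightarrow> u \<in> units G \<and> (\<forall>x\<in>arrows G. src G x = u \<longrightarrow> rng G x = u)"

definition local_homeomorphism :: "'a topology \<Rightarrow> 'b topology \<Rightarrow> ('a \<Rightarrow> 'b) \<Rightarrow> bool" where
  "local_homeomorphism X Y f \<longleftrightarrow>
     (\<forall>x\<in>topspace X. \<exists>U. openin X U \<and> x \<in> U \<and> openin Y (f ` U) \<and>
        homeomorphic_map (subtopology X U) (subtopology Y (f ` U)) f)"

definition etale :: "'a groupoid \<Rightarrow> bool" where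
  "etale G \<longleftrightarrow> local_homeomorphism (arrow_top G) (unit_top G) (rng G)"

definition open_bisection :: "'a groupoid \<Rightarrow> 'a set \<Rightarrow> bool" where
  "open_bisection G U \<longleftrightarrow> openin (arrow_top G) U \<and>
     openin (unit_top G) (src G ` U) \<and>
     homeomorphic_map (subtopology (arrow_top G) U) (subtopology (unit_top G) (src G ` U)) (src G) \<and>
     openin (unit_top G) (rng G ` U) \<and>
     homeomorphic_map (subtopology (arrow_top G) U) (subtopology (unit_top G) (rng G ` U)) (rng G)"

definition compact_open_bisection :: "'a groupoid \<Rightarrow> 'a set \<Rightarrow> bool" where
  "compact_open_bisection G U \<longleftrightarrow> compactin (arrow_top G) U \<and> open_bisection G U"

definition ample :: "'a groupoid \<Rightarrow> bool" where
  "ample G \<longleftrightarrow> openin (arrow_top G) = arbitrary union_of (compact_open_bisection G)"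


section \<open>Comparison of subsets of the unit space\<close>

definition compact_below :: "'a groupoid \<Rightarrow> 'a set \<Rightarrow> 'a set \<Rightarrow> bool" where
  "compact_below G K V \<longleftrightarrow>
     (\<exists>(n::nat) A. (\<forall>i<n. open_bisection G (A i)) \<and>
        K \<subseteq> (\<Union>i<n. src G ` A i) \<and>
        disjoint_family_on (\<lambda>i. rng G ` A i) {..<n} \<and>
        (\<forall>i<n. rng G ` A i \<subseteq> V))"

definition open_below :: "'a groupoid \<Rightarrow> 'a set \<Rightarrow> 'a set \<Rightarrow> bool" where
  "open_below G U V \<longleftrightarrow> (\<forall>K. compactin (unit_top G) K \<and> K \<subseteq> U \<longrightarrow> compact_below G K V)"

definition open_below2 :: "'a groupoid \<Rightarrow> 'a set \<Rightarrow> 'a set \<Rightarrow> bool" where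
  "open_below2 G U V \<longleftrightarrow>
     (\<forall>F. compactin (unit_top G) F \<and> F \<subseteq> U \<longrightarrow>
        (\<exists>O1 O2. openin (unit_top G) O1 \<and> openin (unit_top G) O2 \<and> O1 \<noteq> {} \<and> O2 \<noteq> {} \<and>
           O1 \<inter> O2 = {} \<and> O1 \<subseteq> V \<and> O2 \<subseteq> V \<and>
           compact_below G F O1 \<and> compact_below G F O2))"

definition purely_infinite_groupoid :: "'a groupoid \<Rightarrow> bool" where
  "purely_infinite_groupoid G \<longleftrightarrow>
     (\<forall>O1 O2. openin (unit_top G) O1 \<and> openin (unit_top G) O2 \<and> O1 \<noteq> {} \<and> O2 \<noteq> {} \<and>
        O1 \<subseteq> rng G ` arrows_from G O2 \<longrightarrow> open_below2 G O1 O2)"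

definition weakly_purely_infinite_groupoid :: "'a groupoid \<Rightarrow> bool" where
  "weakly_purely_infinite_groupoid G \<longleftrightarrow>
     (\<forall>O1 O2. openin (unit_top G) O1 \<and> openin (unit_top G) O2 \<and> O1 \<noteq> {} \<and> O2 \<noteq> {} \<and>
        O1 \<subseteq> rng G ` arrows_from G O2 \<longrightarrow> open_below G O1 O2)"

definition paradoxical_comparison :: "'a groupoid \<Rightarrow> bool" where
  "paradoxical_comparison G \<longleftrightarrow>
     (\<forall>U. openin (unit_top G) U \<and> U \<noteq> {} \<longrightarrow> open_below2 G U U)"

definition compact_open_unit_set :: "'a groupoid \<Rightarrow> 'a set \<Rightarrow> bool" where
  "compact_open_unit_set G A \<longleftrightarrow> compactin (unit_top G) A \<and> openin (unit_top G) A"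

definition two_one_paradoxical :: "'a groupoid \<Rightarrow> 'a set \<Rightarrow> bool" where
  "two_one_paradoxical G A \<longleftrightarrow>
     (\<exists>(n :: nat \<Rightarrow> nat) V.
        (\<forall>i\<in>{1, 2}. (\<forall>j\<in>{1..n i}. compact_open_bisection G (V i j)) \<and>
           A = (\<Union>j\<in>{1..n i}. src G ` V i j)) \<and>
        disjoint_family_on (\<lambda>(i, j). rng G ` V i j) (SIGMA i:{1, 2}. {1..n i}) \<and>
        (\<forall>i\<in>{1, 2}. \<forall>j\<in>{1..n i}. rng G ` V i j \<subseteq> A))"


section \<open>Preordered commutative monoids\<close>

text \<open>Commutative monoids are written multiplicatively, following \<^const>\<open>comm_monoid\<close>: the
  additive notation $x + y$, $0$ and $n x$ becomes \<open>x \<otimes> y\<close>, \<open>\<one>\<close> and \<open>x [^] n\<close>.\<close>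

record 'b preordered_monoid = "'b monoid" +
  pre_le :: "'b \<Rightarrow> 'b \<Rightarrow> bool"

definition purely_infinite_monoid :: "'b preordered_monoid \<Rightarrow> bool" where
  "purely_infinite_monoid W \<longleftrightarrow> (\<forall>x\<in>carrier W. pre_le W (x [^]\<^bsub>W\<^esub> (2::nat)) x)"

definition almost_unperforated :: "'b preordered_monoid \<Rightarrow> bool" where
  "almost_unperforated W \<longleftrightarrow>
     (\<forall>x\<in>carrier W. \<forall>y\<in>carrier W.
        (\<exists>n::nat. n \<ge> 1 \<and> pre_le W (x [^]\<^bsub>W\<^esub> (n + 1)) (y [^]\<^bsub>W\<^esub> n)) \<longrightarrow> pre_le W x y)"

definition monoid_state :: "'b preordered_monoid \<Rightarrow> ('b \<Rightarrow> ennreal) \<Rightarrow> bool" where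
  "monoid_state W f \<longleftrightarrow>
     f \<one>\<^bsub>W\<^esub> = 0 \<and>
     (\<forall>x\<in>carrier W. \<forall>y\<in>carrier W. f (x \<otimes>\<^bsub>W\<^esub> y) = f x + f y) \<and>
     (\<forall>x\<in>carrier W. \<forall>y\<in>carrier W. pre_le W x y \<longrightarrow> f x \<le> f y)"

definition nontrivial_state :: "'b preordered_monoid \<Rightarrow> ('b \<Rightarrow> ennreal) \<Rightarrow> bool" where
  "nontrivial_state W f \<longleftrightarrow> monoid_state W f \<and> (\<exists>x\<in>carrier W. f x \<noteq> 0 \<and> f x \<noteq> \<infinity>)"


section \<open>The groupoid semigroup\<close>

text \<open>Finite sequences are lists, so that indices start at \<open>0\<close>.\<close>

definition open_seqs :: "'a groupoid \<Rightarrow> 'a set list set" where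
  "open_seqs G = {a. a \<noteq> [] \<and> (\<forall>U\<in>set a. openin (unit_top G) U)}"

definition tagged_union :: "'a set list \<Rightarrow> ('a \<times> nat) set" where
  "tagged_union b = (\<Union>l<length b. b ! l \<times> {l})"

definition seq_le :: "'a groupoid \<Rightarrow> 'a set list \<Rightarrow> 'a set list \<Rightarrow> bool" where
  "seq_le G a b \<longleftrightarrow>
     (\<forall>F. (\<forall>i<length a. compactin (unit_top G) (F i) \<and> F i \<subseteq> a ! i) \<longrightarrow>
        (\<exists>(J :: nat \<Rightarrow> nat) W k.
           (\<forall>i<length a. \<forall>j<J i. open_bisection G (W i j) \<and> k i j < length b) \<and>
           (\<forall>i<length a. F i \<subseteq> (\<Union>j<J i. src G ` W i j)) \<and>
           disjoint_family_on (\<lambda>(i, j). rng G ` W i j \<times> {k i j}) (SIGMA i:{..<length a}. {..<J i}) \<and>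
           (\<forall>i<length a. \<forall>j<J i. rng G ` W i j \<times> {k i j} \<subseteq> tagged_union b)))"

definition seq_equiv :: "'a groupoid \<Rightarrow> ('a set list \<times> 'a set list) set" where
  "seq_equiv G = {(a, b). a \<in> open_seqs G \<and> b \<in> open_seqs G \<and> seq_le G a b \<and> seq_le G b a}"

definition groupoid_semigroup :: "'a groupoid \<Rightarrow> 'a set list set preordered_monoid" where
  "groupoid_semigroup G =
     \<lparr>carrier = open_seqs G // seq_equiv G,
      monoid.mult = (\<lambda>X Y. \<Union>a\<in>X. \<Union>b\<in>Y. seq_equiv G `` {a @ b}),
      one = seq_equiv G `` {[{}]},
      pre_le = (\<lambda>X Y. \<exists>a\<in>X. \<exists>b\<in>Y. seq_le G a b)\<rparr>"


section \<open>The type semigroup\<close>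

definition compact_open_seqs :: "'a groupoid \<Rightarrow> 'a set list set" where
  "compact_open_seqs G = {a. a \<noteq> [] \<and> (\<forall>A\<in>set a. compact_open_unit_set G A)}"

definition type_rel :: "'a groupoid \<Rightarrow> 'a set list \<Rightarrow> 'a set list \<Rightarrow> bool" where
  "type_rel G a b \<longleftrightarrow>
     (\<exists>(J :: nat \<Rightarrow> nat) W k.
        (\<forall>i<length a. \<forall>j<J i. compact_open_bisection G (W i j) \<and> k i j < length b) \<and>
        (\<forall>i<length a. a ! i = (\<Union>j<J i. src G ` W i j) \<and>
           disjoint_family_on (\<lambda>j. src G ` W i j) {..<J i}) \<and>
        tagged_union b = (\<Union>i<length a. \<Union>j<J i. rng G ` W i j \<times> {k i j}) \<and>
        disjoint_family_on (\<lambda>(i, j). rng G ` W i j \<times> {k i j}) (SIGMA i:{..<length a}. {..<J i}))"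

definition type_equiv :: "'a groupoid \<Rightarrow> ('a set list \<times> 'a set list) set" where
  "type_equiv G =
     {(a, b). a \<in> compact_open_seqs G \<and> b \<in> compact_open_seqs G \<and> type_rel G a b}"

definition type_classes :: "'a groupoid \<Rightarrow> 'a set list set set" where
  "type_classes G = compact_open_seqs G // type_equiv G"

definition type_add ::
  "'a groupoid \<Rightarrow> 'a set list set \<Rightarrow> 'a set list set \<Rightarrow> 'a set list set" where
  "type_add G X Y = (\<Union>a\<in>X. \<Union>b\<in>Y. type_equiv G `` {a @ b})"

definition type_semigroup :: "'a groupoid \<Rightarrow> 'a set list set preordered_monoid" where
  "type_semigroup G =
     \<lparr>carrier = type_classes G,
      monoid.mult = type_add G,
      one = type_equiv G `` {[{}]},
      pre_le = (\<lambda>X Y. \<exists>Z\<in>type_classes G. Y = type_add G X Z)\<rparr>"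

end

(* All conditions are equivalent to the single statement that two disjoint copies of A embed into A,
   for every compact open set A of units.

   A finite sequence of sets of units is a subset of units x nat, and the comparison relations become
   embeddings by compact open bisections of the product of G with the pair groupoid on nat.  Such
   bisections compose, invert and form disjoint unions.  A compact open set covered by open
   bisections with disjoint ranges can be cut into compact open pieces, one for each bisection, so all
   the comparison relations on compact open sets reduce to this one; the open case follows by
   approximation from inside.

   For the semigroups this says 2x \<le> x on generators.  Almost unperforation and absence of
   non-trivial states give 2x \<le> x by Tarski's theorem: if (n+1)x \<le> nx fails for all n, some state
   has value 1 at x; otherwise mx \<le> nx for all m, so (k+1)(2x) \<le> kx for large k.

   In the weakly purely infinite case, a unit u moved by an arrow lies in the source D of a compact
   open bisection whose range R is disjoint from D.  Then D \<union> R embeds into D, and since D and R are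
   equivalent, two copies of D do.  Finitely many such D cover a given compact open set. *)
theory Submission
  imports Defs
begin

text \<open>Neither monoid is assumed cancellative and no preorder is assumed antisymmetric, so the
  state in Tarski's theorem cannot be taken from an embedding into an ordered group. Instead, a
  relation d z + b x \<le> a x bounds any state normalised at x by (a - b) / d at z. The infimum of
  these bounds is subadditive and homogeneous; Zorn's lemma yields a minimal function of this kind,
  which is additive, as in the Hahn-Banach theorem. The state is infinite outside the order ideal of
  x, so it has to be built only there.

  The levels in units x nat have a second use: bisections whose ranges overlap become disjoint when
  they are sent to different levels. Doubling pushes any finite number of levels back into one, and
  so a mere covering turns into an embedding into a single compact open set.

  The argument from weak pure infiniteness breaks down at a global fixed unit: a bisection with an
  arrow starting there has this unit both in its source and in its range, so the unit lies in no set
  D that is moved off itself.\<close>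

section \<open>States on preordered commutative monoids\<close>

text \<open>The common abstraction of both semigroups. By \<open>one_le\<close> summands lie below
  their sum.\<close>

locale pos_preordered_monoid = comm_monoid W for W :: "'b preordered_monoid" (structure) +
  assumes le_refl: "x \<in> carrier W \<Longrightarrow> pre_le W x x"
    and le_trans: "\<lbrakk>pre_le W x y; pre_le W y z; x \<in> carrier W; y \<in> carrier W; z \<in> carrier W\<rbrakk> \<Longrightarrow> pre_le W x z"
    and le_add_right: "\<lbrakk>pre_le W x y; x \<in> carrier W; y \<in> carrier W; z \<in> carrier W\<rbrakk> \<Longrightarrow> pre_le W (x \<otimes> z) (y \<otimes> z)"
    and one_le: "x \<in> carrier W \<Longrightarrow> pre_le W \<one> x"
begin

abbreviation le (infix "\<preceq>" 50) where "le \<equiv> pre_le W"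

lemma le_add:
  assumes "x \<preceq> y" "z \<preceq> w" and c: "x \<in> carrier W" "y \<in> carrier W" "z \<in> carrier W" "w \<in> carrier W"
  shows "x \<otimes> z \<preceq> y \<otimes> w"
proof -
  have "x \<otimes> z \<preceq> y \<otimes> z" using le_add_right assms by blast
  moreover have "y \<otimes> z \<preceq> y \<otimes> w"
    using le_add_right[OF assms(2) c(3,4,2)] m_comm c by metis
  ultimately show ?thesis using le_trans c by (meson m_closed)
qed

lemma le_pow:
  assumes "x \<preceq> y" "x \<in> carrier W" "y \<in> carrier W" shows "x [^] (n::nat) \<preceq> y [^] n"
  by (induction n) (use assms le_refl le_add in auto)

lemma le_mult_left:
  assumes "x \<in> carrier W" "y \<in> carrier W" shows "x \<preceq> y \<otimes> x"
  using le_add_right[OF one_le, of y x] assms by simp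

lemma le_pow_mono:
  assumes "m \<le> n" "x \<in> carrier W" shows "x [^] (m::nat) \<preceq> x [^] n"
  using le_mult_left[of "x [^] m" "x [^] (n - m)"] assms by (simp add: nat_pow_mult)

section \<open>The order ideal of an element and its gauges\<close>

context
  fixes x assumes x: "x \<in> carrier W"
begin

text \<open>Here a state f with value 1 at \<open>x\<close> is forced to be finite, by f z \<le>
  n.\<close>

definition order_ideal :: "'b set" where
  "order_ideal = {z \<in> carrier W. \<exists>n::nat. z \<preceq> x [^] n}"

abbreviation "I \<equiv> order_ideal"

lemma ideal_carrier: "z \<in> I \<Longrightarrow> z \<in> carrier W"
  by (simp add: order_ideal_def)

lemma ideal_le:
  assumes "z \<preceq> w" "z \<in> carrier W" "w \<in> I" shows "z \<in> I"
proof -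
  obtain n :: nat where "w \<preceq> x [^] n" "w \<in> carrier W"
    using assms(3) unfolding order_ideal_def by blast
  then have "z \<preceq> x [^] n" using le_trans[OF assms(1)] assms(2) x by simp
  then show ?thesis using assms(2) unfolding order_ideal_def by blast
qed

lemma ideal_mult: assumes "z \<in> I" "w \<in> I" shows "z \<otimes> w \<in> I"
proof -
  obtain m n :: nat where "z \<preceq> x [^] m" "w \<preceq> x [^] n" "z \<in> carrier W" "w \<in> carrier W"
    using assms unfolding order_ideal_def by blast
  then have "z \<otimes> w \<preceq> x [^] (m + n)"
    using le_add[of z "x [^] m" w "x [^] n"] x by (simp add: nat_pow_mult)
  then show ?thesis using assms unfolding order_ideal_def by blast
qed

text \<open>Summands lie below their sum, so the ideal is hereditary. This is what makes the value
  infinity off the ideal compatible with addition.\<close>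

lemma ideal_mult_iff:
  assumes "z \<in> carrier W" "w \<in> carrier W" shows "z \<otimes> w \<in> I \<longleftrightarrow> z \<in> I \<and> w \<in> I"
proof
  assume h: "z \<otimes> w \<in> I"
  have "w \<preceq> z \<otimes> w" "z \<preceq> z \<otimes> w" using le_mult_left assms m_comm by metis+
  then show "z \<in> I \<and> w \<in> I" using ideal_le[OF _ _ h] assms by simp
qed (simp add: ideal_mult)

lemma ideal_one: "\<one> \<in> I"
  using le_refl[OF one_closed] unfolding order_ideal_def by (auto intro!: exI[of _ "0::nat"])

lemma ideal_pow: "z \<in> I \<Longrightarrow> z [^] (n::nat) \<in> I"
  by (induction n) (auto intro: ideal_one ideal_mult)

lemma ideal_gen: "x \<in> I"
  using le_refl[OF x] x unfolding order_ideal_def by (auto intro!: exI[of _ "1::nat"])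

text \<open>A minimal gauge \<open>p\<close> is additive: for fixed \<open>y\<close>, the infimum of \<open>p (z + t y) - t p y\<close> over
  \<open>t\<close> is a gauge below \<open>p\<close>, hence equal to \<open>p\<close>.  The condition \<open>p (z + x) = p z + 1\<close> serves
  instead of \<open>p x = 1\<close> because it passes to this infimum.\<close>

definition gauges :: "('b \<Rightarrow> real) set" where
  "gauges = {p. (\<forall>z. z \<notin> I \<longrightarrow> p z = 0) \<and>
     (\<forall>z\<in>I. \<forall>w\<in>I. z \<preceq> w \<longrightarrow> p z \<le> p w) \<and>
     (\<forall>z\<in>I. \<forall>w\<in>I. p (z \<otimes> w) \<le> p z + p w) \<and>
     (\<forall>z\<in>I. \<forall>n::nat. real n * p z \<le> p (z [^] n)) \<and>
     (\<forall>z\<in>I. p (z \<otimes> x) = p z + 1)}"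

text \<open>Subadditivity at 1 + 1 = 1 (the neutral element) gives p 1 \<ge> 0, and the axiom on
  multiples with n = 2 gives 2 p 1 \<le> p 1.\<close>

lemma gauge_one: assumes "p \<in> gauges" shows "p \<one> = 0"
proof -
  have "p (\<one> \<otimes> \<one>) \<le> p \<one> + p \<one>" "real 2 * p \<one> \<le> p (\<one> [^] (2::nat))"
    using assms ideal_one unfolding gauges_def by blast+
  then show ?thesis by simp
qed

lemma gauge_nonneg: assumes "p \<in> gauges" shows "0 \<le> p z"
proof (cases "z \<in> I")
  case True
  then have "p \<one> \<le> p z" using assms ideal_one one_le ideal_carrier unfolding gauges_def by blast
  then show ?thesis using gauge_one[OF assms] by simp
qed (use assms in \<open>simp add: gauges_def\<close>)

lemma gauge_pow:
  assumes "p \<in> gauges" "z \<in> I" shows "p (z [^] (n::nat)) = real n * p z"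
proof (rule antisym)
  show "p (z [^] n) \<le> real n * p z"
  proof (induction n)
    case (Suc n)
    have "p (z [^] n \<otimes> z) \<le> p (z [^] n) + p z"
      using assms ideal_pow unfolding gauges_def by blast
    then show ?case using Suc by (simp add: algebra_simps)
  qed (simp add: gauge_one[OF assms(1)])
  show "real n * p z \<le> p (z [^] n)" using assms unfolding gauges_def by blast
qed

text \<open>The witness is the infimum of all (a - b) / d with d z + b x \<le> a x. The term b x
  makes up for missing cancellation: in d (z + x) + b x \<le> a x the d extra copies of x move into
  b, which yields p (z + x) \<ge> p z + 1.\<close>

lemma gauges_nonempty:
  assumes x_inf: "\<And>n::nat. \<not> x [^] (n + 1) \<preceq> x [^] n"
  shows "gauges \<noteq> {}"
proof -
  \<comment> \<open>The hypothesis enters only here: comparable multiples of \<open>x\<close> have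
    comparable coefficients, which keeps every fraction in \<open>A z\<close> nonnegative.\<close>
  have x_le: "b \<le> a" if "x [^] b \<preceq> x [^] a" for a b :: nat
  proof (rule ccontr)
    assume "\<not> b \<le> a"
    then have "x [^] (a + 1) \<preceq> x [^] b" by (intro le_pow_mono x) simp
    then show False using le_trans[OF _ that] x x_inf[of a] by blast
  qed
  define A where "A z = {(real a - real b) / real d | a b d :: nat. d \<ge> 1 \<and> z [^] d \<otimes> x [^] b \<preceq> x [^] a}" for z
  define p where "p z = (if z \<in> I then Inf (A z) else 0)" for z
  have A_nonneg: "0 \<le> t" if t: "t \<in> A z" "z \<in> I" for t z
  proof -
    obtain a b d :: nat where h: "t = (real a - real b) / real d" "d \<ge> 1" "z [^] d \<otimes> x [^] b \<preceq> x [^] a"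
      using t unfolding A_def by blast
    have "x [^] b \<preceq> z [^] d \<otimes> x [^] b" using le_mult_left t ideal_carrier x by simp
    then have "x [^] b \<preceq> x [^] a" using le_trans[OF _ h(3)] t ideal_carrier x by simp
    then show ?thesis using x_le h(1) by simp
  qed
  have bdd: "bdd_below (A z)" if "z \<in> I" for z using A_nonneg that by (meson bdd_belowI)
  have A_ne: "A z \<noteq> {}" if z: "z \<in> I" for z
  proof -
    obtain n :: nat where "z \<preceq> x [^] n" using z unfolding order_ideal_def by blast
    then have "z [^] (1::nat) \<otimes> x [^] (0::nat) \<preceq> x [^] n" using z ideal_carrier by simp
    then have "(real n - real 0) / real 1 \<in> A z" unfolding A_def using le_refl by blast
    then show ?thesis by blast
  qed
  have p_le: "p z \<le> (real a - real b) / real d" if "z \<in> I" "d \<ge> 1" "z [^] d \<otimes> x [^] b \<preceq> x [^] a" for z and a b d :: nat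
    unfolding p_def using that bdd by (auto intro!: cInf_lower simp: A_def)
  have p_ge: "c \<le> p z" if h: "z \<in> I" "\<And>a b d :: nat. d \<ge> 1 \<Longrightarrow> z [^] d \<otimes> x [^] b \<preceq> x [^] a \<Longrightarrow> c \<le> (real a - real b) / real d" for z c
    unfolding p_def using h(1) A_ne[OF h(1)] h(2) by (auto intro!: cInf_greatest simp: A_def)
  have p0: "0 \<le> p z" for z unfolding p_def using A_ne A_nonneg by (auto intro!: cInf_greatest)
  have "p \<in> gauges" unfolding gauges_def
  proof (intro CollectI conjI ballI allI impI)
    fix z assume "z \<notin> I" then show "p z = 0" by (simp add: p_def)
  next
    fix z w assume h: "z \<in> I" "w \<in> I" "z \<preceq> w"
    note c = ideal_carrier[OF h(1)] ideal_carrier[OF h(2)]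
    show "p z \<le> p w"
    proof (rule p_ge[OF h(2)])
      fix a b d :: nat assume d: "d \<ge> 1" "w [^] d \<otimes> x [^] b \<preceq> x [^] a"
      have "z [^] d \<otimes> x [^] b \<preceq> w [^] d \<otimes> x [^] b" using le_add_right le_pow h(3) c x by simp
      then have "z [^] d \<otimes> x [^] b \<preceq> x [^] a" using le_trans[OF _ d(2)] c x by simp
      then show "p z \<le> (real a - real b) / real d" using p_le h(1) d(1) by blast
    qed
  next
    fix z w assume h: "z \<in> I" "w \<in> I"
    note c = ideal_carrier[OF h(1)] ideal_carrier[OF h(2)]
    have "p (z \<otimes> w) - p w \<le> p z"
    proof (rule p_ge[OF h(1)])
      fix a b d :: nat assume d: "d \<ge> 1" "z [^] d \<otimes> x [^] b \<preceq> x [^] a"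
      have "p (z \<otimes> w) - (real a - real b) / real d \<le> p w"
      proof (rule p_ge[OF h(2)])
        fix a' b' d' :: nat assume d': "d' \<ge> 1" "w [^] d' \<otimes> x [^] b' \<preceq> x [^] a'"
        \<comment> \<open>Taking d' times the first inequality and d times the second brings both
          fractions to the common denominator \<open>d * d'\<close>.\<close>
        have "(z [^] d \<otimes> x [^] b) [^] d' \<otimes> (w [^] d' \<otimes> x [^] b') [^] d \<preceq> (x [^] a) [^] d' \<otimes> (x [^] a') [^] d"
          using le_add le_pow d(2) d'(2) c x by simp
        moreover have "(z [^] d \<otimes> x [^] b) [^] d' = z [^] (d * d') \<otimes> x [^] (b * d')"
          using c x by (simp add: nat_pow_distrib nat_pow_pow)
        moreover have "(w [^] d' \<otimes> x [^] b') [^] d = w [^] (d * d') \<otimes> x [^] (b' * d)"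
          using c x by (simp add: nat_pow_distrib nat_pow_pow mult.commute)
        moreover have "z [^] (d * d') \<otimes> x [^] (b * d') \<otimes> (w [^] (d * d') \<otimes> x [^] (b' * d)) =
            (z \<otimes> w) [^] (d * d') \<otimes> x [^] (b * d' + b' * d)"
          using c x by (simp add: nat_pow_distrib m_ac flip: nat_pow_mult)
        moreover have "(x [^] a) [^] d' \<otimes> (x [^] a') [^] d = x [^] (a * d' + a' * d)"
          using x by (simp add: nat_pow_pow nat_pow_mult)
        ultimately have "(z \<otimes> w) [^] (d * d') \<otimes> x [^] (b * d' + b' * d) \<preceq> x [^] (a * d' + a' * d)"
          by simp
        moreover have "1 \<le> d * d'" using mult_le_mono[OF d(1) d'(1)] by simp
        ultimately have "p (z \<otimes> w) \<le> (real (a * d' + a' * d) - real (b * d' + b' * d)) / real (d * d')"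
          by (intro p_le[OF ideal_mult[OF h]])
        also have "\<dots> = (real a - real b) / real d + (real a' - real b') / real d'"
          using d(1) d'(1) by (simp add: field_simps)
        finally show "p (z \<otimes> w) - (real a - real b) / real d \<le> (real a' - real b') / real d'" by simp
      qed
      then show "p (z \<otimes> w) - p w \<le> (real a - real b) / real d" by simp
    qed
    then show "p (z \<otimes> w) \<le> p z + p w" by simp
  next
    fix z and n :: nat assume z: "z \<in> I"
    show "real n * p z \<le> p (z [^] n)"
    proof (cases "n = 0")
      case False
      show ?thesis
      proof (rule p_ge[OF ideal_pow[OF z]])
        fix a b d :: nat assume d: "d \<ge> 1" "(z [^] n) [^] d \<otimes> x [^] b \<preceq> x [^] a"
        then have "p z \<le> (real a - real b) / real (n * d)"
          using p_le[OF z, of "n * d" b a] False z ideal_carrier by (simp add: nat_pow_pow)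
        then show "real n * p z \<le> (real a - real b) / real d"
          using False d(1) by (simp add: field_simps)
      qed
    qed (simp add: p0)
  next
    fix z assume z: "z \<in> I"
    note c = ideal_carrier[OF z]
    have zx: "z \<otimes> x \<in> I" using ideal_mult z ideal_gen by blast
    have "p z + 1 \<le> p (z \<otimes> x)"
    proof (rule p_ge[OF zx])
      fix a b d :: nat assume d: "d \<ge> 1" "(z \<otimes> x) [^] d \<otimes> x [^] b \<preceq> x [^] a"
      have "(z \<otimes> x) [^] d \<otimes> x [^] b = z [^] d \<otimes> x [^] (d + b)"
        using c x by (simp add: nat_pow_distrib m_assoc nat_pow_mult)
      then have "p z \<le> (real a - real (d + b)) / real d" using d(2) by (intro p_le[OF z d(1)]) simp
      then show "p z + 1 \<le> (real a - real b) / real d" using d(1) by (simp add: field_simps)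
    qed
    moreover have "p (z \<otimes> x) - 1 \<le> p z"
    proof (rule p_ge[OF z])
      fix a b d :: nat assume d: "d \<ge> 1" "z [^] d \<otimes> x [^] b \<preceq> x [^] a"
      have "z [^] d \<otimes> x [^] b \<otimes> x [^] d \<preceq> x [^] a \<otimes> x [^] d" using le_add_right d(2) c x by simp
      moreover have "z [^] d \<otimes> x [^] b \<otimes> x [^] d = (z \<otimes> x) [^] d \<otimes> x [^] b"
        using c x by (simp add: nat_pow_distrib m_ac)
      ultimately have "(z \<otimes> x) [^] d \<otimes> x [^] b \<preceq> x [^] (a + d)" using x by (simp add: nat_pow_mult)
      then have "p (z \<otimes> x) \<le> (real (a + d) - real b) / real d" by (rule p_le[OF zx d(1)])
      then show "p (z \<otimes> x) - 1 \<le> (real a - real b) / real d" using d(1) by (simp add: field_simps)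
    qed
    ultimately show "p (z \<otimes> x) = p z + 1" by simp
  qed
  then show ?thesis by blast
qed

text \<open>Only subadditivity needs a chain: the bound p z + q w, with two different gauges, is met
  by the smaller of p and q.\<close>

lemma gauges_chain_Inf:
  assumes C: "C \<subseteq> gauges" "C \<noteq> {}"
    and chain: "\<And>p q. p \<in> C \<Longrightarrow> q \<in> C \<Longrightarrow> p \<le> q \<or> q \<le> p"
  shows "(\<lambda>z. INF p\<in>C. p z) \<in> gauges"
proof -
  let ?u = "\<lambda>z. INF p\<in>C. p z"
  have bdd: "bdd_below ((\<lambda>p. p z) ` C)" for z
    using gauge_nonneg C(1) by (auto intro!: bdd_belowI[of _ 0])
  have lower: "?u z \<le> p z" if "p \<in> C" for p z using bdd that by (rule cINF_lower)
  have greatest: "c \<le> ?u z" if "\<And>p. p \<in> C \<Longrightarrow> c \<le> p z" for c z using C(2) that by (rule cINF_greatest)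
  have G: "p \<in> gauges" if "p \<in> C" for p using C(1) that by blast
  show ?thesis unfolding gauges_def
  proof (intro CollectI conjI ballI allI impI)
    fix z assume "z \<notin> I"
    then have "p z = 0" if "p \<in> C" for p using G[OF that] unfolding gauges_def by blast
    then have "(\<lambda>p. p z) ` C = (\<lambda>_. 0) ` C" by (rule image_cong[OF refl])
    then show "?u z = 0" using C(2) by simp
  next
    fix z w assume h: "z \<in> I" "w \<in> I" "z \<preceq> w"
    show "?u z \<le> ?u w"
    proof (rule greatest)
      fix p assume p: "p \<in> C"
      then have "p z \<le> p w" using G[OF p] h unfolding gauges_def by blast
      then show "?u z \<le> p w" using lower[OF p, of z] by simp
    qed
  next
    fix z w assume h: "z \<in> I" "w \<in> I"
    have 1: "?u (z \<otimes> w) \<le> p z + q w" if pq: "p \<in> C" "q \<in> C" for p q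
    proof -
      obtain m where m: "m \<in> C" "m \<le> p" "m \<le> q" using chain[OF pq] pq by blast
      have "m (z \<otimes> w) \<le> m z + m w" using G[OF m(1)] h unfolding gauges_def by blast
      then show ?thesis using lower[OF m(1), of "z \<otimes> w"] le_funD[OF m(2), of z] le_funD[OF m(3), of w] by simp
    qed
    have "?u (z \<otimes> w) - ?u w \<le> ?u z"
    proof (rule greatest)
      fix p assume p: "p \<in> C"
      have "?u (z \<otimes> w) - p z \<le> ?u w" by (rule greatest) (use 1[OF p] in force)
      then show "?u (z \<otimes> w) - ?u w \<le> p z" by simp
    qed
    then show "?u (z \<otimes> w) \<le> ?u z + ?u w" by simp
  next
    fix z and n :: nat assume z: "z \<in> I"
    show "real n * ?u z \<le> ?u (z [^] n)"
    proof (rule greatest)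
      fix p assume p: "p \<in> C"
      have "real n * ?u z \<le> real n * p z" using lower[OF p] by (intro mult_left_mono) auto
      also have "\<dots> = p (z [^] n)" using gauge_pow[OF G[OF p] z] by simp
      finally show "real n * ?u z \<le> p (z [^] n)" .
    qed
  next
    fix z assume z: "z \<in> I"
    have e: "p (z \<otimes> x) = p z + 1" if "p \<in> C" for p using G[OF that] z unfolding gauges_def by blast
    have "?u (z \<otimes> x) - 1 \<le> ?u z" by (rule greatest) (use lower[of _ "z \<otimes> x"] e in force)
    moreover have "?u z + 1 \<le> ?u (z \<otimes> x)" by (rule greatest) (use lower[of _ z] e in force)
    ultimately show "?u (z \<otimes> x) = ?u z + 1" by simp
  qed
qed

text \<open>Zorn's lemma for the reversed order, so that a maximal element is a minimal gauge; the
  empty chain is bounded by any gauge.\<close>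

lemma gauges_minimal:
  assumes "gauges \<noteq> {}"
  obtains p where "p \<in> gauges" "\<And>q. q \<in> gauges \<Longrightarrow> q \<le> p \<Longrightarrow> q = p"
proof -
  have "\<exists>m\<in>gauges. \<forall>a\<in>gauges. a \<le> m \<longrightarrow> a = m"
  proof (rule predicate_Zorn)
    show "partial_order_on gauges (relation_of (\<lambda>p q. q \<le> p) gauges)"
      by (auto simp: partial_order_on_def preorder_on_def refl_on_def trans_def antisym_def relation_of_def)
    fix C assume C: "C \<in> Chains (relation_of (\<lambda>p q. q \<le> p) gauges)"
    then have sub: "C \<subseteq> gauges" and ch: "\<And>p q. p \<in> C \<Longrightarrow> q \<in> C \<Longrightarrow> p \<le> q \<or> q \<le> p"
      by (auto simp: Chains_def relation_of_def)
    show "\<exists>u\<in>gauges. \<forall>a\<in>C. u \<le> a"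
    proof (cases "C = {}")
      case False
      have "(\<lambda>z. INF p\<in>C. p z) \<le> a" if "a \<in> C" for a
      proof (rule le_funI, rule cINF_lower[OF _ that])
        show "bdd_below ((\<lambda>p. p z) ` C)" for z
          using gauge_nonneg sub by (auto intro!: bdd_belowI[of _ 0])
      qed
      then show ?thesis using gauges_chain_Inf[OF sub False ch] by blast
    qed (use assms in blast)
  qed
  then show thesis using that by blast
qed

lemma minimal_gauge_additive:
  assumes p: "p \<in> gauges" and min: "\<And>q. q \<in> gauges \<Longrightarrow> q \<le> p \<Longrightarrow> q = p"
    and zy: "z \<in> I" "y \<in> I"
  shows "p (z \<otimes> y) = p z + p y"
proof -
  note y = zy(2) and yc = ideal_carrier[OF zy(2)]
  note yp = ideal_pow[OF y]
  have mono: "p z \<le> p w" if "z \<in> I" "w \<in> I" "z \<preceq> w" for z w using p that unfolding gauges_def by blast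
  have sub: "p (z \<otimes> w) \<le> p z + p w" if "z \<in> I" "w \<in> I" for z w using p that unfolding gauges_def by blast
  have shift: "p (z \<otimes> x) = p z + 1" if "z \<in> I" for z using p that unfolding gauges_def by blast
  define D where "D z t = p (z \<otimes> y [^] t) - real t * p y" for z and t :: nat
  define q where "q z = (if z \<in> I then (INF t. D z t) else 0)" for z
  have D0: "0 \<le> D z t" if "z \<in> I" for z t
  proof -
    have "p (y [^] t) \<le> p (z \<otimes> y [^] t)"
      using that yc by (intro mono yp ideal_mult le_mult_left) (auto intro: ideal_carrier)
    then show ?thesis using gauge_pow[OF p y] by (simp add: D_def)
  qed
  have bdd: "bdd_below (range (D z))" if "z \<in> I" for z
    using D0[OF that] by (auto intro!: bdd_belowI[of _ 0])
  have lower: "q z \<le> D z t" if "z \<in> I" for z t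
    unfolding q_def using that bdd by (auto intro: cINF_lower)
  have greatest: "c \<le> q z" if "z \<in> I" "\<And>t. c \<le> D z t" for c z
    unfolding q_def using that by (auto intro: cINF_greatest)
  \<comment> \<open>Since \<open>D z\<close> decreases in t, the infimum may be tested at multiples
    \<open>t * n\<close>. The axiom on multiples needs this, as n (z + t y) = n z + (t n) y.\<close>
  have Dmono: "D z (t + k) \<le> D z t" if "z \<in> I" for z t k
  proof -
    have "p (z \<otimes> y [^] t \<otimes> y [^] k) \<le> p (z \<otimes> y [^] t) + real k * p y"
      using sub[of "z \<otimes> y [^] t" "y [^] k"] that yp gauge_pow[OF p y] ideal_mult by simp
    moreover have "z \<otimes> y [^] t \<otimes> y [^] k = z \<otimes> y [^] (t + k)"
      using that ideal_carrier yc by (simp add: m_assoc nat_pow_mult)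
    ultimately show ?thesis by (simp add: D_def algebra_simps)
  qed
  have "q \<in> gauges" unfolding gauges_def
  proof (intro CollectI conjI ballI allI impI)
    fix z assume "z \<notin> I" then show "q z = 0" by (simp add: q_def)
  next
    fix z w assume h: "z \<in> I" "w \<in> I" "z \<preceq> w"
    show "q z \<le> q w"
    proof (rule greatest[OF h(2)])
      fix t :: nat
      have "p (z \<otimes> y [^] t) \<le> p (w \<otimes> y [^] t)"
        using h yc by (intro mono yp ideal_mult le_add_right) (auto intro: ideal_carrier)
      then show "q z \<le> D w t" using lower[OF h(1), of t] by (simp add: D_def)
    qed
  next
    fix z w assume h: "z \<in> I" "w \<in> I"
    have 1: "q (z \<otimes> w) \<le> D z t + D w k" for t k
    proof -
      have "p ((z \<otimes> y [^] t) \<otimes> (w \<otimes> y [^] k)) \<le> p (z \<otimes> y [^] t) + p (w \<otimes> y [^] k)"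
        by (intro sub ideal_mult h yp)
      moreover have "(z \<otimes> y [^] t) \<otimes> (w \<otimes> y [^] k) = (z \<otimes> w) \<otimes> y [^] (t + k)"
        using h ideal_carrier yc by (simp add: m_ac flip: nat_pow_mult)
      ultimately have "D (z \<otimes> w) (t + k) \<le> D z t + D w k" by (simp add: D_def algebra_simps)
      then show ?thesis using lower[OF ideal_mult[OF h], of "t + k"] by simp
    qed
    have "q (z \<otimes> w) - q w \<le> q z"
    proof (rule greatest[OF h(1)])
      fix t :: nat
      have "q (z \<otimes> w) - D z t \<le> D w k" for k using 1[of t k] by simp
      then have "q (z \<otimes> w) - D z t \<le> q w" by (rule greatest[OF h(2)])
      then show "q (z \<otimes> w) - q w \<le> D z t" by simp
    qed
    then show "q (z \<otimes> w) \<le> q z + q w" by simp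
  next
    fix z and n :: nat assume z: "z \<in> I"
    show "real n * q z \<le> q (z [^] n)"
    proof (rule greatest[OF ideal_pow[OF z]])
      fix t :: nat
      show "real n * q z \<le> D (z [^] n) t"
      proof (cases n)
        case 0
        then show ?thesis using D0[OF ideal_pow[OF z], of n t] by simp
      next
        case (Suc m)
        have "D (z [^] n) (t * n) \<le> D (z [^] n) t"
          using Dmono[OF ideal_pow[OF z], of n t "t * m"] Suc by simp
        moreover have "z [^] n \<otimes> y [^] (t * n) = (z \<otimes> y [^] t) [^] n"
          using z ideal_carrier yc by (simp add: nat_pow_distrib nat_pow_pow)
        then have "D (z [^] n) (t * n) = real n * D z t"
          using gauge_pow[OF p, of "z \<otimes> y [^] t" n] z yp ideal_mult by (simp add: D_def algebra_simps)
        moreover have "real n * q z \<le> real n * D z t" using lower[OF z] by (intro mult_left_mono) auto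
        ultimately show ?thesis by simp
      qed
    qed
  next
    fix z assume z: "z \<in> I"
    have zx: "z \<otimes> x \<in> I" using ideal_mult z ideal_gen by blast
    have e: "D (z \<otimes> x) t = D z t + 1" for t
    proof -
      have "z \<otimes> x \<otimes> y [^] t = z \<otimes> y [^] t \<otimes> x" using z ideal_carrier yc x by (simp add: m_ac)
      then show ?thesis using shift[of "z \<otimes> y [^] t"] z yp ideal_mult by (simp add: D_def)
    qed
    have "q (z \<otimes> x) - 1 \<le> D z t" for t using lower[OF zx, of t] e[of t] by simp
    then have "q (z \<otimes> x) - 1 \<le> q z" by (rule greatest[OF z])
    moreover have "q z + 1 \<le> D (z \<otimes> x) t" for t using lower[OF z, of t] e[of t] by simp
    then have "q z + 1 \<le> q (z \<otimes> x)" by (rule greatest[OF zx])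
    ultimately show "q (z \<otimes> x) = q z + 1" by simp
  qed
  moreover have "q \<le> p"
  proof (rule le_funI)
    fix z show "q z \<le> p z"
    proof (cases "z \<in> I")
      case True
      then show ?thesis using lower[of z 0] ideal_carrier by (simp add: D_def)
    next
      case False
      then show ?thesis using p by (simp add: q_def gauges_def)
    qed
  qed
  ultimately have "q = p" using min by blast
  \<comment> \<open>At t = 1 the identity q = p gives p z + p y \<le> p (z + y), the half of
    additivity that subadditivity leaves open.\<close>
  then have "p z \<le> D z 1" using lower[OF zy(1), of 1] by simp
  then show ?thesis using sub[OF zy] yc by (simp add: D_def)
qed

text \<open>A minimal gauge, extended by infinity off the order ideal. The value at \<open>x\<close>
  comes from p (1 + x) = p 1 + 1 and p 1 = 0, where the 1 in the arguments is the neutral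
  element.\<close>

lemma exists_state:
  assumes "\<And>n::nat. \<not> x [^] (n + 1) \<preceq> x [^] n"
  obtains f where "monoid_state W f" "f x = 1"
proof -
  obtain p where p: "p \<in> gauges" and min: "\<And>q. q \<in> gauges \<Longrightarrow> q \<le> p \<Longrightarrow> q = p"
    using gauges_minimal[OF gauges_nonempty[OF assms]] by blast
  define f where "f z = (if z \<in> I then ennreal (p z) else \<infinity>)" for z
  have p1: "p \<one> = 0" by (rule gauge_one[OF p])
  have "monoid_state W f" unfolding monoid_state_def
  proof (intro conjI ballI impI)
    show "f \<one> = 0" using p1 ideal_one by (simp add: f_def)
    fix z w assume c: "z \<in> carrier W" "w \<in> carrier W"
    show "f (z \<otimes> w) = f z + f w"
      using minimal_gauge_additive[OF p min, of z w] ideal_mult_iff[OF c] gauge_nonneg[OF p]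
      by (auto simp: f_def simp flip: ennreal_plus)
    show "f z \<le> f w" if le: "z \<preceq> w"
    proof (cases "w \<in> I")
      case True
      then have "z \<in> I" using ideal_le le c by blast
      then have "p z \<le> p w" using p True le unfolding gauges_def by blast
      then show ?thesis using True \<open>z \<in> I\<close> by (simp add: f_def ennreal_leI)
    qed (simp add: f_def)
  qed
  moreover have "p (\<one> \<otimes> x) = p \<one> + 1" using p ideal_one unfolding gauges_def by blast
  then have "f x = 1" using x p1 ideal_gen by (simp add: f_def)
  ultimately show thesis using that by blast
qed

end

text \<open>Each surplus copy of \<open>x\<close> is absorbed by the n copies already
  present.\<close>

lemma pow_add_le_of_Suc_pow_le:
  assumes x: "x \<in> carrier W" and n: "x [^] (n + 1) \<preceq> x [^] (n::nat)"
  shows "x [^] (m + n) \<preceq> x [^] n"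
proof (induction m)
  case 0
  then show ?case using le_refl x by simp
next
  case (Suc m)
  have "x [^] (m + n) \<otimes> x \<preceq> x [^] n \<otimes> x" using le_add_right Suc x by simp
  then show ?case using le_trans[OF _ n] x by simp
qed

text \<open>Forwards, 2 y \<le> y absorbs all multiples of y, so x \<le> (n + 1) x \<le> n y \<le>
  y; and f x + f x \<le> f x leaves only the values 0 and infinity. Backwards this is Tarski's
  theorem.\<close>

lemma purely_infinite_iff:
  "purely_infinite_monoid W \<longleftrightarrow> almost_unperforated W \<and> \<not> (\<exists>f. nontrivial_state W f)"
proof
  assume pi: "purely_infinite_monoid W"
  have two: "x \<otimes> x \<preceq> x" if "x \<in> carrier W" for x
    using pi that by (auto simp: purely_infinite_monoid_def numeral_2_eq_2)
  have pw: "y [^] (n + 1) \<preceq> y" if "y \<in> carrier W" for y and n :: nat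
  proof (induction n)
    case 0
    then show ?case using le_refl that by simp
  next
    case (Suc n)
    have "y [^] (n + 1) \<otimes> y \<preceq> y \<otimes> y" using le_add_right Suc that by simp
    then have "y [^] (n + 1) \<otimes> y \<preceq> y" using le_trans[OF _ two[OF that]] that by simp
    then show ?case by simp
  qed
  have "almost_unperforated W" unfolding almost_unperforated_def
  proof (intro ballI impI)
    fix x y assume c: "x \<in> carrier W" "y \<in> carrier W"
      and "\<exists>n::nat. n \<ge> 1 \<and> x [^] (n + 1) \<preceq> y [^] n"
    then obtain n :: nat where n: "n \<ge> 1" "x [^] (n + 1) \<preceq> y [^] n" by blast
    have "x \<preceq> x [^] (n + 1)" using le_pow_mono[of 1 "n + 1" x] c by simp
    moreover have "y [^] n \<preceq> y" using pw[OF c(2), of "n - 1"] n(1) by simp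
    ultimately show "x \<preceq> y" using n(2) le_trans c by (meson nat_pow_closed)
  qed
  moreover have "\<not> nontrivial_state W f" for f
  proof
    assume "nontrivial_state W f"
    then obtain x where x: "x \<in> carrier W" "f x \<noteq> 0" "f x \<noteq> \<infinity>" "f (x \<otimes> x) = f x + f x" "f (x \<otimes> x) \<le> f x"
      using two unfolding nontrivial_state_def monoid_state_def by (metis m_closed)
    obtain a where "f x = ennreal a" "a \<ge> 0" using x(3) by (cases "f x") auto
    then show False using x by (auto simp flip: ennreal_plus)
  qed
  ultimately show "almost_unperforated W \<and> \<not> (\<exists>f. nontrivial_state W f)" by blast
next
  assume R: "almost_unperforated W \<and> \<not> (\<exists>f. nontrivial_state W f)"
  show "purely_infinite_monoid W" unfolding purely_infinite_monoid_def
  proof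
    fix x assume x: "x \<in> carrier W"
    have "\<exists>n::nat. x [^] (n + 1) \<preceq> x [^] n"
    proof (rule ccontr)
      assume "\<nexists>n::nat. x [^] (n + 1) \<preceq> x [^] n"
      then obtain f where f: "monoid_state W f" "f x = 1" using exists_state[OF x] by metis
      have "nontrivial_state W f" unfolding nontrivial_state_def using f x by (metis infinity_ennreal_def one_neq_zero ennreal_one_neq_top)
      then show False using R by blast
    qed
    then obtain n :: nat where n: "x [^] (n + 1) \<preceq> x [^] n" by blast
    \<comment> \<open>Here \<open>n\<close> may be 0, whereas almost unperforation asks for a
      positive number of copies; one more \<open>x\<close> on both sides repairs this.\<close>
    define k where "k = n + 1"
    have "x [^] (k + 1) \<preceq> x [^] k" using le_add_right[OF n] x by (simp add: k_def)
    \<comment> \<open>The number k + 2 is chosen so that the left side consists of k + 1 copies of 2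
      x.\<close>
    then have "x [^] (k + 2 + k) \<preceq> x [^] k" using pow_add_le_of_Suc_pow_le[OF x] by blast
    moreover have "(x [^] (2::nat)) [^] (k + 1) = x [^] (k + 2 + k)"
    proof -
      have "(x [^] (2::nat)) [^] (k + 1) = x [^] (2 * (k + 1))" by (rule nat_pow_pow[OF x])
      moreover have "2 * (k + 1) = k + 2 + k" by simp
      ultimately show ?thesis by (simp only:)
    qed
    ultimately have "(x [^] (2::nat)) [^] (k + 1) \<preceq> x [^] k" by simp
    moreover have "k \<ge> 1" by (simp add: k_def)
    ultimately show "x [^] (2::nat) \<preceq> x"
      using R x unfolding almost_unperforated_def by (meson nat_pow_closed)
  qed
qed

end

section \<open>Quotients of monoids of sequences\<close>

lemma (in pos_preordered_monoid) double_le_mult: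
  assumes "x \<otimes> x \<preceq> x" "y \<otimes> y \<preceq> y" and c: "x \<in> carrier W" "y \<in> carrier W"
  shows "(x \<otimes> y) \<otimes> (x \<otimes> y) \<preceq> x \<otimes> y"
proof -
  have "(x \<otimes> x) \<otimes> (y \<otimes> y) \<preceq> x \<otimes> y" using le_add assms by simp
  moreover have "(x \<otimes> x) \<otimes> (y \<otimes> y) = (x \<otimes> y) \<otimes> (x \<otimes> y)" using c by (simp add: m_ac)
  ultimately show ?thesis by simp
qed

text \<open>Treats both semigroups at once. \<open>L\<close> compares representatives, while
  \<open>le\<close> is the given order on classes, defined algebraically in one case and through
  some pair of representatives in the other; \<open>le_iff\<close> links the two.\<close>

locale seq_quotient =
  fixes P :: "'c \<Rightarrow> bool" and E :: "('c list \<times> 'c list) set" and z :: 'c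
    and L :: "'c list \<Rightarrow> 'c list \<Rightarrow> bool" and le :: "'c list set \<Rightarrow> 'c list set \<Rightarrow> bool"
    and seqs :: "'c list set"
  assumes seqs: "seqs = {a. a \<noteq> [] \<and> (\<forall>U\<in>set a. P U)}"
    and equivE: "equiv seqs E"
    and cong: "(a, a') \<in> E \<Longrightarrow> (b, b') \<in> E \<Longrightarrow> (a @ b, a' @ b') \<in> E"
    and comm: "a \<in> seqs \<Longrightarrow> b \<in> seqs \<Longrightarrow> (a @ b, b @ a) \<in> E"
    and zero: "P z"
    and neutral: "a \<in> seqs \<Longrightarrow> ([z] @ a, a) \<in> E"
    and le_iff: "a \<in> seqs \<Longrightarrow> b \<in> seqs \<Longrightarrow> le (E `` {a}) (E `` {b}) \<longleftrightarrow> L a b"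
    and L_refl: "a \<in> seqs \<Longrightarrow> L a a"
    and L_trans: "L a b \<Longrightarrow> L b c \<Longrightarrow> a \<in> seqs \<Longrightarrow> b \<in> seqs \<Longrightarrow> c \<in> seqs \<Longrightarrow> L a c"
    and L_append: "L a b \<Longrightarrow> a \<in> seqs \<Longrightarrow> b \<in> seqs \<Longrightarrow> c \<in> seqs \<Longrightarrow> L (a @ c) (b @ c)"
    and L_least: "a \<in> seqs \<Longrightarrow> L [z] a"
begin

definition quotient_monoid :: "'c list set preordered_monoid" where
  "quotient_monoid = \<lparr>carrier = seqs // E, monoid.mult = (\<lambda>X Y. \<Union>a\<in>X. \<Union>b\<in>Y. E `` {a @ b}),
     one = E `` {[z]}, pre_le = le\<rparr>"

abbreviation "M \<equiv> quotient_monoid"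
abbreviation "cls a \<equiv> E `` {a}"

lemma append_seqs: "a \<in> seqs \<Longrightarrow> b \<in> seqs \<Longrightarrow> a @ b \<in> seqs"
  by (auto simp: seqs)

lemma zero_seqs: "[z] \<in> seqs"
  using zero by (simp add: seqs)

lemma cls_mem: "a \<in> seqs \<Longrightarrow> cls a \<in> carrier M"
  by (simp add: quotient_monoid_def quotientI)

lemma carrier_cls: "x \<in> carrier M \<Longrightarrow> \<exists>a\<in>seqs. x = cls a"
  by (auto simp: quotient_monoid_def quotient_def)

lemma cls_eq: "(a, b) \<in> E \<Longrightarrow> cls a = cls b"
  using equivE equiv_class_eq by metis

lemma mult_cls:
  assumes "a \<in> seqs" "b \<in> seqs" shows "cls a \<otimes>\<^bsub>M\<^esub> cls b = cls (a @ b)"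
proof -
  have "cls (a' @ b') = cls (a @ b)" if "a' \<in> cls a" "b' \<in> cls b" for a' b'
    using cls_eq[OF cong, of a a' b b'] that by auto
  moreover have "a \<in> cls a" "b \<in> cls b" using equiv_class_self[OF equivE] assms by auto
  ultimately have "(\<Union>a'\<in>cls a. \<Union>b'\<in>cls b. cls (a' @ b')) = cls (a @ b)" by blast
  then show ?thesis by (simp add: quotient_monoid_def)
qed

lemma one_cls: "\<one>\<^bsub>M\<^esub> = cls [z]" and le_cls: "pre_le M = le"
  by (simp_all add: quotient_monoid_def)

sublocale pos_preordered_monoid M
proof unfold_locales
  fix x y assume c: "x \<in> carrier M" "y \<in> carrier M"
  then obtain a b where ab: "a \<in> seqs" "x = cls a" "b \<in> seqs" "y = cls b" using carrier_cls by metis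
  show "x \<otimes>\<^bsub>M\<^esub> y \<in> carrier M" using ab mult_cls append_seqs cls_mem by simp
  show "x \<otimes>\<^bsub>M\<^esub> y = y \<otimes>\<^bsub>M\<^esub> x" using ab mult_cls cls_eq[OF comm] by simp
  show "\<one>\<^bsub>M\<^esub> \<otimes>\<^bsub>M\<^esub> x = x" using ab mult_cls zero_seqs cls_eq[OF neutral] by (simp add: one_cls)
  have "cls (a @ [z]) = cls ([z] @ a)" by (rule cls_eq[OF comm]) (use ab zero_seqs in auto)
  then show "x \<otimes>\<^bsub>M\<^esub> \<one>\<^bsub>M\<^esub> = x" using ab mult_cls zero_seqs cls_eq[OF neutral] by (simp add: one_cls)
  show "pre_le M x x" using ab le_iff L_refl by (simp add: le_cls)
  show "pre_le M \<one>\<^bsub>M\<^esub> x" using ab le_iff L_least zero_seqs by (simp add: le_cls one_cls)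
  fix w assume "w \<in> carrier M"
  then obtain d where d: "d \<in> seqs" "w = cls d" using carrier_cls by metis
  show "x \<otimes>\<^bsub>M\<^esub> y \<otimes>\<^bsub>M\<^esub> w = x \<otimes>\<^bsub>M\<^esub> (y \<otimes>\<^bsub>M\<^esub> w)" using ab d mult_cls append_seqs by simp
  show "pre_le M (x \<otimes>\<^bsub>M\<^esub> w) (y \<otimes>\<^bsub>M\<^esub> w)" if "pre_le M x y"
    using that ab d mult_cls append_seqs le_iff L_append by (simp add: le_cls)
  show "pre_le M x w" if "pre_le M x y" "pre_le M y w"
    using that ab d le_iff L_trans[of a b d] by (simp add: le_cls)
next
  show "\<one>\<^bsub>M\<^esub> \<in> carrier M" by (simp add: one_cls cls_mem zero_seqs)
qed

lemmas quotient_purely_infinite_iff = purely_infinite_iff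

text \<open>A sequence is the sum of its one-term sequences and 2 (x + y) = 2 x + 2 y, so doubling
  the single terms is enough.\<close>

lemma purely_infinite_singletons:
  "purely_infinite_monoid M \<longleftrightarrow> (\<forall>U. P U \<longrightarrow> L [U, U] [U])"
proof -
  have sq: "x [^]\<^bsub>M\<^esub> (2::nat) = x \<otimes>\<^bsub>M\<^esub> x" if "x \<in> carrier M" for x
    using that by (simp add: numeral_2_eq_2)
  have single: "[U] \<in> seqs" "[U, U] \<in> seqs" if "P U" for U using that by (simp_all add: seqs)
  have dbl: "cls [U] \<otimes>\<^bsub>M\<^esub> cls [U] = cls [U, U]" if "P U" for U
    using mult_cls single[OF that] by simp
  show ?thesis
  proof
    assume pi: "purely_infinite_monoid M"
    show "\<forall>U. P U \<longrightarrow> L [U, U] [U]"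
    proof (intro allI impI)
      fix U assume U: "P U"
      have "pre_le M (cls [U] [^]\<^bsub>M\<^esub> (2::nat)) (cls [U])"
        using pi cls_mem[OF single(1)[OF U]] unfolding purely_infinite_monoid_def by blast
      then have "le (cls [U, U]) (cls [U])"
        using sq[OF cls_mem[OF single(1)[OF U]]] dbl[OF U] by (simp add: le_cls)
      then show "L [U, U] [U]" using le_iff single[OF U] by simp
    qed
  next
    assume R: "\<forall>U. P U \<longrightarrow> L [U, U] [U]"
    have one: "pre_le M (cls [U] \<otimes>\<^bsub>M\<^esub> cls [U]) (cls [U])" if "P U" for U
      using R that le_iff[OF single(2,1)[OF that]] dbl[OF that] by (simp add: le_cls)
    have "a \<noteq> [] \<Longrightarrow> a \<in> seqs \<Longrightarrow> pre_le M (cls a \<otimes>\<^bsub>M\<^esub> cls a) (cls a)" for a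
    proof (induction a rule: list_nonempty_induct)
      case (single U)
      then show ?case using one by (simp add: seqs)
    next
      case (cons U a)
      have U: "[U] \<in> seqs" "P U" and a: "a \<in> seqs" using cons by (auto simp: seqs)
      have "cls (U # a) = cls [U] \<otimes>\<^bsub>M\<^esub> cls a" using mult_cls[OF U(1) a] by simp
      then show ?case
        using double_le_mult[OF one[OF U(2)] cons.IH[OF a] cls_mem[OF U(1)] cls_mem[OF a]] by simp
    qed
    then have "pre_le M (cls a \<otimes>\<^bsub>M\<^esub> cls a) (cls a)" if "a \<in> seqs" for a
      using that by (simp add: seqs)
    then have "pre_le M (x \<otimes>\<^bsub>M\<^esub> x) x" if "x \<in> carrier M" for x
      using carrier_cls[OF that] by blast
    then show "purely_infinite_monoid M"
      by (simp add: purely_infinite_monoid_def sq)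
  qed
qed

end

section \<open>Ample groupoids\<close>

lemma compactin_Hausdorff_Diff:
  assumes "Hausdorff_space X" "compactin X A" "openin X B"
  shows "compactin X (A - B)"
  using assms by (metis Diff_eq closed_Int_compactin closedin_def Int_Diff Diff_subset Diff_Diff_Int
      closed_compactin closedin_diff compactin_imp_closedin)

locale ample_groupoid = topological_groupoid +
  assumes Hausdorff: "Hausdorff_space (arrow_top G)"
    and etale: "etale G"
    and ample: "ample G"
begin

abbreviation "X \<equiv> arrow_top G"
abbreviation "s \<equiv> src G"
abbreviation "r \<equiv> rng G"

lemma composable_ginv': "x \<in> arrows G \<Longrightarrow> (ginv G x, x) \<in> composable G"
  using composable_ginv[of "ginv G x"] ginv_closed ginv_ginv by simp

lemma src_closed [simp]: "x \<in> arrows G \<Longrightarrow> s x \<in> arrows G"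
  unfolding src_def using gmult_closed composable_ginv' by blast

lemma rng_closed [simp]: "x \<in> arrows G \<Longrightarrow> r x \<in> arrows G"
  unfolding rng_def using gmult_closed composable_ginv by blast

declare ginv_closed [simp] ginv_ginv [simp]

lemma rng_ginv [simp]: "x \<in> arrows G \<Longrightarrow> r (ginv G x) = s x"
  unfolding rng_def src_def by simp

lemma src_ginv [simp]: "x \<in> arrows G \<Longrightarrow> s (ginv G x) = r x"
  unfolding rng_def src_def by simp

lemma composable_arrows: "(x, y) \<in> composable G \<Longrightarrow> x \<in> arrows G \<and> y \<in> arrows G"
  using composable_subset by auto

text \<open>Left cancellation gives (x^-1 x) y = y. Multiplying both sides by y^-1 on the right
  leaves x^-1 x on one side and y y^-1 on the other.\<close>

lemma src_eq_rng:
  assumes "(x, y) \<in> composable G" shows "s x = r y"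
proof -
  have xy: "x \<in> arrows G" "y \<in> arrows G" using composable_arrows[OF assms] by auto
  have c: "(ginv G x, x) \<in> composable G" using composable_ginv' xy by blast
  have "gmult G (gmult G (ginv G x) x) y = y"
    using gmult_assoc[OF c assms] ginv_cancel_left[OF assms] by simp
  moreover have "gmult G (gmult G (gmult G (ginv G x) x) y) (ginv G y) = gmult G (ginv G x) x"
    by (rule ginv_cancel_right[OF composable_left[OF c assms]])
  ultimately show ?thesis unfolding src_def rng_def by simp
qed

text \<open>With e = s x = r y both (x, e) and (e, y) are composable and e y = y, hence (x, y) is
  composable.\<close>

lemma composable_iff:
  "(x, y) \<in> composable G \<longleftrightarrow> x \<in> arrows G \<and> y \<in> arrows G \<and> s x = r y"
proof
  assume h: "x \<in> arrows G \<and> y \<in> arrows G \<and> s x = r y"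
  have 1: "(x, gmult G (ginv G x) x) \<in> composable G"
    using composable_right[OF composable_ginv composable_ginv'] h by blast
  have 2: "(gmult G y (ginv G y), y) \<in> composable G"
    using composable_left[OF composable_ginv composable_ginv'] h by blast
  have "gmult G (gmult G y (ginv G y)) y = y"
    using gmult_assoc[OF composable_ginv composable_ginv', of y] ginv_cancel_left[OF composable_ginv', of y] h by simp
  then show "(x, y) \<in> composable G"
    using composable_right[of x "gmult G y (ginv G y)" y] 1 2 h unfolding src_def rng_def by simp
qed (use composable_arrows src_eq_rng in blast)

lemma gmult_closed' [simp]:
  "x \<in> arrows G \<Longrightarrow> y \<in> arrows G \<Longrightarrow> s x = r y \<Longrightarrow> gmult G x y \<in> arrows G"
  using gmult_closed composable_iff by blast

lemma src_gmult [simp]: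
  assumes "x \<in> arrows G" "y \<in> arrows G" "s x = r y" shows "s (gmult G x y) = s y"
proof -
  have "(gmult G x y, ginv G y) \<in> composable G"
    using assms composable_left composable_iff composable_ginv by blast
  then show ?thesis using src_eq_rng assms by fastforce
qed

lemma rng_gmult [simp]:
  assumes "x \<in> arrows G" "y \<in> arrows G" "s x = r y" shows "r (gmult G x y) = r x"
proof -
  have "(ginv G x, gmult G x y) \<in> composable G"
    using assms composable_right composable_iff composable_ginv' by blast
  then show ?thesis using src_eq_rng assms by fastforce
qed

lemma gmult_ginv_cancel [simp]:
  assumes "x \<in> arrows G" "y \<in> arrows G" "s x = s y"
  shows "gmult G (gmult G x (ginv G y)) y = x"
  using ginv_cancel_right[of x "ginv G y"] assms composable_iff by simp

lemma gmult_ginv_cancel' [simp]: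
  assumes "x \<in> arrows G" "y \<in> arrows G" "s x = r y"
  shows "gmult G (gmult G x y) (ginv G y) = x"
  using ginv_cancel_right[of x y] assms composable_iff by simp

lemma src_src [simp]: "x \<in> arrows G \<Longrightarrow> s (s x) = s x"
  using src_gmult[of "ginv G x" x] by (simp add: src_def[of G x])

lemma rng_src [simp]: "x \<in> arrows G \<Longrightarrow> r (s x) = s x"
  using rng_gmult[of "ginv G x" x] by (simp add: src_def[of G x])

lemma src_rng [simp]: "x \<in> arrows G \<Longrightarrow> s (r x) = r x"
  using src_src[of "ginv G x"] by simp

lemma src_units [simp]: "x \<in> arrows G \<Longrightarrow> s x \<in> units G"
  by (simp add: units_def)

lemma rng_units [simp]: "x \<in> arrows G \<Longrightarrow> r x \<in> units G"
  using src_units[of "ginv G x"] by simp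

lemma units_arrows: "units G \<subseteq> arrows G"
  by (auto simp: units_def)

lemma src_of_unit [simp]: "u \<in> units G \<Longrightarrow> s u = u"
  and rng_of_unit [simp]: "u \<in> units G \<Longrightarrow> r u = u"
  by (auto simp: units_def)

lemma topspace_unit_top [simp]: "topspace (unit_top G) = units G"
  unfolding unit_top_def using units_arrows by auto

section \<open>Continuity and openness of the source and range maps\<close>

lemma continuous_rng: "continuous_map X (unit_top G) r"
proof -
  have id: "continuous_map X X (\<lambda>x. x)" by simp
  have "continuous_map X (subtopology (prod_topology X X) (composable G)) (\<lambda>x. (x, ginv G x))"
    using id continuous_ginv composable_ginv
    by (intro continuous_map_into_subtopology) (auto simp: continuous_map_paired)
  then have "continuous_map X X ((\<lambda>(x, y). gmult G x y) \<circ> (\<lambda>x. (x, ginv G x)))"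
    using continuous_gmult continuous_map_compose by blast
  then have "continuous_map X X r" by (simp add: o_def rng_def[abs_def])
  then show ?thesis unfolding unit_top_def by (intro continuous_map_into_subtopology) auto
qed

lemma continuous_src: "continuous_map X (unit_top G) s"
proof -
  have "continuous_map X (unit_top G) (r \<circ> ginv G)"
    using continuous_ginv continuous_rng continuous_map_compose by blast
  then show ?thesis by (rule continuous_map_eq) simp
qed

lemma homeomorphic_ginv: "homeomorphic_map X X (ginv G)"
  by (simp add: continuous_ginv homeomorphic_map_involution)

lemma openin_ginv: "openin X U \<Longrightarrow> openin X (ginv G ` U)"
  using homeomorphic_ginv homeomorphic_map_openness openin_subset by blast

lemma open_rng:
  assumes U: "openin X U" shows "openin (unit_top G) (r ` U)"
proof (subst openin_subopen, intro ballI)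
  fix y assume "y \<in> r ` U"
  then obtain x where x: "x \<in> U" "y = r x" by auto
  have xX: "x \<in> topspace X" using U x openin_subset by blast
  obtain V where V: "openin X V" "x \<in> V" "openin (unit_top G) (r ` V)"
    "homeomorphic_map (subtopology X V) (subtopology (unit_top G) (r ` V)) r"
    using etale xX unfolding etale_def local_homeomorphism_def by blast
  have "openin (subtopology X V) (U \<inter> V)" using U V(1) by (simp add: openin_open_subtopology openin_Int)
  then have "openin (subtopology (unit_top G) (r ` V)) (r ` (U \<inter> V))"
    using V(4) homeomorphic_map_openness openin_subset by metis
  then have "openin (unit_top G) (r ` (U \<inter> V))" using V(3) openin_open_subtopology by blast
  then show "\<exists>T. openin (unit_top G) T \<and> y \<in> T \<and> T \<subseteq> r ` U" using x V(2) by blast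
qed

text \<open>Near a unit the range map is injective. If x and r x both lie in such a neighbourhood,
  then r (r x) = r x forces x = r x, so x is a unit.\<close>

lemma openin_units: "openin X (units G)"
proof (subst openin_subopen, intro ballI)
  fix u assume u: "u \<in> units G"
  then have uX: "u \<in> arrows G" using units_arrows by blast
  obtain V where V: "openin X V" "u \<in> V" "openin (unit_top G) (r ` V)"
    "homeomorphic_map (subtopology X V) (subtopology (unit_top G) (r ` V)) r"
    using etale uX unfolding etale_def local_homeomorphism_def by blast
  have Vs: "V \<subseteq> arrows G" using V(1) openin_subset by blast
  have inj: "inj_on r V" using V(4) Vs homeomorphic_imp_injective_map by (metis topspace_subtopology_subset)
  define T where "T = {x \<in> V. r x \<in> V}"
  have "continuous_map X X r" using continuous_rng unfolding unit_top_def
    using continuous_map_into_fulltopology by blast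
  then have "openin X T" unfolding T_def using V(1) openin_continuous_map_preimage_gen by blast
  moreover have "u \<in> T" using u V(2) by (simp add: T_def)
  moreover have "T \<subseteq> units G"
  proof
    fix x assume "x \<in> T"
    then have x: "x \<in> V" "r x \<in> V" "x \<in> arrows G" using Vs by (auto simp: T_def)
    then have "r x = x" using inj_onD[OF inj, of "r x" x] by simp
    then show "x \<in> units G" using rng_units x(3) by metis
  qed
  ultimately show "\<exists>T. openin X T \<and> u \<in> T \<and> T \<subseteq> units G" by blast
qed

lemma openin_unit_top: "openin (unit_top G) U \<longleftrightarrow> openin X U \<and> U \<subseteq> units G"
  unfolding unit_top_def using openin_units openin_open_subtopology by blast

lemma compactin_unit_top: "compactin (unit_top G) K \<longleftrightarrow> compactin X K \<and> K \<subseteq> units G"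
  unfolding unit_top_def by (simp add: compactin_subtopology)

lemma open_src:
  assumes U: "openin X U" shows "openin (unit_top G) (s ` U)"
proof -
  have "U \<subseteq> arrows G" using U openin_subset by blast
  then have "s ` U = r ` ginv G ` U" by (force simp: image_image)
  then show ?thesis using open_rng openin_ginv U by simp
qed

lemma homeomorphic_map_of_open:
  assumes U: "openin X U" and inj: "inj_on f U"
    and f: "continuous_map X (unit_top G) f" "\<And>V. openin X V \<Longrightarrow> openin (unit_top G) (f ` V)"
  shows "homeomorphic_map (subtopology X U) (subtopology (unit_top G) (f ` U)) f"
proof (rule bijective_open_imp_homeomorphic_map)
  have Us: "U \<subseteq> arrows G" using U openin_subset by blast
  have im: "f ` U \<subseteq> units G" using f(2)[OF U] by (simp add: openin_unit_top)
  show "continuous_map (subtopology X U) (subtopology (unit_top G) (f ` U)) f"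
    using Us by (intro continuous_map_into_subtopology continuous_map_from_subtopology f(1)) auto
  show "open_map (subtopology X U) (subtopology (unit_top G) (f ` U)) f"
    using f(2) U by (auto simp: open_map_def openin_open_subtopology)
  show "f ` topspace (subtopology X U) = topspace (subtopology (unit_top G) (f ` U))"
    using Us im by (auto simp: Int_absorb1)
  show "inj_on f (topspace (subtopology X U))" using inj Us by (simp add: Int_absorb1)
qed

text \<open>The source and range maps are continuous and open, so of all the homeomorphism
  conditions only injectivity remains.\<close>

lemma open_bisection_iff:
  "open_bisection G U \<longleftrightarrow> openin X U \<and> inj_on s U \<and> inj_on r U"
proof
  assume L: "open_bisection G U"
  then have "U \<subseteq> arrows G" using openin_subset open_bisection_def by blast
  then show "openin X U \<and> inj_on s U \<and> inj_on r U"
    using L homeomorphic_imp_injective_map unfolding open_bisection_def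
    by (metis topspace_subtopology_subset)
next
  assume R: "openin X U \<and> inj_on s U \<and> inj_on r U"
  then show "open_bisection G U" unfolding open_bisection_def
    by (simp add: open_src open_rng homeomorphic_map_of_open continuous_src continuous_rng)
qed

section \<open>Compact open sets of arrows\<close>

definition compact_open :: "'a set \<Rightarrow> bool" where
  "compact_open A \<longleftrightarrow> compactin X A \<and> openin X A"

lemma compact_open_arrows: "compact_open A \<Longrightarrow> A \<subseteq> arrows G"
  unfolding compact_open_def using openin_subset by blast

lemma compact_open_empty [simp]: "compact_open {}" by (simp add: compact_open_def)

lemma compact_open_Un: "compact_open A \<Longrightarrow> compact_open B \<Longrightarrow> compact_open (A \<union> B)"
  by (simp add: compact_open_def compactin_Un openin_Un)

lemma compact_open_UN: "finite I \<Longrightarrow> (\<And>i. i \<in> I \<Longrightarrow> compact_open (A i)) \<Longrightarrow> compact_open (\<Union>i\<in>I. A i)"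
  by (induction I rule: finite_induct) (auto intro: compact_open_Un)

lemma compact_open_closed: "compact_open A \<Longrightarrow> closedin X A"
  using Hausdorff compact_open_def compactin_imp_closedin by blast

lemma compact_open_Diff: "compact_open A \<Longrightarrow> compact_open B \<Longrightarrow> compact_open (A - B)"
  using compact_open_closed compactin_Hausdorff_Diff[OF Hausdorff] openin_diff unfolding compact_open_def by blast

lemma compact_open_Int: "compact_open A \<Longrightarrow> compact_open B \<Longrightarrow> compact_open (A \<inter> B)"
  using compact_open_Diff[of A "A - B"] compact_open_Diff[of A B] by (simp add: Diff_Diff_Int)

lemma compact_open_unit_set_iff: "compact_open_unit_set G A \<longleftrightarrow> compact_open A \<and> A \<subseteq> units G"
  unfolding compact_open_unit_set_def compact_open_def openin_unit_top compactin_unit_top by blast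

lemma compact_open_bisection_iff:
  "compact_open_bisection G U \<longleftrightarrow> compact_open U \<and> inj_on s U \<and> inj_on r U"
  unfolding compact_open_bisection_def open_bisection_iff compact_open_def by blast

lemma compact_open_src: "compact_open A \<Longrightarrow> compact_open (s ` A)" and compact_open_rng: "compact_open A \<Longrightarrow> compact_open (r ` A)"
  using open_src[of A] open_rng[of A] image_compactin[OF _ continuous_src, of A]
    image_compactin[OF _ continuous_rng, of A]
  by (simp_all add: compact_open_def openin_unit_top compactin_unit_top)

lemma compact_open_ginv: "compact_open A \<Longrightarrow> compact_open (ginv G ` A)"
  using openin_ginv[of A] image_compactin[OF _ continuous_ginv, of A] by (simp add: compact_open_def)

lemma bisection_basis:
  assumes "openin X U" "x \<in> U"
  shows "\<exists>B. compact_open_bisection G B \<and> x \<in> B \<and> B \<subseteq> U"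
proof -
  have "(arbitrary union_of (compact_open_bisection G)) U" using ample assms ample_def by metis
  then show ?thesis using assms(2) unfolding union_of_def arbitrary_def by blast
qed

text \<open>Finitely many basic compact open sets inside \<open>U\<close> cover \<open>K\<close>. In
  the comparison relations this replaces compact test sets by compact open ones.\<close>

lemma compact_open_between:
  assumes K: "compactin X K" and U: "openin X U" "K \<subseteq> U"
  shows "\<exists>C. compact_open C \<and> K \<subseteq> C \<and> C \<subseteq> U"
proof -
  let ?\<U> = "{C. compact_open C \<and> C \<subseteq> U}"
  have "\<exists>\<F>. finite \<F> \<and> \<F> \<subseteq> ?\<U> \<and> K \<subseteq> \<Union>\<F>"
  proof (rule compactinD[OF K])
    show "K \<subseteq> \<Union>?\<U>" using bisection_basis[OF U(1)] U(2) compact_open_bisection_iff by blast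
  qed (simp add: compact_open_def)
  then obtain \<F> where F: "finite \<F>" "\<F> \<subseteq> ?\<U>" "K \<subseteq> \<Union>\<F>" by blast
  then have "compact_open (\<Union>\<F>)" using compact_open_UN[of \<F> id] by auto
  then show ?thesis using F by blast
qed

text \<open>The source map is a homeomorphism on \<open>W\<close>, so compactness of
  \<open>C\<close> pulls back.\<close>

lemma compact_open_restrict_src:
  assumes W: "openin X W" "inj_on s W" and C: "compact_open C" "C \<subseteq> s ` W"
  shows "compact_open {x \<in> W. s x \<in> C}"
proof -
  have Ws: "W \<subseteq> arrows G" using W(1) openin_subset by blast
  have h: "homeomorphic_map (subtopology X W) (subtopology (unit_top G) (s ` W)) s"
    by (intro homeomorphic_map_of_open W continuous_src open_src)
  have eq: "s ` {x \<in> W. s x \<in> C} = C" using C(2) by auto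
  have cont: "continuous_map X X s" using continuous_src unfolding unit_top_def
    using continuous_map_into_fulltopology by blast
  have "openin X {x \<in> W. s x \<in> C}"
    using openin_continuous_map_preimage_gen[OF cont W(1)] C(1) compact_open_def by blast
  moreover have "compactin (subtopology (unit_top G) (s ` W)) C"
    using C open_src[OF W(1)] by (auto simp: compactin_subtopology compactin_unit_top compact_open_def openin_unit_top)
  then have "compactin (subtopology X W) {x \<in> W. s x \<in> C}"
    using homeomorphic_map_compactness[OF h, of "{x \<in> W. s x \<in> C}"] eq Ws by auto
  ultimately show ?thesis by (simp add: compact_open_def compactin_subtopology)
qed

section \<open>Products with compact open bisections\<close>

definition gprod :: "'a set \<Rightarrow> 'a set \<Rightarrow> 'a set" where
  "gprod A B = {gmult G x y | x y. x \<in> A \<and> y \<in> B \<and> s x = r y}"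

text \<open>Multiplies x by the arrow of \<open>B\<close> that ends at s x; this arrow is unique
  when \<open>r\<close> is injective on \<open>B\<close>.\<close>

definition right_translate :: "'a set \<Rightarrow> 'a \<Rightarrow> 'a" where
  "right_translate B x = gmult G x (inv_into B r (s x))"

text \<open>Choosing the arrow in \<open>B\<close> inverts the homeomorphism \<open>r\<close> on
  \<open>B\<close>, hence is continuous; multiplication is continuous as well.\<close>

lemma continuous_right_translate:
  assumes B: "openin X B" "inj_on r B"
  shows "continuous_map (subtopology X {x \<in> arrows G. s x \<in> r ` B}) X (right_translate B)"
proof -
  let ?D = "subtopology X {x \<in> arrows G. s x \<in> r ` B}"
  let ?t = "inv_into B r"
  have Bs: "B \<subseteq> arrows G" using B(1) openin_subset by blast
  have h: "homeomorphic_map (subtopology X B) (subtopology (unit_top G) (r ` B)) r"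
    by (intro homeomorphic_map_of_open B continuous_rng open_rng)
  then obtain g where g: "homeomorphic_maps (subtopology X B) (subtopology (unit_top G) (r ` B)) r g"
    using homeomorphic_map_maps by blast
  have gt: "g y = ?t y" if y: "y \<in> r ` B" for y
  proof -
    obtain b where b: "b \<in> B" "y = r b" using y by blast
    have "g (r b) = b" using g b(1) Bs unfolding homeomorphic_maps_def by auto
    then show ?thesis using b B(2) by simp
  qed
  have rB: "r ` B \<subseteq> units G" using Bs by auto
  have "continuous_map (subtopology (unit_top G) (r ` B)) X ?t"
  proof (rule continuous_map_eq)
    show "continuous_map (subtopology (unit_top G) (r ` B)) X g"
      using g unfolding homeomorphic_maps_def using continuous_map_into_fulltopology by blast
  qed (use gt in auto)
  moreover have "continuous_map ?D (subtopology (unit_top G) (r ` B)) s"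
    by (intro continuous_map_into_subtopology continuous_map_from_subtopology continuous_src) auto
  ultimately have 1: "continuous_map ?D X (?t \<circ> s)" using continuous_map_compose by blast
  have t: "?t (s x) \<in> B \<and> r (?t (s x)) = s x" if "s x \<in> r ` B" for x
    using that f_inv_into_f inv_into_into by metis
  have "continuous_map ?D (subtopology (prod_topology X X) (composable G)) (\<lambda>x. (x, (?t \<circ> s) x))"
  proof (rule continuous_map_into_subtopology)
    show "continuous_map ?D (prod_topology X X) (\<lambda>x. (x, (?t \<circ> s) x))"
      using 1 by (simp add: continuous_map_paired continuous_map_from_subtopology o_def)
    show "(\<lambda>x. (x, (?t \<circ> s) x)) \<in> topspace ?D \<rightarrow> composable G"
      using t Bs by (fastforce simp: composable_iff)
  qed
  then have "continuous_map ?D X ((\<lambda>(x, y). gmult G x y) \<circ> (\<lambda>x. (x, (?t \<circ> s) x)))"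
    using continuous_gmult continuous_map_compose by blast
  then show ?thesis by (simp add: o_def right_translate_def[abs_def])
qed

text \<open>Right translation by a bisection \<open>B\<close> is a partial homeomorphism whose inverse is right
  translation by \<open>B\<^sup>-\<^sup>1\<close>, so \<open>A B\<close> is both a continuous image and a continuous preimage of \<open>A\<close>.\<close>

lemma compact_open_gprod:
  assumes A: "compact_open A" and B: "compact_open B" "inj_on s B" "inj_on r B"
  shows "compact_open (gprod A B)"
proof -
  have Bo: "openin X B" using B compact_open_def by blast
  have As: "A \<subseteq> arrows G" and Bs: "B \<subseteq> arrows G" using A B compact_open_arrows by auto
  let ?D = "{x \<in> arrows G. s x \<in> r ` B}"
  let ?B = "ginv G ` B" let ?E = "{x \<in> arrows G. s x \<in> s ` B}"
  have rB: "r ` ?B = s ` B" using Bs by (force simp: image_image)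
  have injB: "inj_on r ?B" 
  proof (rule inj_onI)
    fix a b assume ab: "a \<in> ?B" "b \<in> ?B" "r a = r b"
    then obtain x y where xy: "x \<in> B" "a = ginv G x" "y \<in> B" "b = ginv G y" by blast
    moreover have "x \<in> arrows G" "y \<in> arrows G" using xy Bs by auto
    ultimately have "s x = s y" using ab by simp
    then have "x = y" using inj_onD[OF B(2)] xy by blast
    then show "a = b" using xy by simp
  qed
  have cont: "continuous_map X X s" using continuous_src unfolding unit_top_def
    using continuous_map_into_fulltopology by blast
  have eq1: "gprod A B = right_translate B ` (A \<inter> ?D)"
  proof -
    have *: "gmult G x y = right_translate B x" if "x \<in> A" "y \<in> B" "s x = r y" for x y
      using that B(3) by (simp add: right_translate_def)
    have **: "inv_into B r (s x) \<in> B \<and> s x = r (inv_into B r (s x))" if "s x \<in> r ` B" for x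
      using that f_inv_into_f inv_into_into by metis
    show ?thesis
    proof (intro equalityI subsetI)
      fix z assume "z \<in> gprod A B"
      then obtain x y where xy: "x \<in> A" "y \<in> B" "s x = r y" "z = gmult G x y"
        unfolding gprod_def by blast
      then have "z = right_translate B x" "x \<in> A \<inter> ?D"
        using * As by auto
      then show "z \<in> right_translate B ` (A \<inter> ?D)" by blast
    next
      fix z assume "z \<in> right_translate B ` (A \<inter> ?D)"
      then obtain x where x: "x \<in> A" "s x \<in> r ` B" "z = right_translate B x" by blast
      then show "z \<in> gprod A B" using **[OF x(2)] unfolding gprod_def right_translate_def by blast
    qed
  qed
  \<comment> \<open>From z = x y the factor x is recovered as z y^-1. This form gives openness, the
    previous one compactness.\<close>
  have eq2: "gprod A B = {z \<in> ?E. right_translate ?B z \<in> A}"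
  proof (intro equalityI subsetI)
    fix z assume "z \<in> gprod A B"
    then obtain x y where xy: "x \<in> A" "y \<in> B" "s x = r y" "z = gmult G x y"
      unfolding gprod_def by blast
    have a: "x \<in> arrows G" "y \<in> arrows G" using xy As Bs by auto
    have "inv_into ?B r (s z) = ginv G y"
      using xy a inv_into_f_f[OF injB, of "ginv G y"] by simp
    then show "z \<in> {z \<in> ?E. right_translate ?B z \<in> A}"
      using xy a by (simp add: right_translate_def)
  next
    fix z assume "z \<in> {z \<in> ?E. right_translate ?B z \<in> A}"
    then obtain y where y: "z \<in> arrows G" "y \<in> B" "s z = s y" "right_translate ?B z \<in> A" by auto
    have a: "y \<in> arrows G" using y Bs by auto
    have "inv_into ?B r (s z) = ginv G y"
      using y a inv_into_f_f[OF injB, of "ginv G y"] by simp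
    then have "gmult G z (ginv G y) \<in> A" using y(4) by (simp add: right_translate_def)
    moreover have "z = gmult G (gmult G z (ginv G y)) y" using y a by simp
    moreover have "s (gmult G z (ginv G y)) = r y" using y a by simp
    ultimately show "z \<in> gprod A B" unfolding gprod_def using y(2) by blast
  qed
  have "closedin X ?D"
    using closedin_continuous_map_preimage[OF cont] compact_open_closed compact_open_rng B(1) by blast
  then have "compactin X (A \<inter> ?D)"
    using A compact_open_def compact_Int_closedin by blast
  then have "compactin (subtopology X ?D) (A \<inter> ?D)" by (simp add: compactin_subtopology)
  then have 1: "compactin X (gprod A B)"
    unfolding eq1 using continuous_right_translate[OF Bo B(3)] image_compactin by blast
  have oE: "openin X ?E" using openin_continuous_map_preimage[OF cont] compact_open_src B(1) compact_open_def by blast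
  have c: "continuous_map (subtopology X ?E) X (right_translate ?B)"
    using continuous_right_translate[OF openin_ginv[OF Bo] injB] by (simp only: rB)
  have "openin (subtopology X ?E) {z \<in> topspace (subtopology X ?E). right_translate ?B z \<in> A}"
    using openin_continuous_map_preimage[OF c] A by (simp only: compact_open_def)
  moreover have "topspace (subtopology X ?E) = ?E" by auto
  ultimately have "openin (subtopology X ?E) (gprod A B)"
    by (simp only: eq2)
  then show ?thesis using 1 openin_open_subtopology[OF oE, of "gprod A B"] by (simp only: compact_open_def)
qed

end

section \<open>Equidecomposition of tagged sets of units\<close>

definition slice :: "('a \<times> 't) set \<Rightarrow> 't \<Rightarrow> 'a set" where
  "slice P t = {x. (x, t) \<in> P}"

lemma mem_slice [simp]: "x \<in> slice P t \<longleftrightarrow> (x, t) \<in> P"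
  by (simp add: slice_def)

lemma slice_Un: "slice (P \<union> Q) t = slice P t \<union> slice Q t"
  and slice_Diff: "slice (P - Q) t = slice P t - slice Q t"
  and slice_Int: "slice (P \<inter> Q) t = slice P t \<inter> slice Q t"
  and slice_Times: "slice (A \<times> I) t = (if t \<in> I then A else {})"
  by (auto simp: slice_def)

lemma slice_tagged_union: "slice (tagged_union a) l = (if l < length a then a ! l else {})"
  by (auto simp: slice_def tagged_union_def)

lemma mem_tagged_union: "(x, l) \<in> tagged_union a \<longleftrightarrow> l < length a \<and> x \<in> a ! l"
  by (auto simp: tagged_union_def)

context ample_groupoid
begin

text \<open>Compact openness in a product with a discrete space. The tags are levels for sets of
  units and pairs of levels for sets of arrows.\<close>

definition tagged_compact_open :: "('a \<times> 't) set \<Rightarrow> bool" where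
  "tagged_compact_open P \<longleftrightarrow> finite (snd ` P) \<and> (\<forall>t. compact_open (slice P t))"

definition unit_compact_open :: "('a \<times> 't) set \<Rightarrow> bool" where
  "unit_compact_open P \<longleftrightarrow> tagged_compact_open P \<and> P \<subseteq> units G \<times> UNIV"

lemma tagged_compact_open_Un: "tagged_compact_open P \<Longrightarrow> tagged_compact_open Q \<Longrightarrow> tagged_compact_open (P \<union> Q)"
  by (simp add: tagged_compact_open_def slice_Un compact_open_Un image_Un)

lemma tagged_compact_open_Diff: "tagged_compact_open P \<Longrightarrow> tagged_compact_open Q \<Longrightarrow> tagged_compact_open (P - Q)"
  unfolding tagged_compact_open_def slice_Diff
  by (blast intro: compact_open_Diff finite_subset[of "snd ` (P - Q)" "snd ` P"])

lemma tagged_compact_open_Times: "compact_open A \<Longrightarrow> finite I \<Longrightarrow> tagged_compact_open (A \<times> I)"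
  unfolding tagged_compact_open_def slice_Times by (simp add: finite_subset[of _ I] image_subset_iff)

lemma unit_compact_open_Un: "unit_compact_open P \<Longrightarrow> unit_compact_open Q \<Longrightarrow> unit_compact_open (P \<union> Q)"
  by (simp add: unit_compact_open_def tagged_compact_open_Un)

lemma unit_compact_open_Diff: "unit_compact_open P \<Longrightarrow> unit_compact_open Q \<Longrightarrow> unit_compact_open (P - Q)"
  unfolding unit_compact_open_def using tagged_compact_open_Diff by blast

lemma unit_compact_open_Times: "compact_open A \<Longrightarrow> A \<subseteq> units G \<Longrightarrow> finite I \<Longrightarrow> unit_compact_open (A \<times> I)"
  unfolding unit_compact_open_def using tagged_compact_open_Times by blast

lemma tagged_compact_open_arrows: "tagged_compact_open P \<Longrightarrow> (x, t) \<in> P \<Longrightarrow> x \<in> arrows G"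
  unfolding tagged_compact_open_def using compact_open_arrows[of "slice P t"] by auto

text \<open>A triple \<open>(x, i, k)\<close> stands for the arrow \<open>x\<close> leading from level \<open>i\<close> to level \<open>k\<close>.\<close>

definition tsrc :: "'a \<times> nat \<times> nat \<Rightarrow> 'a \<times> nat" where "tsrc = (\<lambda>(x, i, k). (s x, i))"
definition trng :: "'a \<times> nat \<times> nat \<Rightarrow> 'a \<times> nat" where "trng = (\<lambda>(x, i, k). (r x, k))"

lemma tsrc_simp [simp]: "tsrc (x, i, k) = (s x, i)" and trng_simp [simp]: "trng (x, i, k) = (r x, k)"
  by (simp_all add: tsrc_def trng_def)

definition tbisection :: "('a \<times> nat \<times> nat) set \<Rightarrow> bool" where
  "tbisection S \<longleftrightarrow> tagged_compact_open S \<and> inj_on tsrc S \<and> inj_on trng S"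

definition equidec :: "('a \<times> nat) set \<Rightarrow> ('a \<times> nat) set \<Rightarrow> bool" where
  "equidec P Q \<longleftrightarrow> (\<exists>S. tbisection S \<and> tsrc ` S = P \<and> trng ` S = Q)"

definition subeq :: "('a \<times> nat) set \<Rightarrow> ('a \<times> nat) set \<Rightarrow> bool" where
  "subeq P Q \<longleftrightarrow> (\<exists>Q'. equidec P Q' \<and> Q' \<subseteq> Q)"

lemma tbisection_arrows: "tbisection S \<Longrightarrow> (x, t) \<in> S \<Longrightarrow> x \<in> arrows G"
  unfolding tbisection_def by (metis tagged_compact_open_arrows)

lemma slice_bisection:
  assumes "tbisection S" shows "compact_open_bisection G (slice S t)"
proof -
  obtain i k where t: "t = (i, k)" by (cases t)
  have "inj_on s (slice S t)"
  proof (rule inj_onI)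
    fix x y assume "x \<in> slice S t" "y \<in> slice S t" "s x = s y"
    then have "(x, i, k) = (y, i, k)"
      using assms t unfolding tbisection_def by (intro inj_onD[of tsrc S]) auto
    then show "x = y" by simp
  qed
  moreover have "inj_on r (slice S t)"
  proof (rule inj_onI)
    fix x y assume "x \<in> slice S t" "y \<in> slice S t" "r x = r y"
    then have "(x, i, k) = (y, i, k)"
      using assms t unfolding tbisection_def by (intro inj_onD[of trng S]) auto
    then show "x = y" by simp
  qed
  ultimately show ?thesis
    using assms by (simp add: compact_open_bisection_iff tbisection_def tagged_compact_open_def t)
qed

lemma unit_compact_open_tsrc:
  assumes "tagged_compact_open S" shows "unit_compact_open (tsrc ` S)"
proof -
  have eq: "slice (tsrc ` S) i = (\<Union>k\<in>snd ` snd ` S. s ` slice S (i, k))" for i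
    by (auto simp: slice_def tsrc_def) (force intro: rev_image_eqI)+
  have "snd ` tsrc ` S = fst ` snd ` S" by (force simp: tsrc_def image_image)
  moreover have f: "finite (fst ` snd ` S)" "finite (snd ` snd ` S)"
    using assms unfolding tagged_compact_open_def by (metis finite_imageI)+
  moreover have "compact_open (slice (tsrc ` S) i)" for i
    unfolding eq using f assms by (intro compact_open_UN compact_open_src) (auto simp: tagged_compact_open_def)
  moreover have "tsrc ` S \<subseteq> units G \<times> UNIV" using tagged_compact_open_arrows[OF assms] by (auto simp: tsrc_def)
  ultimately show ?thesis unfolding unit_compact_open_def tagged_compact_open_def by (simp del: finite_imageI)
qed

lemma unit_compact_open_trng:
  assumes "tagged_compact_open S" shows "unit_compact_open (trng ` S)"
proof -
  have eq: "slice (trng ` S) k = (\<Union>i\<in>fst ` snd ` S. r ` slice S (i, k))" for k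
    by (auto simp: slice_def trng_def) (force intro: rev_image_eqI)+
  have "snd ` trng ` S = snd ` snd ` S" by (force simp: trng_def image_image)
  moreover have f: "finite (fst ` snd ` S)" "finite (snd ` snd ` S)"
    using assms unfolding tagged_compact_open_def by (metis finite_imageI)+
  moreover have "compact_open (slice (trng ` S) i)" for i
    unfolding eq using f assms by (intro compact_open_UN compact_open_rng) (auto simp: tagged_compact_open_def)
  moreover have "trng ` S \<subseteq> units G \<times> UNIV" using tagged_compact_open_arrows[OF assms] by (auto simp: trng_def)
  ultimately show ?thesis unfolding unit_compact_open_def tagged_compact_open_def by (simp del: finite_imageI)
qed

lemma equidec_unit_compact_open: "equidec P Q \<Longrightarrow> unit_compact_open P \<and> unit_compact_open Q"
  unfolding equidec_def tbisection_def by (metis unit_compact_open_tsrc unit_compact_open_trng)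

text \<open>A unit x itself serves as the arrow from level i to level \<pi> i; injectivity of \<pi>
  on the occurring levels keeps the ranges apart.\<close>

lemma equidec_shift:
  assumes P: "unit_compact_open P" and inj: "inj_on \<pi> (snd ` P)"
  shows "equidec P (map_prod id \<pi> ` P)"
proof -
  define S where "S = (\<lambda>(x, i). (x, i, \<pi> i)) ` P"
  have sl: "slice S (i, k) = (if k = \<pi> i then slice P i else {})" for i k
    by (auto simp: S_def slice_def)
  have "snd ` S = (\<lambda>i. (i, \<pi> i)) ` snd ` P" by (force simp: S_def image_image)
  then have "tagged_compact_open S"
    using P by (auto simp: unit_compact_open_def tagged_compact_open_def sl)
  moreover have u: "s x = x" "r x = x" if "(x, i) \<in> P" for x i
    using P that unfolding unit_compact_open_def by auto
  have "inj_on tsrc S" by (rule inj_onI) (auto simp: S_def u)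
  moreover have "inj_on trng S"
  proof (rule inj_onI)
    fix a b assume "a \<in> S" "b \<in> S" "trng a = trng b"
    then obtain x i y j where xy: "(x, i) \<in> P" "(y, j) \<in> P" "a = (x, i, \<pi> i)" "b = (y, j, \<pi> j)"
      unfolding S_def by auto
    then have e: "x = y" "\<pi> i = \<pi> j" using \<open>trng a = trng b\<close> u(2)[OF xy(1)] u(2)[OF xy(2)] by auto
    have "i \<in> snd ` P" "j \<in> snd ` P" using xy(1,2) by (auto intro: rev_image_eqI)
    then have "i = j" using inj_onD[OF inj] e by metis
    then show "a = b" using xy e by simp
  qed
  ultimately have "tbisection S" by (simp add: tbisection_def)
  moreover have "tsrc ` S = P"
    unfolding S_def image_image using u by (force simp: image_iff)
  moreover have "trng ` S = map_prod id \<pi> ` P"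
    unfolding S_def image_image using u by (intro image_cong) auto
  ultimately show ?thesis unfolding equidec_def by blast
qed

lemma equidec_refl: "unit_compact_open P \<Longrightarrow> equidec P P"
  using equidec_shift[of P id] by (simp add: map_prod.id)

lemma subeq_refl: "unit_compact_open K \<Longrightarrow> K \<subseteq> P \<Longrightarrow> subeq K P"
  unfolding subeq_def using equidec_refl by blast

lemma equidec_imp_subeq: "equidec P Q \<Longrightarrow> subeq P Q"
  unfolding subeq_def by blast

lemma subeq_mono: "subeq P Q \<Longrightarrow> Q \<subseteq> Q' \<Longrightarrow> subeq P Q'"
  unfolding subeq_def by blast

lemma equidec_sym:
  assumes "equidec P Q" shows "equidec Q P"
proof -
  obtain S where S: "tbisection S" "tsrc ` S = P" "trng ` S = Q" using assms unfolding equidec_def by blast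
  note arr = tbisection_arrows[OF S(1)]
  define f where "f = (\<lambda>(x, i :: nat, k :: nat). (ginv G x, k, i))"
  have ff: "tsrc (f z) = trng z \<and> trng (f z) = tsrc z" if "z \<in> S" for z
    using that arr by (cases z) (auto simp: f_def)
  then have f1: "tsrc (f z) = trng z" and f2: "trng (f z) = tsrc z" if "z \<in> S" for z
    using that by blast+
  have sl: "slice (f ` S) (k, i) = ginv G ` slice S (i, k)" for i k
    by (auto simp: f_def slice_def) (force intro: rev_image_eqI)
  have "snd ` f ` S = prod.swap ` snd ` S" by (force simp: f_def image_image)
  then have "tagged_compact_open (f ` S)"
    using S(1) compact_open_ginv by (auto simp: tbisection_def tagged_compact_open_def sl)
  moreover have "inj_on (tsrc \<circ> f) S" "inj_on (trng \<circ> f) S"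
    using S(1) f1 f2 unfolding tbisection_def by (auto simp: inj_on_def)
  then have "inj_on tsrc (f ` S)" "inj_on trng (f ` S)"
    by (auto intro: inj_on_imageI)
  ultimately have "tbisection (f ` S)" by (simp add: tbisection_def)
  moreover have "tsrc ` f ` S = Q" "trng ` f ` S = P"
    using S(2,3) f1 f2 by (auto simp: image_image)
  ultimately show ?thesis unfolding equidec_def by blast
qed

text \<open>Each slice of the product is a finite union, over the intermediate level, of products of
  bisections. The source of h g determines g and then h; its range determines h and then g. The
  inclusion case serves \<open>subeq\<close>, the equality case \<open>equidec\<close>.\<close>

lemma tbisection_compose:
  assumes S: "tbisection S" and R: "tbisection R" and sub: "trng ` S \<subseteq> tsrc ` R"
  shows "\<exists>Q. tbisection Q \<and> tsrc ` Q = tsrc ` S \<and> trng ` Q \<subseteq> trng ` R \<and>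
    (trng ` S = tsrc ` R \<longrightarrow> trng ` Q = trng ` R)"
proof -
  define Q where "Q = {(gmult G h g, i, k) | g h i j k. (g, i, j) \<in> S \<and> (h, j, k) \<in> R \<and> s h = r g}"
  have arrS: "x \<in> arrows G" if "(x, t) \<in> S" for x t using tbisection_arrows[OF S that] .
  have arrR: "x \<in> arrows G" if "(x, t) \<in> R" for x t using tbisection_arrows[OF R that] .
  have injS: "tagged_compact_open S" "inj_on tsrc S" "inj_on trng S" using S by (simp_all add: tbisection_def)
  have injR: "tagged_compact_open R" "inj_on tsrc R" "inj_on trng R" using R by (simp_all add: tbisection_def)
  have sl: "slice Q (i, k) = (\<Union>j\<in>snd ` snd ` S. gprod (slice R (j, k)) (slice S (i, j)))" for i k
    by (auto simp: Q_def slice_def gprod_def) (force intro: rev_image_eqI)+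
  have "snd ` Q \<subseteq> (fst ` snd ` S) \<times> (snd ` snd ` R)" by (force simp: Q_def)
  then have "finite (snd ` Q)"
    using injS injR unfolding tagged_compact_open_def by (meson finite_SigmaI finite_imageI finite_subset)
  moreover have "compact_open (slice Q (i, k))" for i k
    unfolding sl using slice_bisection[OF S] slice_bisection[OF R] injS
    by (intro compact_open_UN compact_open_gprod) (auto simp: compact_open_bisection_iff tagged_compact_open_def)
  ultimately have 1: "tagged_compact_open Q" by (auto simp: tagged_compact_open_def)
  have E: "\<exists>g h j. z = (gmult G h g, i, k) \<and> (g, i, j) \<in> S \<and> (h, j, k) \<in> R \<and> s h = r g \<and>
      s (fst z) = s g \<and> r (fst z) = r h" if z: "z \<in> Q" "snd z = (i, k)" for z i k
  proof -
    obtain g h j where "z = (gmult G h g, i, k)" "(g, i, j) \<in> S" "(h, j, k) \<in> R" "s h = r g"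
      using z unfolding Q_def by auto
    then show ?thesis using arrS[of g] arrR[of h] by (intro exI[of _ g] exI[of _ h] exI[of _ j]) simp
  qed
  have uS: "x = y \<and> k = l" if "(x, i, k) \<in> S" "(y, i, l) \<in> S" "s x = s y" for x y i k l
    using inj_onD[of tsrc S "(x, i, k)" "(y, i, l)"] injS that by simp
  have uS': "x = y \<and> i = j" if "(x, i, k) \<in> S" "(y, j, k) \<in> S" "r x = r y" for x y i k j
    using inj_onD[of trng S "(x, i, k)" "(y, j, k)"] injS that by simp
  have uR: "x = y \<and> k = l" if "(x, i, k) \<in> R" "(y, i, l) \<in> R" "s x = s y" for x y i k l
    using inj_onD[of tsrc R "(x, i, k)" "(y, i, l)"] injR that by simp
  have uR': "x = y \<and> i = j" if "(x, i, k) \<in> R" "(y, j, k) \<in> R" "r x = r y" for x y i k j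
    using inj_onD[of trng R "(x, i, k)" "(y, j, k)"] injR that by simp
  have 2: "inj_on tsrc Q"
  proof (rule inj_onI)
    fix z z' assume zz: "z \<in> Q" "z' \<in> Q" "tsrc z = tsrc z'"
    obtain i k where ik: "snd z = (i, k)" by (cases "snd z")
    obtain i' k' where ik': "snd z' = (i', k')" by (cases "snd z'")
    obtain g h j where a: "z = (gmult G h g, i, k)" "(g, i, j) \<in> S" "(h, j, k) \<in> R" "s h = r g"
      "s (fst z) = s g" using E[OF zz(1) ik] by blast
    obtain g' h' j' where b: "z' = (gmult G h' g', i', k')" "(g', i', j') \<in> S" "(h', j', k') \<in> R"
      "s h' = r g'" "s (fst z') = s g'" using E[OF zz(2) ik'] by blast
    have e: "i = i'" "s g = s g'" using zz(3) a(1,5) b(1,5) by auto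
    have "g = g' \<and> j = j'" using uS a(2) b(2) e by blast
    moreover from this have "h = h' \<and> k = k'" using uR a(3,4) b(3,4) by metis
    ultimately show "z = z'" using a(1) b(1) e by simp
  qed
  have 3: "inj_on trng Q"
  proof (rule inj_onI)
    fix z z' assume zz: "z \<in> Q" "z' \<in> Q" "trng z = trng z'"
    obtain i k where ik: "snd z = (i, k)" by (cases "snd z")
    obtain i' k' where ik': "snd z' = (i', k')" by (cases "snd z'")
    obtain g h j where a: "z = (gmult G h g, i, k)" "(g, i, j) \<in> S" "(h, j, k) \<in> R" "s h = r g"
      "r (fst z) = r h" using E[OF zz(1) ik] by blast
    obtain g' h' j' where b: "z' = (gmult G h' g', i', k')" "(g', i', j') \<in> S" "(h', j', k') \<in> R"
      "s h' = r g'" "r (fst z') = r h'" using E[OF zz(2) ik'] by blast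
    have e: "k = k'" "r h = r h'" using zz(3) a(1,5) b(1,5) by auto
    have "h = h' \<and> j = j'" using uR' a(3) b(3) e by blast
    moreover from this have "g = g' \<and> i = i'" using uS' a(2,4) b(2,4) by metis
    ultimately show "z = z'" using a(1) b(1) e by simp
  qed
  have 4: "tsrc ` Q = tsrc ` S"
  proof (intro equalityI subsetI)
    fix y assume "y \<in> tsrc ` Q"
    then obtain z where z: "z \<in> Q" "y = tsrc z" by blast
    obtain i k where ik: "snd z = (i, k)" by (cases "snd z")
    obtain g j where "fst (snd z) = i" "(g, i, j) \<in> S" "s (fst z) = s g" using E[OF z(1) ik] ik by auto
    then show "y \<in> tsrc ` S" using z(2) by (intro image_eqI[of _ _ "(g, i, j)"]) (simp_all add: tsrc_def case_prod_beta)
  next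
    fix y assume "y \<in> tsrc ` S"
    then obtain g i j where g: "(g, i, j) \<in> S" "y = (s g, i)" by (auto simp: tsrc_def)
    then have "(r g, j) \<in> tsrc ` R" using sub by force
    then obtain h k where h: "(h, j, k) \<in> R" "s h = r g" by (auto simp: tsrc_def)
    have "(gmult G h g, i, k) \<in> Q" unfolding Q_def using g h by blast
    moreover have "y = tsrc (gmult G h g, i, k)" using g h arrS[OF g(1)] arrR[OF h(1)] by simp
    ultimately show "y \<in> tsrc ` Q" by (rule rev_image_eqI)
  qed
  have 5: "trng ` Q \<subseteq> trng ` R"
  proof
    fix y assume "y \<in> trng ` Q"
    then obtain z where z: "z \<in> Q" "y = trng z" by blast
    obtain i k where ik: "snd z = (i, k)" by (cases "snd z")
    obtain h j where "snd (snd z) = k" "(h, j, k) \<in> R" "r (fst z) = r h" using E[OF z(1) ik] ik by auto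
    then show "y \<in> trng ` R" using z(2) by (intro image_eqI[of _ _ "(h, j, k)"]) (simp_all add: trng_def case_prod_beta)
  qed
  have 6: "trng ` R \<subseteq> trng ` Q" if eq: "trng ` S = tsrc ` R"
  proof
    fix y assume "y \<in> trng ` R"
    then obtain h j k where h: "(h, j, k) \<in> R" "y = (r h, k)" by (auto simp: trng_def)
    then have "(s h, j) \<in> trng ` S" using eq by force
    then obtain g i where g: "(g, i, j) \<in> S" "s h = r g" by (auto simp: trng_def)
    have "(gmult G h g, i, k) \<in> Q" unfolding Q_def using g h by blast
    moreover have "y = trng (gmult G h g, i, k)" using g h arrS[OF g(1)] arrR[OF h(1)] by simp
    ultimately show "y \<in> trng ` Q" by (rule rev_image_eqI)
  qed
  have "tbisection Q" using 1 2 3 by (simp add: tbisection_def)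
  then show ?thesis using 4 5 6 by (intro exI[of _ Q]) blast
qed

lemma equidec_trans:
  assumes "equidec P Q" "equidec Q R" shows "equidec P R"
proof -
  obtain S1 where 1: "tbisection S1" "tsrc ` S1 = P" "trng ` S1 = Q" using assms(1) unfolding equidec_def by blast
  obtain S2 where 2: "tbisection S2" "tsrc ` S2 = Q" "trng ` S2 = R" using assms(2) unfolding equidec_def by blast
  have e: "trng ` S1 = tsrc ` S2" "trng ` S1 \<subseteq> tsrc ` S2" using 1 2 by auto
  obtain T where "tbisection T" "tsrc ` T = tsrc ` S1" "trng ` T = trng ` S2"
    using tbisection_compose[OF 1(1) 2(1) e(2)] e(1) by blast
  then show ?thesis unfolding equidec_def using 1(2) 2(3) by blast
qed

lemma subeq_trans:
  assumes "subeq P Q" "subeq Q R" shows "subeq P R"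
proof -
  obtain S1 where 1: "tbisection S1" "tsrc ` S1 = P" "trng ` S1 \<subseteq> Q"
    using assms(1) unfolding subeq_def equidec_def by blast
  obtain S2 where 2: "tbisection S2" "tsrc ` S2 = Q" "trng ` S2 \<subseteq> R"
    using assms(2) unfolding subeq_def equidec_def by blast
  have e: "trng ` S1 \<subseteq> tsrc ` S2" using 1 2 by auto
  obtain T where "tbisection T" "tsrc ` T = tsrc ` S1" "trng ` T \<subseteq> trng ` S2"
    using tbisection_compose[OF 1(1) 2(1) e] by blast
  then have "tbisection T" "tsrc ` T = P" "trng ` T \<subseteq> R" using 1 2 by simp_all
  then show ?thesis unfolding subeq_def equidec_def by blast
qed

lemma equidec_Un:
  assumes "equidec P Q" "equidec P' Q'" "P \<inter> P' = {}" "Q \<inter> Q' = {}"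
  shows "equidec (P \<union> P') (Q \<union> Q')"
proof -
  obtain S where 1: "tbisection S" "tsrc ` S = P" "trng ` S = Q" using assms(1) unfolding equidec_def by blast
  obtain S' where 2: "tbisection S'" "tsrc ` S' = P'" "trng ` S' = Q'" using assms(2) unfolding equidec_def by blast
  have "tsrc ` (S - S') \<inter> tsrc ` (S' - S) = {}" "trng ` (S - S') \<inter> trng ` (S' - S) = {}"
    using 1 2 assms(3,4) by blast+
  then have "tbisection (S \<union> S')"
    using 1(1) 2(1) unfolding tbisection_def by (simp add: tagged_compact_open_Un inj_on_Un)
  moreover have "tsrc ` (S \<union> S') = P \<union> P'" "trng ` (S \<union> S') = Q \<union> Q'" using 1 2 by (auto simp: image_Un)
  ultimately show ?thesis unfolding equidec_def by blast
qed

lemma subeq_Un: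
  assumes "subeq P Q" "subeq P' Q'" "P \<inter> P' = {}" "Q \<inter> Q' = {}"
  shows "subeq (P \<union> P') (Q \<union> Q')"
proof -
  obtain R where R: "equidec P R" "R \<subseteq> Q" using assms(1) unfolding subeq_def by blast
  obtain R' where R': "equidec P' R'" "R' \<subseteq> Q'" using assms(2) unfolding subeq_def by blast
  have "R \<inter> R' = {}" using R(2) R'(2) assms(4) by blast
  then have "equidec (P \<union> P') (R \<union> R')" using equidec_Un R(1) R'(1) assms(3) by blast
  then show ?thesis unfolding subeq_def using R(2) R'(2) by blast
qed

lemma unit_compact_open_empty [simp]: "unit_compact_open {}"
  by (simp add: unit_compact_open_def tagged_compact_open_def slice_def)

lemma equidec_UN:
  assumes "finite I" "\<And>x. x \<in> I \<Longrightarrow> equidec (P x) (Q x)"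
    "disjoint_family_on P I" "disjoint_family_on Q I"
  shows "equidec (\<Union>x\<in>I. P x) (\<Union>x\<in>I. Q x)"
  using assms
proof (induction I rule: finite_induct)
  case empty
  then show ?case using equidec_refl[OF unit_compact_open_empty] by simp
next
  case (insert x F)
  have "equidec (P x \<union> (\<Union>x\<in>F. P x)) (Q x \<union> (\<Union>x\<in>F. Q x))"
  proof (rule equidec_Un)
    show "equidec (\<Union>x\<in>F. P x) (\<Union>x\<in>F. Q x)"
      using insert by (auto simp: disjoint_family_on_def)
    show "P x \<inter> (\<Union>x\<in>F. P x) = {}" "Q x \<inter> (\<Union>x\<in>F. Q x) = {}"
      using insert.prems(2,3) insert.hyps by (auto simp: disjoint_family_on_def)
  qed (use insert.prems in auto)
  then show ?case by simp
qed

section \<open>From covering bisections to embeddings\<close>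

lemma equidec_bisection:
  assumes "compact_open_bisection G W"
  shows "equidec (s ` W \<times> {i}) (r ` W \<times> {k})"
proof -
  have W: "compact_open W" "inj_on s W" "inj_on r W" using assms compact_open_bisection_iff by auto
  have "tbisection (W \<times> {(i, k)})"
    using W unfolding tbisection_def by (auto intro!: tagged_compact_open_Times inj_onI dest: inj_onD)
  moreover have "tsrc ` (W \<times> {(i, k)}) = s ` W \<times> {i}" "trng ` (W \<times> {(i, k)}) = r ` W \<times> {k}"
    by (auto simp: tsrc_def trng_def image_iff)
  ultimately show ?thesis unfolding equidec_def by blast
qed

lemma subeq_bisection:
  assumes W: "open_bisection G W" and C: "compact_open C" "C \<subseteq> s ` W"
  shows "subeq (C \<times> {i}) (r ` W \<times> {k})"
proof -
  let ?V = "{x \<in> W. s x \<in> C}"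
  have W': "openin X W" "inj_on s W" "inj_on r W" using W by (simp_all add: open_bisection_iff)
  have "compact_open ?V" by (rule compact_open_restrict_src[OF W'(1,2) C])
  moreover have "inj_on s ?V" "inj_on r ?V" by (rule inj_on_subset[OF W'(2)], blast, rule inj_on_subset[OF W'(3)], blast)
  ultimately have "compact_open_bisection G ?V" by (simp add: compact_open_bisection_iff)
  then have "equidec (s ` ?V \<times> {i}) (r ` ?V \<times> {k})" by (rule equidec_bisection)
  moreover have "s ` ?V = C" using C(2) by auto
  moreover have "r ` ?V \<times> {k} \<subseteq> r ` W \<times> {k}" by blast
  ultimately show ?thesis using subeq_mono[OF equidec_imp_subeq] by simp
qed

text \<open>On level i the part of \<open>K\<close> outside \<open>V\<close> is compact and lies in
  the open set \<open>U\<close>, so a compact open \<open>C\<close> fits in between; the rest of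
  \<open>K\<close> is then covered by \<open>V\<close>.\<close>

lemma unit_compact_open_split:
  assumes K: "unit_compact_open K" "K \<subseteq> U \<times> {i} \<union> V" and U: "openin X U" and V: "openin X (slice V i)"
  obtains C where "compact_open C" "C \<subseteq> U" "C \<times> {i} \<subseteq> K" "unit_compact_open (K - C \<times> {i})" "K - C \<times> {i} \<subseteq> V"
proof -
  have cK: "compact_open (slice K i)" using K(1) by (simp add: unit_compact_open_def tagged_compact_open_def)
  have "compactin X (slice K i - slice V i)"
    using cK V compactin_Hausdorff_Diff[OF Hausdorff] by (simp add: compact_open_def)
  moreover have "openin X (slice K i \<inter> U)" using cK U by (simp add: compact_open_def openin_Int)
  moreover have "slice K i - slice V i \<subseteq> slice K i \<inter> U" using K(2) by auto
  ultimately obtain C where C: "compact_open C" "slice K i - slice V i \<subseteq> C" "C \<subseteq> slice K i \<inter> U"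
    using compact_open_between by metis
  have sub: "C \<times> {i} \<subseteq> K" using C(3) by auto
  have "C \<subseteq> units G" using sub K(1) unfolding unit_compact_open_def by auto
  then have "unit_compact_open (K - C \<times> {i})" by (intro unit_compact_open_Diff K(1) unit_compact_open_Times C(1)) auto
  moreover have "K - C \<times> {i} \<subseteq> V"
  proof (rule ccontr)
    assume "\<not> K - C \<times> {i} \<subseteq> V"
    then obtain x j where x: "(x, j) \<in> K" "(x, j) \<notin> C \<times> {i}" "(x, j) \<notin> V" by auto
    then have "j = i" using K(2) by blast
    then have "x \<in> slice K i - slice V i" using x by simp
    then show False using C(2) x(2) \<open>j = i\<close> by blast
  qed
  ultimately show thesis using that C sub by blast
qed

text \<open>The sources may overlap. Splitting off a compact open piece for one bisection at a time
  makes them disjoint, and disjointness of the ranges lets the pieces be glued. The set left to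
  embed shrinks, so the induction is over all \<open>K\<close>.\<close>

lemma subeq_of_cover:
  assumes "finite I" "\<And>x. x \<in> I \<Longrightarrow> open_bisection G (W x)"
    "disjoint_family_on (\<lambda>x. r ` W x \<times> {k x}) I"
    "unit_compact_open K" "K \<subseteq> (\<Union>x\<in>I. s ` W x \<times> {i x})"
  shows "subeq K (\<Union>x\<in>I. r ` W x \<times> {k x})"
  using assms
proof (induction I arbitrary: K rule: finite_induct)
  case empty
  then show ?case using subeq_refl[OF unit_compact_open_empty] by simp
next
  case (insert x F)
  let ?V = "\<Union>x\<in>F. s ` W x \<times> {i x}"
  have op: "openin X (s ` W y)" if "y \<in> insert x F" for y
    using insert.prems(1)[OF that] open_src by (simp add: open_bisection_iff openin_unit_top)
  have "slice ?V (i x) = (\<Union>y\<in>{y \<in> F. i y = i x}. s ` W y)" by (auto simp: slice_def)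
  then have V: "openin X (slice ?V (i x))" using op by auto
  have "K \<subseteq> s ` W x \<times> {i x} \<union> ?V" using insert.prems(4) by auto
  then obtain C where C: "compact_open C" "C \<subseteq> s ` W x" "C \<times> {i x} \<subseteq> K" "unit_compact_open (K - C \<times> {i x})"
    "K - C \<times> {i x} \<subseteq> ?V"
    using unit_compact_open_split[OF insert.prems(3) _ op[of x] V] by auto
  have 1: "subeq (K - C \<times> {i x}) (\<Union>x\<in>F. r ` W x \<times> {k x})"
    using insert.IH C(4,5) insert.prems by (auto simp: disjoint_family_on_def)
  have 2: "subeq (C \<times> {i x}) (r ` W x \<times> {k x})"
    by (rule subeq_bisection[OF _ C(1,2)]) (simp add: insert.prems)
  have "r ` W x \<times> {k x} \<inter> r ` W y \<times> {k y} = {}" if "y \<in> F" for y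
    using disjoint_family_onD[OF insert.prems(2), of x y] insert.hyps(2) that by blast
  then have 3: "r ` W x \<times> {k x} \<inter> (\<Union>x\<in>F. r ` W x \<times> {k x}) = {}" by blast
  have 4: "C \<times> {i x} \<inter> (K - C \<times> {i x}) = {}" by blast
  have "C \<times> {i x} \<union> (K - C \<times> {i x}) = K" using C(3) by blast
  then show ?case using subeq_Un[OF 2 1 4 3] by simp
qed

end

section \<open>Comparison relations as embeddings of tagged sets\<close>

lemma tagged_union_append:
  "tagged_union (a @ b) = tagged_union a \<union> map_prod id ((+) (length a)) ` tagged_union b"
proof (intro equalityI subsetI)
  fix z assume "z \<in> tagged_union (a @ b)"
  then obtain x l where z: "z = (x, l)" "l < length a + length b" "x \<in> (a @ b) ! l"
    by (cases z) (auto simp: mem_tagged_union)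
  show "z \<in> tagged_union a \<union> map_prod id ((+) (length a)) ` tagged_union b"
  proof (cases "l < length a")
    case True
    then show ?thesis using z by (simp add: mem_tagged_union nth_append)
  next
    case False
    then have "(x, l - length a) \<in> tagged_union b" using z by (simp add: mem_tagged_union nth_append)
    moreover have "z = map_prod id ((+) (length a)) (x, l - length a)" using False z(1) by simp
    ultimately show ?thesis by blast
  qed
qed (auto simp: mem_tagged_union nth_append)

lemma tagged_union_single: "tagged_union [A] = A \<times> {0}"
  by (auto simp: tagged_union_def)

context ample_groupoid
begin

abbreviation "T \<equiv> tagged_union"

lemma unit_compact_open_UN: "finite I \<Longrightarrow> (\<And>x. x \<in> I \<Longrightarrow> unit_compact_open (P x)) \<Longrightarrow> unit_compact_open (\<Union>x\<in>I. P x)"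
  by (induction I rule: finite_induct) (auto intro: unit_compact_open_Un)

lemma compact_open_seqs_iff:
  "a \<in> compact_open_seqs G \<longleftrightarrow> a \<noteq> [] \<and> (\<forall>i<length a. compact_open (a ! i) \<and> a ! i \<subseteq> units G)"
  unfolding compact_open_seqs_def compact_open_unit_set_iff all_set_conv_all_nth by simp

lemma open_seqs_iff:
  "a \<in> open_seqs G \<longleftrightarrow> a \<noteq> [] \<and> (\<forall>i<length a. openin X (a ! i) \<and> a ! i \<subseteq> units G)"
  unfolding open_seqs_def openin_unit_top all_set_conv_all_nth by simp

lemma unit_compact_open_tagged_union: "a \<in> compact_open_seqs G \<Longrightarrow> unit_compact_open (T a)"
  unfolding tagged_union_def by (intro unit_compact_open_UN unit_compact_open_Times) (auto simp: compact_open_seqs_iff)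

lemma tbisection_src_eq:
  assumes "tbisection S" "(x, i, k) \<in> S" "(y, i, l) \<in> S" "s x = s y" shows "x = y \<and> k = l"
  using inj_onD[of tsrc S "(x, i, k)" "(y, i, l)"] assms unfolding tbisection_def by simp

lemma tbisection_rng_eq:
  assumes "tbisection S" "(x, i, k) \<in> S" "(y, j, k) \<in> S" "r x = r y" shows "x = y \<and> i = j"
  using inj_onD[of trng S "(x, i, k)" "(y, j, k)"] assms unfolding tbisection_def by simp

lemma subeqE:
  assumes "subeq P Q"
  obtains S where "tbisection S" "tsrc ` S = P" "trng ` S \<subseteq> Q"
  using assms unfolding subeq_def equidec_def by blast

lemma disjoint_slices_src:
  assumes "tbisection S"
  shows "disjoint_family_on (\<lambda>j. s ` slice S (i, j)) J"
  unfolding disjoint_family_on_def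
proof (intro ballI impI, rule ccontr)
  fix j k assume "j \<noteq> k" "s ` slice S (i, j) \<inter> s ` slice S (i, k) \<noteq> {}"
  then obtain x y where "(x, i, j) \<in> S" "(y, i, k) \<in> S" "s x = s y" by auto
  then show False using tbisection_src_eq[OF assms] \<open>j \<noteq> k\<close> by blast
qed

lemma disjoint_slices_rng:
  assumes "tbisection S"
  shows "disjoint_family_on (\<lambda>(i, j). r ` slice S (i, j) \<times> {j}) J"
  unfolding disjoint_family_on_def
proof (intro ballI impI, rule ccontr)
  fix z z' :: "nat \<times> nat"
  obtain i j i' j' where e: "z = (i, j)" "z' = (i', j')" by (cases z, cases z')
  assume ne: "z \<noteq> z'" and "(case z of (i, j) \<Rightarrow> r ` slice S (i, j) \<times> {j}) \<inter>
    (case z' of (i, j) \<Rightarrow> r ` slice S (i, j) \<times> {j}) \<noteq> {}"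
  then obtain x y where "(x, i, j) \<in> S" "(y, i', j) \<in> S" "r x = r y" "j = j'" using e by auto
  then show False using tbisection_rng_eq[OF assms] ne e by blast
qed

text \<open>The pieces of a decomposition glue to one tagged bisection; conversely, its slices are
  such pieces, one for each pair of levels.\<close>

lemma type_rel_iff: "type_rel G a b \<longleftrightarrow> equidec (T a) (T b)"
proof
  assume "type_rel G a b"
  then obtain J :: "nat \<Rightarrow> nat" and W k where
    h: "\<forall>i<length a. \<forall>j<J i. compact_open_bisection G (W i j) \<and> k i j < length b"
      "\<forall>i<length a. a ! i = (\<Union>j<J i. s ` W i j) \<and> disjoint_family_on (\<lambda>j. s ` W i j) {..<J i}"
    and b: "T b = (\<Union>i<length a. \<Union>j<J i. r ` W i j \<times> {k i j})"
    and db: "disjoint_family_on (\<lambda>(i, j). r ` W i j \<times> {k i j}) (SIGMA i:{..<length a}. {..<J i})"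
    unfolding type_rel_def by (elim exE conjE)
  have W: "compact_open_bisection G (W i j)" if "i < length a" "j < J i" for i j using h(1) that by blast
  have a: "a ! i = (\<Union>j<J i. s ` W i j)" and da: "disjoint_family_on (\<lambda>j. s ` W i j) {..<J i}"
    if "i < length a" for i using h(2) that by blast+
  let ?I = "SIGMA i:{..<length a}. {..<J i}"
  let ?P = "\<lambda>(i, j). s ` W i j \<times> {i}"
  let ?Q = "\<lambda>(i, j). r ` W i j \<times> {k i j}"
  have "equidec (\<Union>z\<in>?I. ?P z) (\<Union>z\<in>?I. ?Q z)"
  proof (rule equidec_UN)
    show "equidec (?P z) (?Q z)" if "z \<in> ?I" for z using that W equidec_bisection by auto
    show "disjoint_family_on ?P ?I" unfolding disjoint_family_on_def
    proof (intro ballI impI)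
      fix z z' assume z: "z \<in> ?I" "z' \<in> ?I" "z \<noteq> z'"
      obtain i j i' j' where e: "z = (i, j)" "z' = (i', j')" by (cases z, cases z')
      show "?P z \<inter> ?P z' = {}"
      proof (cases "i = i'")
        case True
        then have "s ` W i j \<inter> s ` W i j' = {}"
          using disjoint_family_onD[OF da, of i j j'] z e by auto
        then show ?thesis using e True by auto
      qed (use e in auto)
    qed
  qed (use db in auto)
  moreover have "(\<Union>z\<in>?I. ?P z) = T a" by (auto simp: tagged_union_def a)
  moreover have "(\<Union>z\<in>?I. ?Q z) = T b" unfolding b by auto
  ultimately show "equidec (T a) (T b)" by simp
next
  assume "equidec (T a) (T b)"
  then obtain S where S: "tbisection S" "tsrc ` S = T a" "trng ` S = T b"
    unfolding equidec_def by (elim exE conjE)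
  have mem: "i < length a \<and> s x \<in> a ! i \<and> k < length b \<and> r x \<in> b ! k" if "(x, i, k) \<in> S" for x i k
  proof -
    have "tsrc (x, i, k) \<in> T a" "trng (x, i, k) \<in> T b" using that S(2,3) by blast+
    then show ?thesis by (simp add: mem_tagged_union)
  qed
  have ex1: "\<exists>x k. (x, i, k) \<in> S \<and> s x = u" if "u \<in> a ! i" "i < length a" for u i
  proof -
    have "(u, i) \<in> tsrc ` S" using that S(2) by (simp add: mem_tagged_union)
    then show ?thesis by (auto simp: tsrc_def)
  qed
  have ex2: "\<exists>x i. (x, i, k) \<in> S \<and> r x = u" if "u \<in> b ! k" "k < length b" for u k
  proof -
    have "(u, k) \<in> trng ` S" using that S(3) by (simp add: mem_tagged_union)
    then show ?thesis by (auto simp: trng_def)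
  qed
  show "type_rel G a b" unfolding type_rel_def
  \<comment> \<open>On each source level the pieces are indexed by their target level, so
    \<open>k i j\<close> is \<open>j\<close> and some pieces may be empty.\<close>
  proof (intro exI[of _ "\<lambda>_. length b"] exI[of _ "\<lambda>i j. slice S (i, j)"] exI[of _ "\<lambda>i j. j"] conjI allI impI)
    show "compact_open_bisection G (slice S (i, j))" for i j by (rule slice_bisection[OF S(1)])
    show "a ! i = (\<Union>j<length b. s ` slice S (i, j))" if i: "i < length a" for i
    proof (intro equalityI subsetI)
      fix u assume "u \<in> a ! i"
      then obtain x k where "(x, i, k) \<in> S" "s x = u" using ex1 i by blast
      then show "u \<in> (\<Union>j<length b. s ` slice S (i, j))" using mem by force
    qed (use mem in auto)
    show "disjoint_family_on (\<lambda>j. s ` slice S (i, j)) {..<length b}" for i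
      by (rule disjoint_slices_src[OF S(1)])
    show "T b = (\<Union>i<length a. \<Union>j<length b. r ` slice S (i, j) \<times> {j})"
    proof (intro equalityI subsetI)
      fix z assume "z \<in> T b"
      then obtain u k where z: "z = (u, k)" "k < length b" "u \<in> b ! k" by (cases z) (auto simp: mem_tagged_union)
      then obtain x i where x: "(x, i, k) \<in> S" "r x = u" using ex2 by blast
      then show "z \<in> (\<Union>i<length a. \<Union>j<length b. r ` slice S (i, j) \<times> {j})" using mem[OF x(1)] z by force
    qed (use mem in \<open>auto simp: mem_tagged_union\<close>)
    show "disjoint_family_on (\<lambda>(i, j). r ` slice S (i, j) \<times> {j}) (SIGMA i:{..<length a}. {..<length b})"
      by (rule disjoint_slices_rng[OF S(1)])
  qed
qed

text \<open>Compact subsets of the open terms of \<open>a\<close> can be enlarged to compact open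
  ones inside these terms, so compact open test sets suffice; for them a cover by bisections can be
  cut into an embedding.\<close>

lemma seq_le_iff:
  assumes "a \<in> open_seqs G"
  shows "seq_le G a b \<longleftrightarrow> (\<forall>K. unit_compact_open K \<and> K \<subseteq> T a \<longrightarrow> subeq K (T b))"
proof (intro iffI allI impI)
  fix K assume L: "seq_le G a b" and K: "unit_compact_open K \<and> K \<subseteq> T a"
  have cK: "compact_open (slice K i)" "slice K i \<subseteq> units G" for i
    using K unfolding unit_compact_open_def tagged_compact_open_def by auto
  have "slice K i \<subseteq> a ! i" if "i < length a" for i using K by (auto simp: mem_tagged_union)
  then have F: "\<forall>i<length a. compactin (unit_top G) (slice K i) \<and> slice K i \<subseteq> a ! i"
    using cK by (simp add: compactin_unit_top compact_open_def)
  obtain J :: "nat \<Rightarrow> nat" and W k where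
    h: "\<forall>i<length a. \<forall>j<J i. open_bisection G (W i j) \<and> k i j < length b"
      "\<forall>i<length a. slice K i \<subseteq> (\<Union>j<J i. s ` W i j)"
      "\<forall>i<length a. \<forall>j<J i. r ` W i j \<times> {k i j} \<subseteq> T b"
    and dis: "disjoint_family_on (\<lambda>(i, j). r ` W i j \<times> {k i j}) (SIGMA i:{..<length a}. {..<J i})"
    using mp[OF spec[OF L[unfolded seq_le_def], of "slice K"] F] by (elim exE conjE)
  have W: "open_bisection G (W i j)" if "i < length a" "j < J i" for i j using h(1) that by blast
  have cov: "slice K i \<subseteq> (\<Union>j<J i. s ` W i j)" if "i < length a" for i using h(2) that by blast
  have sub: "r ` W i j \<times> {k i j} \<subseteq> T b" if "i < length a" "j < J i" for i j using h(3) that by blast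
  let ?I = "SIGMA i:{..<length a}. {..<J i}"
  have "subeq K (\<Union>z\<in>?I. r ` W (fst z) (snd z) \<times> {k (fst z) (snd z)})"
  proof (rule subeq_of_cover)
    show "open_bisection G (W (fst z) (snd z))" if "z \<in> ?I" for z using that W by auto
    show "disjoint_family_on (\<lambda>z. r ` W (fst z) (snd z) \<times> {k (fst z) (snd z)}) ?I"
      using dis by (simp add: case_prod_beta')
    show "K \<subseteq> (\<Union>z\<in>?I. s ` W (fst z) (snd z) \<times> {fst z})"
    proof
      fix z assume z: "z \<in> K"
      obtain u i where e: "z = (u, i)" by (cases z)
      have i: "i < length a" using z e K by (auto simp: mem_tagged_union)
      then obtain j where "j < J i" "u \<in> s ` W i j" using cov[OF i] z e by auto
      then show "z \<in> (\<Union>z\<in>?I. s ` W (fst z) (snd z) \<times> {fst z})"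
        using i e by (intro UN_I[of "(i, j)"]) auto
    qed
  qed (use K in auto)
  moreover have "(\<Union>z\<in>?I. r ` W (fst z) (snd z) \<times> {k (fst z) (snd z)}) \<subseteq> T b"
    by (rule UN_least, rule sub) auto
  ultimately show "subeq K (T b)" by (rule subeq_mono)
next
  assume R: "\<forall>K. unit_compact_open K \<and> K \<subseteq> T a \<longrightarrow> subeq K (T b)"
  show "seq_le G a b" unfolding seq_le_def
  proof (intro allI impI)
    fix F assume F: "\<forall>i<length a. compactin (unit_top G) (F i) \<and> F i \<subseteq> a ! i"
    have "\<exists>C. compact_open C \<and> F i \<subseteq> C \<and> C \<subseteq> a ! i" if "i < length a" for i
      using F assms that by (intro compact_open_between) (auto simp: compactin_unit_top open_seqs_iff)
    then obtain C where C: "\<And>i. i < length a \<Longrightarrow> compact_open (C i) \<and> F i \<subseteq> C i \<and> C i \<subseteq> a ! i" by metis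
    let ?K = "\<Union>i<length a. C i \<times> {i}"
    have "unit_compact_open ?K"
    proof (intro unit_compact_open_UN unit_compact_open_Times)
      show "C i \<subseteq> units G" if "i \<in> {..<length a}" for i
        using that C assms unfolding open_seqs_iff by blast
    qed (use C in auto)
    moreover have "C i \<times> {i} \<subseteq> T a" if "i < length a" for i
      using C[OF that] that by (auto simp: mem_tagged_union)
    then have "?K \<subseteq> T a" by blast
    ultimately have "subeq ?K (T b)" using spec[OF R, of ?K] by (simp only: simp_thms)
    then obtain S where S: "tbisection S" "tsrc ` S = ?K" "trng ` S \<subseteq> T b"
      by (rule subeqE)
    have mem: "k < length b \<and> r x \<in> b ! k" if "(x, i, k) \<in> S" for x i k
    proof -
      have "trng (x, i, k) \<in> T b" using that S(3) by blast
      then show ?thesis by (simp add: mem_tagged_union)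
    qed
    show "\<exists>(J :: nat \<Rightarrow> nat) W k.
       (\<forall>i<length a. \<forall>j<J i. open_bisection G (W i j) \<and> k i j < length b) \<and>
       (\<forall>i<length a. F i \<subseteq> (\<Union>j<J i. s ` W i j)) \<and>
       disjoint_family_on (\<lambda>(i, j). r ` W i j \<times> {k i j}) (SIGMA i:{..<length a}. {..<J i}) \<and>
       (\<forall>i<length a. \<forall>j<J i. r ` W i j \<times> {k i j} \<subseteq> T b)"
    proof (intro exI[of _ "\<lambda>_. length b"] exI[of _ "\<lambda>i j. slice S (i, j)"] exI[of _ "\<lambda>i j. j"] conjI allI impI)
      show "open_bisection G (slice S (i, j))" for i j
        using slice_bisection[OF S(1)] unfolding compact_open_bisection_def by blast
      show "F i \<subseteq> (\<Union>j<length b. s ` slice S (i, j))" if i: "i < length a" for i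
      proof
        fix u assume "u \<in> F i"
        then have "(u, i) \<in> tsrc ` S" using C i S(2) by auto
        then obtain x k where "(x, i, k) \<in> S" "s x = u" by (auto simp: tsrc_def)
        then show "u \<in> (\<Union>j<length b. s ` slice S (i, j))" using mem by force
      qed
      show "disjoint_family_on (\<lambda>(i, j). r ` slice S (i, j) \<times> {j}) (SIGMA i:{..<length a}. {..<length b})"
        by (rule disjoint_slices_rng[OF S(1)])
      show "r ` slice S (i, j) \<times> {j} \<subseteq> T b" for i j using mem by (auto simp: mem_tagged_union)
    qed
  qed
qed

lemma compact_below_imp_subeq:
  assumes "compact_below G K V" "compact_open K" "K \<subseteq> units G"
  shows "subeq (K \<times> {i}) (V \<times> {j})"
proof -
  obtain n :: nat and A where A: "\<forall>i<n. open_bisection G (A i)" "K \<subseteq> (\<Union>i<n. s ` A i)"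
    "disjoint_family_on (\<lambda>i. r ` A i) {..<n}" "\<forall>i<n. r ` A i \<subseteq> V"
    using assms(1) unfolding compact_below_def by (elim exE conjE)
  have "subeq (K \<times> {i}) (\<Union>x<n. r ` A x \<times> {j})"
  proof (rule subeq_of_cover)
    show "disjoint_family_on (\<lambda>x. r ` A x \<times> {j}) {..<n}"
      using A(3) unfolding disjoint_family_on_def by blast
    show "unit_compact_open (K \<times> {i})" using assms by (intro unit_compact_open_Times) auto
    show "K \<times> {i} \<subseteq> (\<Union>x<n. s ` A x \<times> {i})" using A(2) by blast
  qed (use A in auto)
  then show ?thesis by (rule subeq_mono) (use A(4) in auto)
qed

text \<open>With one source level and one target level a tagged bisection has a single relevant
  slice, so one open bisection is enough.\<close>

lemma subeq_imp_compact_below: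
  assumes "subeq (K \<times> {i}) (V \<times> {j})" "F \<subseteq> K"
  shows "compact_below G F V"
proof -
  obtain S where S: "tbisection S" "tsrc ` S = K \<times> {i}" "trng ` S \<subseteq> V \<times> {j}"
    using assms(1) by (rule subeqE)
  have mem: "k = j \<and> r x \<in> V" if "(x, i', k) \<in> S" for x i' k
  proof -
    have "trng (x, i', k) \<in> V \<times> {j}" using that S(3) by blast
    then show ?thesis by simp
  qed
  have "F \<subseteq> s ` slice S (i, j)"
  proof
    fix u assume "u \<in> F"
    then have "(u, i) \<in> tsrc ` S" using assms(2) S(2) by auto
    then obtain x k where "(x, i, k) \<in> S" "s x = u" by (auto simp: tsrc_def)
    then show "u \<in> s ` slice S (i, j)" using mem by force
  qed
  moreover have "open_bisection G (slice S (i, j))"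
    using slice_bisection[OF S(1)] unfolding compact_open_bisection_def by blast
  moreover have "r ` slice S (i, j) \<subseteq> V" using mem by auto
  ultimately show ?thesis unfolding compact_below_def
    by (intro exI[of _ "1::nat"] exI[of _ "\<lambda>_. slice S (i, j)"]) (auto simp: disjoint_family_on_def)
qed

text \<open>The bisections are the slices from levels 0 and 1 to level 0; injectivity of
  \<open>trng\<close> separates their ranges.\<close>

lemma subeq_double_bisections:
  assumes "subeq (A \<times> {0, 1}) (A \<times> {0})"
  obtains V :: "nat \<Rightarrow> 'a set" where "\<forall>i. compact_open_bisection G (V i)" "\<forall>i\<in>{0, 1}. s ` V i = A"
    "\<forall>i. r ` V i \<subseteq> A" "r ` V 0 \<inter> r ` V 1 = {}"
proof -
  obtain S where S: "tbisection S" "tsrc ` S = A \<times> {0, 1}" "trng ` S \<subseteq> A \<times> {0}"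
    using assms by (rule subeqE)
  have mem: "k = 0 \<and> r x \<in> A \<and> s x \<in> A" if "(x, i, k) \<in> S" for x i k
  proof -
    have "trng (x, i, k) \<in> trng ` S" "tsrc (x, i, k) \<in> tsrc ` S" using that by (rule imageI)+
    then show ?thesis using S(2,3) by auto
  qed
  have src: "A = s ` slice S (i, 0)" if "i \<in> {0, 1}" for i
  proof (intro equalityI subsetI)
    fix u assume "u \<in> A"
    then have "(u, i) \<in> tsrc ` S" using that S(2) by auto
    then obtain x k where "(x, i, k) \<in> S" "s x = u" by (auto simp: tsrc_def)
    then show "u \<in> s ` slice S (i, 0)" using mem by force
  qed (use mem in auto)
  have dis: "r ` slice S (i, 0) \<inter> r ` slice S (j, 0) = {}" if ij: "i \<noteq> j" for i j
  proof (rule ccontr)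
    assume "\<not> ?thesis"
    then obtain x y where "(x, i, 0) \<in> S" "(y, j, 0) \<in> S" "r x = r y" by auto
    then show False using tbisection_rng_eq[OF S(1)] ij by blast
  qed
  show thesis
  proof (rule that[of "\<lambda>i. slice S (i, 0)"])
    show "\<forall>i. compact_open_bisection G (slice S (i, 0))" using slice_bisection[OF S(1)] by blast
    show "\<forall>i\<in>{0, 1}. s ` slice S (i, 0) = A" using src by blast
    show "\<forall>i. r ` slice S (i, 0) \<subseteq> A" using mem by auto
    show "r ` slice S (0, 0) \<inter> r ` slice S (1, 0) = {}" by (rule dis) simp
  qed
qed

lemma two_one_paradoxical_iff:
  assumes A: "compact_open A" "A \<subseteq> units G"
  shows "two_one_paradoxical G A \<longleftrightarrow> subeq (A \<times> {0, 1}) (A \<times> {0})"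
proof
  assume "two_one_paradoxical G A"
  then obtain n :: "nat \<Rightarrow> nat" and V where
    h: "\<forall>i\<in>{1, 2}. (\<forall>j\<in>{1..n i}. compact_open_bisection G (V i j)) \<and> A = (\<Union>j\<in>{1..n i}. s ` V i j)"
      "\<forall>i\<in>{1, 2}. \<forall>j\<in>{1..n i}. r ` V i j \<subseteq> A"
    and dis: "disjoint_family_on (\<lambda>(i, j). r ` V i j) (SIGMA i:{1, 2}. {1..n i})"
    unfolding two_one_paradoxical_def by (elim exE conjE)
  let ?I = "SIGMA i:{1, 2}. {1..n i}"
  have "subeq (A \<times> {0, 1}) (\<Union>z\<in>?I. r ` V (fst z) (snd z) \<times> {0})"
  proof (rule subeq_of_cover)
    show "open_bisection G (V (fst z) (snd z))" if "z \<in> ?I" for z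
      using that h(1) unfolding compact_open_bisection_def by auto
    show "disjoint_family_on (\<lambda>z. r ` V (fst z) (snd z) \<times> {0}) ?I"
      unfolding disjoint_family_on_def
    proof (intro ballI impI)
      fix z z' assume "z \<in> ?I" "z' \<in> ?I" "z \<noteq> z'"
      then have "r ` V (fst z) (snd z) \<inter> r ` V (fst z') (snd z') = {}"
        using disjoint_family_onD[OF dis] by (simp add: case_prod_beta')
      then show "r ` V (fst z) (snd z) \<times> {0} \<inter> r ` V (fst z') (snd z') \<times> {0} = {}" by blast
    qed
    \<comment> \<open>The copies numbered 1 and 2 in the definition of paradoxicality are the levels
      0 and 1 here, whence \<open>fst z - 1\<close>.\<close>
    show "A \<times> {0, 1} \<subseteq> (\<Union>z\<in>?I. s ` V (fst z) (snd z) \<times> {fst z - 1})"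
    proof
      fix z assume "z \<in> A \<times> {0, 1 :: nat}"
      then obtain u i where z: "z = (u, i)" "u \<in> A" "i + 1 \<in> {1, 2 :: nat}" by force
      then obtain j where j: "j \<in> {1..n (i + 1)}" "u \<in> s ` V (i + 1) j" using bspec[OF h(1) z(3)] by blast
      then show "z \<in> (\<Union>z\<in>?I. s ` V (fst z) (snd z) \<times> {fst z - 1})"
        using z by (intro UN_I[of "(i + 1, j)"]) simp_all
    qed
    show "unit_compact_open (A \<times> {0, 1})" using A by (intro unit_compact_open_Times) auto
  qed auto
  moreover have "r ` V (fst z) (snd z) \<subseteq> A" if "z \<in> ?I" for z
  proof -
    have "fst z \<in> {1, 2}" "snd z \<in> {1..n (fst z)}" using that by auto
    then show ?thesis using h(2) by blast
  qed
  then have "(\<Union>z\<in>?I. r ` V (fst z) (snd z) \<times> {0 :: nat}) \<subseteq> A \<times> {0}" by blast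
  ultimately show "subeq (A \<times> {0, 1}) (A \<times> {0})" by (rule subeq_mono)
next
  assume "subeq (A \<times> {0, 1}) (A \<times> {0})"
  then obtain V :: "nat \<Rightarrow> 'a set" where V: "\<forall>i. compact_open_bisection G (V i)" "\<forall>i\<in>{0, 1}. s ` V i = A"
    "\<forall>i. r ` V i \<subseteq> A" "r ` V 0 \<inter> r ` V 1 = {}" by (rule subeq_double_bisections)
  show "two_one_paradoxical G A" unfolding two_one_paradoxical_def
  proof (intro exI[of _ "\<lambda>_. 1"] exI[of _ "\<lambda>i (j::nat). V (i - 1)"] conjI ballI)
    show "compact_open_bisection G (V (i - 1))" for i using V(1) by blast
    show "A = (\<Union>j\<in>{1..1::nat}. s ` V (i - 1))" if "i \<in> {1, 2}" for i
      using bspec[OF V(2), of "i - 1"] that by auto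
    show "disjoint_family_on (\<lambda>(i, j). r ` V (i - 1)) (SIGMA i:{1, 2}. {1..1::nat})"
      unfolding disjoint_family_on_def using V(4) by auto
    show "r ` V (i - 1) \<subseteq> A" for i using V(3) by blast
  qed
qed

end

section \<open>The two semigroups\<close>

context ample_groupoid
begin

section \<open>Concatenation and the type semigroup\<close>

abbreviation "shift n P \<equiv> map_prod id ((+) (n::nat)) ` P"

lemma equidec_shift_add: "unit_compact_open P \<Longrightarrow> equidec P (shift n P)"
  by (rule equidec_shift) auto

lemma tagged_union_shift_disjoint: "T a \<inter> shift (length a) Q = {}"
  by (auto simp: tagged_union_def)

lemma tagged_union_shift_disjoint': "shift (length a) Q \<inter> T a = {}"
  using tagged_union_shift_disjoint[of a Q] by (simp add: Int_commute)

lemma equidec_append: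
  assumes "equidec (T a) (T a')" "equidec (T b) (T b')"
  shows "equidec (T (a @ b)) (T (a' @ b'))"
proof -
  have "unit_compact_open (T b)" "unit_compact_open (T b')" using equidec_unit_compact_open[OF assms(2)] by simp_all
  then have "equidec (shift (length a) (T b)) (T b)" "equidec (T b') (shift (length a') (T b'))"
    using equidec_sym[OF equidec_shift_add] equidec_shift_add by blast+
  then have "equidec (shift (length a) (T b)) (shift (length a') (T b'))"
    using assms(2) equidec_trans by metis
  then show ?thesis unfolding tagged_union_append
    by (intro equidec_Un assms(1) tagged_union_shift_disjoint)
qed

lemma equidec_append_comm:
  assumes "unit_compact_open (T a)" "unit_compact_open (T b)"
  shows "equidec (T (a @ b)) (T (b @ a))"
proof -
  have 1: "equidec (T a) (shift (length b) (T a))" by (rule equidec_shift_add[OF assms(1)])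
  have 2: "equidec (shift (length a) (T b)) (T b)" by (rule equidec_sym[OF equidec_shift_add[OF assms(2)]])
  have "equidec (T a \<union> shift (length a) (T b)) (shift (length b) (T a) \<union> T b)"
    by (rule equidec_Un[OF 1 2 tagged_union_shift_disjoint tagged_union_shift_disjoint'])
  then show ?thesis unfolding tagged_union_append by (simp add: Un_commute)
qed

lemma tagged_union_empty_append: "T ([{}] @ a) = shift 1 (T a)"
  unfolding tagged_union_append by (auto simp: tagged_union_single)

text \<open>Turns a tagged set back into a sequence, with empty terms filling it up to the length of
  \<open>b\<close>.\<close>

lemma tagged_union_slices:
  assumes "P \<subseteq> T b" shows "T (map (slice P) [0..<length b]) = P"
proof (intro equalityI subsetI)
  fix z assume z: "z \<in> P"
  then have "snd z < length b" using assms by (cases z) (auto simp: mem_tagged_union)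
  then show "z \<in> T (map (slice P) [0..<length b])" using z by (cases z) (simp add: mem_tagged_union)
qed (auto simp: mem_tagged_union)

lemma compact_open_slices:
  assumes "unit_compact_open P" "b \<noteq> []"
  shows "map (slice P) [0..<length b] \<in> compact_open_seqs G"
  using assms unfolding compact_open_seqs_iff unit_compact_open_def tagged_compact_open_def by auto

lemma type_equiv_iff:
  "(a, b) \<in> type_equiv G \<longleftrightarrow> a \<in> compact_open_seqs G \<and> b \<in> compact_open_seqs G \<and> equidec (T a) (T b)"
  by (simp add: type_equiv_def type_rel_iff)

lemma append_compact_open_seqs:
  "a \<in> compact_open_seqs G \<Longrightarrow> b \<in> compact_open_seqs G \<Longrightarrow> a @ b \<in> compact_open_seqs G"
  by (auto simp: compact_open_seqs_def)

lemma append_open_seqs: "a \<in> open_seqs G \<Longrightarrow> b \<in> open_seqs G \<Longrightarrow> a @ b \<in> open_seqs G"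
  by (auto simp: open_seqs_def)

lemma equiv_type_equiv: "equiv (compact_open_seqs G) (type_equiv G)"
proof (rule equivI)
  show "type_equiv G \<subseteq> compact_open_seqs G \<times> compact_open_seqs G"
    by (auto simp: type_equiv_iff)
  show "refl_on (compact_open_seqs G) (type_equiv G)"
    using equidec_refl unit_compact_open_tagged_union by (auto simp: refl_on_def type_equiv_iff)
  show "sym (type_equiv G)" using equidec_sym by (auto simp: sym_def type_equiv_iff)
  show "trans (type_equiv G)" unfolding trans_def type_equiv_iff using equidec_trans by blast
qed

lemma type_add_classes:
  assumes "a \<in> compact_open_seqs G" "b \<in> compact_open_seqs G"
  shows "type_add G (type_equiv G `` {a}) (type_equiv G `` {b}) = type_equiv G `` {a @ b}"
proof -
  have "type_equiv G `` {a' @ b'} = type_equiv G `` {a @ b}"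
    if "a' \<in> type_equiv G `` {a}" "b' \<in> type_equiv G `` {b}" for a' b'
  proof (rule equiv_class_eq[OF equiv_type_equiv, symmetric])
    show "(a @ b, a' @ b') \<in> type_equiv G"
      using that equidec_append append_compact_open_seqs by (simp add: type_equiv_iff)
  qed
  moreover have "a \<in> type_equiv G `` {a}" "b \<in> type_equiv G `` {b}"
    using equiv_class_self[OF equiv_type_equiv] assms by auto
  ultimately show ?thesis unfolding type_add_def by blast
qed

text \<open>A summand embeds into the sum as its first levels. Conversely, the complement in
  \<open>T b\<close> of an embedded copy of \<open>T a\<close> is again compact open, and its slices
  form the missing summand.\<close>

lemma type_le_iff:
  assumes a: "a \<in> compact_open_seqs G" and b: "b \<in> compact_open_seqs G"
  shows "(\<exists>Z\<in>type_classes G. type_equiv G `` {b} = type_add G (type_equiv G `` {a}) Z) \<longleftrightarrow> subeq (T a) (T b)"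
proof
  assume "\<exists>Z\<in>type_classes G. type_equiv G `` {b} = type_add G (type_equiv G `` {a}) Z"
  then obtain c where c: "c \<in> compact_open_seqs G"
    "type_equiv G `` {b} = type_add G (type_equiv G `` {a}) (type_equiv G `` {c})"
    unfolding type_classes_def quotient_def by blast
  then have "type_equiv G `` {b} = type_equiv G `` {a @ c}" using type_add_classes[OF a c(1)] by simp
  then have "(b, a @ c) \<in> type_equiv G"
    using eq_equiv_class[OF _ equiv_type_equiv] append_compact_open_seqs[OF a c(1)] by blast
  then have "equidec (T (a @ c)) (T b)" using equidec_sym by (simp add: type_equiv_iff)
  moreover have "subeq (T a) (T (a @ c))"
    by (rule subeq_refl[OF unit_compact_open_tagged_union[OF a]]) (auto simp: tagged_union_append)
  ultimately show "subeq (T a) (T b)" using subeq_trans equidec_imp_subeq by blast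
next
  assume "subeq (T a) (T b)"
  then obtain Q where Q: "equidec (T a) Q" "Q \<subseteq> T b" unfolding subeq_def by (elim exE conjE)
  let ?R = "T b - Q" let ?c = "map (slice ?R) [0..<length b]"
  have R: "unit_compact_open ?R" by (rule unit_compact_open_Diff[OF unit_compact_open_tagged_union[OF b]]) (use equidec_unit_compact_open[OF Q(1)] in simp)
  have c: "?c \<in> compact_open_seqs G" by (rule compact_open_slices[OF R]) (use b in \<open>simp add: compact_open_seqs_iff\<close>)
  have Tc: "T ?c = ?R" by (rule tagged_union_slices) blast
  have "equidec (shift (length a) ?R) ?R" by (rule equidec_sym[OF equidec_shift_add[OF R]])
  then have "equidec (T a \<union> shift (length a) ?R) (Q \<union> ?R)"
    by (intro equidec_Un[OF Q(1)] tagged_union_shift_disjoint) auto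
  moreover have "Q \<union> ?R = T b" using Q(2) by blast
  ultimately have "equidec (T (a @ ?c)) (T b)" unfolding tagged_union_append Tc by simp
  then have "(a @ ?c, b) \<in> type_equiv G" using append_compact_open_seqs[OF a c] b by (simp add: type_equiv_iff)
  then have "type_equiv G `` {b} = type_equiv G `` {a @ ?c}"
    using equiv_class_eq[OF equiv_type_equiv] by (metis)
  then have "type_equiv G `` {b} = type_add G (type_equiv G `` {a}) (type_equiv G `` {?c})"
    using type_add_classes[OF a c] by simp
  then show "\<exists>Z\<in>type_classes G. type_equiv G `` {b} = type_add G (type_equiv G `` {a}) Z"
    unfolding type_classes_def using quotientI[OF c] by blast
qed

lemma subeq_append:
  assumes "subeq (T a) (T b)" "unit_compact_open (T c)"
  shows "subeq (T (a @ c)) (T (b @ c))"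
proof -
  have "equidec (shift (length a) (T c)) (shift (length b) (T c))"
    using equidec_trans[OF equidec_sym[OF equidec_shift_add[OF assms(2)]] equidec_shift_add[OF assms(2)]] .
  then show ?thesis unfolding tagged_union_append
    by (intro subeq_Un[OF assms(1) equidec_imp_subeq] tagged_union_shift_disjoint)
qed

lemma unit_set_empty: "compact_open_unit_set G {}"
  by (simp add: compact_open_unit_set_iff)

lemma type_seq_quotient:
  "seq_quotient (compact_open_unit_set G) (type_equiv G) {} (\<lambda>a b. subeq (T a) (T b))
     (pre_le (type_semigroup G)) (compact_open_seqs G)"
proof
  show "compact_open_seqs G = {a. a \<noteq> [] \<and> (\<forall>U\<in>set a. compact_open_unit_set G U)}"
    by (simp add: compact_open_seqs_def)
  show "equiv (compact_open_seqs G) (type_equiv G)" by (rule equiv_type_equiv)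
  show "(a @ b, a' @ b') \<in> type_equiv G" if "(a, a') \<in> type_equiv G" "(b, b') \<in> type_equiv G" for a a' b b'
    using that equidec_append append_compact_open_seqs by (simp add: type_equiv_iff)
  show "compact_open_unit_set G {}" by (rule unit_set_empty)
  fix a assume a: "a \<in> compact_open_seqs G"
  note ua = unit_compact_open_tagged_union[OF a]
  show "([{}] @ a, a) \<in> type_equiv G"
  proof -
    have "[{}] \<in> compact_open_seqs G" using unit_set_empty by (simp add: compact_open_seqs_def)
    moreover have "equidec (T ([{}] @ a)) (T a)"
      unfolding tagged_union_empty_append by (rule equidec_sym[OF equidec_shift_add[OF ua]])
    ultimately show ?thesis unfolding type_equiv_iff using append_compact_open_seqs a by blast
  qed
  show "subeq (T a) (T a)" using subeq_refl[OF ua] by simp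
  show "subeq (T [{}]) (T a)" using subeq_refl[OF unit_compact_open_empty] by (simp add: tagged_union_single)
  fix b assume b: "b \<in> compact_open_seqs G"
  note ub = unit_compact_open_tagged_union[OF b]
  show "(a @ b, b @ a) \<in> type_equiv G"
    using equidec_append_comm[OF ua ub] append_compact_open_seqs a b by (simp add: type_equiv_iff)
  show "pre_le (type_semigroup G) (type_equiv G `` {a}) (type_equiv G `` {b}) = subeq (T a) (T b)"
    using type_le_iff[OF a b] by (simp add: type_semigroup_def)
  show "subeq (T (c @ a)) (T (d @ a))" if "subeq (T c) (T d)" for c d
    by (rule subeq_append[OF that ua])
qed (rule subeq_trans)

lemma type_semigroup_eq:
  "seq_quotient.quotient_monoid (type_equiv G) {} (pre_le (type_semigroup G)) (compact_open_seqs G) = type_semigroup G"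
  unfolding seq_quotient.quotient_monoid_def[OF type_seq_quotient]
  by (simp add: type_semigroup_def type_classes_def type_add_def[abs_def])

section \<open>The order of the groupoid semigroup\<close>

definition open_subeq :: "('a \<times> nat) set \<Rightarrow> ('a \<times> nat) set \<Rightarrow> bool" where
  "open_subeq P Q \<longleftrightarrow> (\<forall>K. unit_compact_open K \<and> K \<subseteq> P \<longrightarrow> subeq K Q)"

lemma seq_le_iff_open_subeq: "a \<in> open_seqs G \<Longrightarrow> seq_le G a b \<longleftrightarrow> open_subeq (T a) (T b)"
  by (simp add: seq_le_iff open_subeq_def)

lemma open_subeq_refl: "P \<subseteq> Q \<Longrightarrow> open_subeq P Q"
  unfolding open_subeq_def using subeq_refl by blast

text \<open>A compact open test set is carried onto a compact open subset of \<open>Q\<close>, which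
  is a test set for the second comparison.\<close>

lemma open_subeq_trans:
  assumes "open_subeq P Q" "open_subeq Q R" shows "open_subeq P R"
  unfolding open_subeq_def
proof (intro allI impI)
  fix K assume "unit_compact_open K \<and> K \<subseteq> P"
  then have "subeq K Q" using assms(1) unfolding open_subeq_def by blast
  then obtain Q' where Q': "equidec K Q'" "Q' \<subseteq> Q" unfolding subeq_def by (elim exE conjE)
  then have "subeq Q' R" using assms(2) equidec_unit_compact_open[OF Q'(1)] unfolding open_subeq_def by blast
  then show "subeq K R" using subeq_trans[OF equidec_imp_subeq[OF Q'(1)]] by blast
qed

text \<open>Inside \<open>K\<close> the sets \<open>P\<close> and \<open>P'\<close> are
  complementary: K \<inter> P is open because \<open>P\<close> is, and compact because it is
  \<open>K\<close> minus the open set \<open>P'\<close>.\<close>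

lemma unit_compact_open_Int_open:
  assumes K: "unit_compact_open K" "K \<subseteq> P \<union> P'" and P: "\<And>t. openin X (slice P t)" "\<And>t. openin X (slice P' t)"
    and disj: "P \<inter> P' = {}"
  shows "unit_compact_open (K \<inter> P)"
proof -
  have "compact_open (slice (K \<inter> P) t)" for t
  proof -
    have cK: "compact_open (slice K t)" using K(1) by (simp add: unit_compact_open_def tagged_compact_open_def)
    have "K \<inter> P = K - P'" using K(2) disj by blast
    then have "slice (K \<inter> P) t = slice K t - slice P' t" by (simp add: slice_Diff)
    then have "compactin X (slice (K \<inter> P) t)"
      using compactin_Hausdorff_Diff[OF Hausdorff] cK P(2) by (simp add: compact_open_def)
    moreover have "openin X (slice (K \<inter> P) t)" using cK P(1) by (simp add: slice_Int compact_open_def openin_Int)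
    ultimately show ?thesis by (simp add: compact_open_def)
  qed
  moreover have "finite (snd ` (K \<inter> P))"
    using K(1) by (intro finite_subset[of "snd ` (K \<inter> P)" "snd ` K"]) (auto simp: unit_compact_open_def tagged_compact_open_def)
  ultimately show ?thesis using K(1) by (auto simp: unit_compact_open_def tagged_compact_open_def)
qed

lemma open_subeq_Un:
  assumes "open_subeq P Q" "open_subeq P' Q'" "P \<inter> P' = {}" "Q \<inter> Q' = {}"
    and P: "\<And>t. openin X (slice P t)" "\<And>t. openin X (slice P' t)"
  shows "open_subeq (P \<union> P') (Q \<union> Q')"
  unfolding open_subeq_def
proof (intro allI impI)
  fix K assume K: "unit_compact_open K \<and> K \<subseteq> P \<union> P'"
  then have u: "unit_compact_open (K \<inter> P)" "unit_compact_open (K \<inter> P')"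
    using unit_compact_open_Int_open[of K P P'] unit_compact_open_Int_open[of K P' P] P assms(3) by (auto simp: Int_commute Un_commute)
  have "subeq (K \<inter> P) Q" "subeq (K \<inter> P') Q'"
    using assms(1,2) u unfolding open_subeq_def by blast+
  then have "subeq ((K \<inter> P) \<union> (K \<inter> P')) (Q \<union> Q')" by (rule subeq_Un) (use assms(3,4) in auto)
  moreover have "(K \<inter> P) \<union> (K \<inter> P') = K" using K by blast
  ultimately show "subeq K (Q \<union> Q')" by simp
qed

lemma open_subeq_shift: "open_subeq P (shift n P)"
  unfolding open_subeq_def
proof (intro allI impI)
  fix K assume K: "unit_compact_open K \<and> K \<subseteq> P"
  then have "subeq K (shift n K)" using equidec_imp_subeq equidec_shift_add by blast
  then show "subeq K (shift n P)" by (rule subeq_mono) (use K in blast)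
qed

lemma open_subeq_unshift: "open_subeq (shift n P) P"
  unfolding open_subeq_def
proof (intro allI impI)
  fix K assume K: "unit_compact_open K \<and> K \<subseteq> shift n P"
  \<comment> \<open>Truncated subtraction undoes the shift: it is injective here because every level
    of \<open>K\<close> is at least \<open>n\<close>.\<close>
  have "inj_on (\<lambda>i. i - n) (snd ` K)"
  proof (rule inj_onI)
    fix i j assume "i \<in> snd ` K" "j \<in> snd ` K" "i - n = j - n"
    moreover have "n \<le> i" if "i \<in> snd ` K" for i using that K by auto
    ultimately show "i = j" by (metis le_add_diff_inverse)
  qed
  then have "equidec K (map_prod id (\<lambda>i. i - n) ` K)" using K equidec_shift by blast
  moreover have "map_prod id (\<lambda>i. i - n) ` K \<subseteq> P" using K by auto
  ultimately show "subeq K P" unfolding subeq_def by blast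
qed

lemma openin_slice_tagged_union: "a \<in> open_seqs G \<Longrightarrow> openin X (slice (T a) t)"
  by (auto simp: slice_tagged_union open_seqs_iff)

lemma openin_slice_shift:
  assumes "a \<in> open_seqs G" shows "openin X (slice (shift n (T a)) t)"
proof -
  have "slice (shift n (T a)) t = (if n \<le> t then slice (T a) (t - n) else {})"
    by (auto simp: slice_def image_iff) (metis add_diff_inverse_nat id_apply le_add1 map_prod_simp not_less)+
  then show ?thesis using openin_slice_tagged_union[OF assms] by simp
qed

lemma seq_le_append:
  assumes "a \<in> open_seqs G" "b \<in> open_seqs G" "seq_le G a a'" "seq_le G b b'"
  shows "seq_le G (a @ b) (a' @ b')"
proof -
  have 1: "open_subeq (T a) (T a')" "open_subeq (T b) (T b')"
    using assms seq_le_iff_open_subeq by blast+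
  then have 2: "open_subeq (shift (length a) (T b)) (shift (length a') (T b'))"
    using open_subeq_trans[OF open_subeq_trans[OF open_subeq_unshift 1(2)] open_subeq_shift] by blast
  have "open_subeq (T (a @ b)) (T (a' @ b'))" unfolding tagged_union_append
    by (intro open_subeq_Un[OF 1(1) 2] tagged_union_shift_disjoint openin_slice_tagged_union openin_slice_shift assms)
  then show ?thesis using seq_le_iff_open_subeq append_open_seqs assms by simp
qed

lemma seq_le_refl: "a \<in> open_seqs G \<Longrightarrow> seq_le G a a"
  by (simp add: seq_le_iff_open_subeq open_subeq_refl)

lemma seq_le_trans:
  "seq_le G a b \<Longrightarrow> seq_le G b c \<Longrightarrow> a \<in> open_seqs G \<Longrightarrow> b \<in> open_seqs G \<Longrightarrow> seq_le G a c"
  using open_subeq_trans by (simp add: seq_le_iff_open_subeq)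

lemma seq_le_comm:
  assumes "a \<in> open_seqs G" "b \<in> open_seqs G" shows "seq_le G (a @ b) (b @ a)"
proof -
  have "open_subeq (T a \<union> shift (length a) (T b)) (shift (length b) (T a) \<union> T b)"
    by (intro open_subeq_Un open_subeq_shift open_subeq_unshift tagged_union_shift_disjoint
        tagged_union_shift_disjoint' openin_slice_tagged_union openin_slice_shift assms)
  then show ?thesis using append_open_seqs[OF assms]
    by (simp add: seq_le_iff_open_subeq tagged_union_append Un_commute)
qed

lemma seq_equiv_iff:
  "(a, b) \<in> seq_equiv G \<longleftrightarrow> a \<in> open_seqs G \<and> b \<in> open_seqs G \<and> seq_le G a b \<and> seq_le G b a"
  by (simp add: seq_equiv_def)

lemma equiv_seq_equiv: "equiv (open_seqs G) (seq_equiv G)"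
proof (rule equivI)
  show "seq_equiv G \<subseteq> open_seqs G \<times> open_seqs G" by (auto simp: seq_equiv_iff)
  show "refl_on (open_seqs G) (seq_equiv G)" using seq_le_refl by (auto simp: refl_on_def seq_equiv_iff)
  show "sym (seq_equiv G)" by (auto simp: sym_def seq_equiv_iff)
  show "trans (seq_equiv G)" unfolding trans_def seq_equiv_iff using seq_le_trans by blast
qed

lemma groupoid_seq_quotient:
  "seq_quotient (openin (unit_top G)) (seq_equiv G) {} (seq_le G)
     (pre_le (groupoid_semigroup G)) (open_seqs G)"
proof
  show "open_seqs G = {a. a \<noteq> [] \<and> (\<forall>U\<in>set a. openin (unit_top G) U)}"
    by (simp add: open_seqs_def)
  show "equiv (open_seqs G) (seq_equiv G)" by (rule equiv_seq_equiv)
  show "(a @ b, a' @ b') \<in> seq_equiv G" if "(a, a') \<in> seq_equiv G" "(b, b') \<in> seq_equiv G" for a a' b b'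
    using that seq_le_append append_open_seqs by (simp add: seq_equiv_iff)
  show "openin (unit_top G) {}" by simp
  have z: "[{}] \<in> open_seqs G" by (simp add: open_seqs_def)
  fix a assume a: "a \<in> open_seqs G"
  show "([{}] @ a, a) \<in> seq_equiv G"
  proof -
    have "open_subeq (T ([{}] @ a)) (T a)" "open_subeq (T a) (T ([{}] @ a))"
      unfolding tagged_union_empty_append by (rule open_subeq_unshift open_subeq_shift)+
    then show ?thesis using append_open_seqs[OF z a] a unfolding seq_equiv_iff seq_le_iff_open_subeq[OF a]
      by (simp only: seq_le_iff_open_subeq simp_thms)
  qed
  show "seq_le G a a" by (rule seq_le_refl[OF a])
  show "seq_le G [{}] a" by (simp add: seq_le_iff_open_subeq[OF z] open_subeq_refl tagged_union_single)
  fix b assume b: "b \<in> open_seqs G"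
  show "(a @ b, b @ a) \<in> seq_equiv G"
    using seq_le_comm append_open_seqs a b by (simp add: seq_equiv_iff)
  show "pre_le (groupoid_semigroup G) (seq_equiv G `` {a}) (seq_equiv G `` {b}) = seq_le G a b"
  proof
    assume "pre_le (groupoid_semigroup G) (seq_equiv G `` {a}) (seq_equiv G `` {b})"
    then obtain a' b' where h: "(a, a') \<in> seq_equiv G" "(b, b') \<in> seq_equiv G" "seq_le G a' b'"
      by (auto simp: groupoid_semigroup_def)
    then have "seq_le G a b'" using seq_le_trans[of a a' b'] by (simp add: seq_equiv_iff)
    then show "seq_le G a b" using seq_le_trans[of a b' b] h by (simp add: seq_equiv_iff)
  next
    assume "seq_le G a b"
    moreover have "a \<in> seq_equiv G `` {a}" "b \<in> seq_equiv G `` {b}"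
      using equiv_class_self[OF equiv_seq_equiv] a b by auto
    ultimately show "pre_le (groupoid_semigroup G) (seq_equiv G `` {a}) (seq_equiv G `` {b})"
      by (auto simp: groupoid_semigroup_def)
  qed
next
  show "seq_le G a c" if "seq_le G a b" "seq_le G b c" "a \<in> open_seqs G" "b \<in> open_seqs G" for a b c
    using seq_le_trans that by blast
  show "seq_le G (a @ c) (b @ c)" if "seq_le G a b" "a \<in> open_seqs G" "c \<in> open_seqs G" for a b c
    using seq_le_append seq_le_refl that by blast
qed

lemma groupoid_semigroup_eq:
  "seq_quotient.quotient_monoid (seq_equiv G) {} (pre_le (groupoid_semigroup G)) (open_seqs G) = groupoid_semigroup G"
  unfolding seq_quotient.quotient_monoid_def[OF groupoid_seq_quotient]
  by (simp add: groupoid_semigroup_def)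

lemmas type_semigroup_singletons =
  seq_quotient.purely_infinite_singletons[OF type_seq_quotient, unfolded type_semigroup_eq]

lemmas type_semigroup_states =
  seq_quotient.quotient_purely_infinite_iff[OF type_seq_quotient, unfolded type_semigroup_eq]

lemmas groupoid_semigroup_singletons =
  seq_quotient.purely_infinite_singletons[OF groupoid_seq_quotient, unfolded groupoid_semigroup_eq]

lemmas groupoid_semigroup_states =
  seq_quotient.quotient_purely_infinite_iff[OF groupoid_seq_quotient, unfolded groupoid_semigroup_eq]

end

section \<open>Equivalence of the conditions\<close>

context ample_groupoid
begin

text \<open>The empty set is included, to match the semigroups; paradoxicality is asked only of
  non-empty sets.\<close>

definition all_double :: bool where
  "all_double \<longleftrightarrow> (\<forall>A. compact_open A \<and> A \<subseteq> units G \<longrightarrow> subeq (A \<times> {0, 1}) (A \<times> {0}))"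

lemma tagged_union_double: "T [A, A] = A \<times> {0, 1}"
  by (auto simp: tagged_union_def lessThan_Suc)

lemma two_one_iff_all_double:
  "(\<forall>A. compact_open_unit_set G A \<and> A \<noteq> {} \<longrightarrow> two_one_paradoxical G A) \<longleftrightarrow> all_double"
proof -
  have "subeq ({} \<times> {0, 1}) ({} \<times> {0})" using subeq_refl[OF unit_compact_open_empty] by simp
  then show ?thesis unfolding all_double_def compact_open_unit_set_iff using two_one_paradoxical_iff by metis
qed

lemma type_semigroup_all_double: "purely_infinite_monoid (type_semigroup G) \<longleftrightarrow> all_double"
  unfolding type_semigroup_singletons all_double_def tagged_union_double tagged_union_single
    compact_open_unit_set_iff ..

lemma groupoid_semigroup_all_double: "purely_infinite_monoid (groupoid_semigroup G) \<longleftrightarrow> all_double"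
proof -
  have e: "seq_le G [U, U] [U] \<longleftrightarrow> open_subeq (U \<times> {0, 1}) (U \<times> {0})" if "openin (unit_top G) U" for U
    using that by (subst seq_le_iff_open_subeq) (simp_all add: open_seqs_def tagged_union_double tagged_union_single)
  show ?thesis unfolding groupoid_semigroup_singletons
  proof
    assume L: "\<forall>U. openin (unit_top G) U \<longrightarrow> seq_le G [U, U] [U]"
    show all_double unfolding all_double_def
    proof (intro allI impI)
      fix A assume A: "compact_open A \<and> A \<subseteq> units G"
      then have "open_subeq (A \<times> {0, 1}) (A \<times> {0})" using L e by (simp add: openin_unit_top compact_open_def)
      moreover have "unit_compact_open (A \<times> {0, 1})" using A by (intro unit_compact_open_Times) auto
      ultimately show "subeq (A \<times> {0, 1}) (A \<times> {0})" unfolding open_subeq_def by blast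
    qed
  next
    assume R: all_double
    show "\<forall>U. openin (unit_top G) U \<longrightarrow> seq_le G [U, U] [U]"
    proof (intro allI impI)
      fix U assume U: "openin (unit_top G) U"
      have "open_subeq (U \<times> {0, 1}) (U \<times> {0})" unfolding open_subeq_def
      proof (intro allI impI)
        fix K :: "('a \<times> nat) set" assume K: "unit_compact_open K \<and> K \<subseteq> U \<times> {0, 1}"
        \<comment> \<open>One compact open set inside \<open>U\<close> that contains both levels of
          the test set, so that doubling it embeds \<open>K\<close>.\<close>
        let ?A = "slice K 0 \<union> slice K 1"
        have "compact_open ?A" using K by (intro compact_open_Un) (simp_all add: unit_compact_open_def tagged_compact_open_def)
        moreover have "?A \<subseteq> units G" using K by (auto simp: unit_compact_open_def)
        ultimately have d: "subeq (?A \<times> {0, 1}) (?A \<times> {0})" using R unfolding all_double_def by blast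
        have "K \<subseteq> ?A \<times> {0, 1}" using K by auto
        then have "subeq K (?A \<times> {0, 1})" by (intro subeq_refl conjunct1[OF K])
        then have "subeq K (?A \<times> {0})" by (rule subeq_trans[OF _ d])
        then show "subeq K (U \<times> {0})" by (rule subeq_mono) (use K in auto)
      qed
      then show "seq_le G [U, U] [U]" using e U by blast
    qed
  qed
qed

section \<open>Pure infiniteness and paradoxical comparison of the groupoid\<close>

lemma purely_infinite_imp_paradoxical:
  assumes "purely_infinite_groupoid G" shows "paradoxical_comparison G"
  unfolding paradoxical_comparison_def
proof (intro allI impI)
  fix U assume U: "openin (unit_top G) U \<and> U \<noteq> {}"
  have "U \<subseteq> rng G ` arrows_from G U"
  proof
    fix u assume u: "u \<in> U"
    then have "u \<in> units G" using U by (auto simp: openin_unit_top)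
    then have "u \<in> arrows_from G U" "r u = u" using u units_arrows by (auto simp: arrows_from_def)
    then show "u \<in> rng G ` arrows_from G U" by (metis imageI)
  qed
  then show "open_below2 G U U" using assms U unfolding purely_infinite_groupoid_def by blast
qed

text \<open>A compact open set may serve as its own compact test set; its two copies then go to the
  disjoint sets \<open>O1\<close> and \<open>O2\<close>.\<close>

lemma paradoxical_imp_all_double:
  assumes "paradoxical_comparison G" shows all_double
  unfolding all_double_def
proof (intro allI impI)
  fix A assume A: "compact_open A \<and> A \<subseteq> units G"
  show "subeq (A \<times> {0, 1}) (A \<times> {0})"
  proof (cases "A = {}")
    case True
    then show ?thesis using subeq_refl[OF unit_compact_open_empty] by simp
  next
    case False
    have "openin (unit_top G) A" "compactin (unit_top G) A"
      using A by (simp_all add: openin_unit_top compactin_unit_top compact_open_def)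
    then have "open_below2 G A A" using assms False unfolding paradoxical_comparison_def by simp
    then have "\<exists>O1 O2. openin (unit_top G) O1 \<and> openin (unit_top G) O2 \<and> O1 \<noteq> {} \<and> O2 \<noteq> {} \<and>
           O1 \<inter> O2 = {} \<and> O1 \<subseteq> A \<and> O2 \<subseteq> A \<and> compact_below G A O1 \<and> compact_below G A O2"
      using \<open>compactin (unit_top G) A\<close> unfolding open_below2_def by simp
    then obtain O1 O2 where O: "O1 \<inter> O2 = {}" "O1 \<subseteq> A" "O2 \<subseteq> A"
      "compact_below G A O1" "compact_below G A O2" by (elim exE conjE)
    have 1: "subeq (A \<times> {0}) (O1 \<times> {0})" "subeq (A \<times> {1}) (O2 \<times> {0})"
      using compact_below_imp_subeq O(4,5) A by simp_all
    have "subeq (A \<times> {0} \<union> A \<times> {1}) (O1 \<times> {0} \<union> O2 \<times> {0})"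
      by (rule subeq_Un[OF 1]) (use O(1) in auto)
    moreover have "A \<times> {0} \<union> A \<times> {1} = A \<times> {0, 1 :: nat}" by auto
    moreover have "O1 \<times> {0} \<union> O2 \<times> {0} \<subseteq> A \<times> {0 :: nat}" using O(2,3) by blast
    ultimately show ?thesis using subeq_mono by simp
  qed
qed

text \<open>The first n copies are pushed into level 0 and the next one into level 1; doubling
  merges these two levels.\<close>

lemma subeq_multiples:
  assumes H: all_double and K: "compact_open K" "K \<subseteq> units G"
  shows "subeq (K \<times> {..<n}) (K \<times> {0})"
proof (induction n)
  case 0
  then show ?case using subeq_refl[OF unit_compact_open_empty] by simp
next
  case (Suc n)
  have "equidec (K \<times> {n}) (map_prod id (\<lambda>_. 1) ` (K \<times> {n}))"
    by (rule equidec_shift[OF unit_compact_open_Times[OF K]]) auto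
  moreover have "map_prod id (\<lambda>_. 1) ` (K \<times> {n}) = K \<times> {1 :: nat}" by force
  ultimately have 1: "subeq (K \<times> {n}) (K \<times> {1})" using equidec_imp_subeq by simp
  have "subeq (K \<times> {..<n} \<union> K \<times> {n}) (K \<times> {0} \<union> K \<times> {1})"
    by (rule subeq_Un[OF Suc 1]) auto
  moreover have "K \<times> {..<n} \<union> K \<times> {n} = K \<times> {..<Suc n}" by auto
  moreover have "K \<times> {0} \<union> K \<times> {1} = K \<times> {0, 1 :: nat}" by auto
  ultimately have "subeq (K \<times> {..<Suc n}) (K \<times> {0, 1})" by simp
  moreover have "subeq (K \<times> {0, 1}) (K \<times> {0})" using H K unfolding all_double_def by blast
  ultimately show ?case by (rule subeq_trans)
qed

lemma src_ginv_image: "B \<subseteq> arrows G \<Longrightarrow> s ` ginv G ` B = r ` B"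
  and rng_ginv_image: "B \<subseteq> arrows G \<Longrightarrow> r ` ginv G ` B = s ` B"
  by (force simp: image_image)+

lemma inverse_bisection:
  assumes "compact_open_bisection G B" shows "compact_open_bisection G (ginv G ` B)"
proof -
  have B: "compact_open B" "inj_on s B" "inj_on r B" using assms compact_open_bisection_iff by auto
  have a: "B \<subseteq> arrows G" by (rule compact_open_arrows[OF B(1)])
  have "inj_on s (ginv G ` B)"
    by (rule inj_on_imageI) (use B(3) a in \<open>auto simp: inj_on_def subset_iff\<close>)
  moreover have "inj_on r (ginv G ` B)"
    by (rule inj_on_imageI) (use B(2) a in \<open>auto simp: inj_on_def subset_iff\<close>)
  ultimately show ?thesis using compact_open_ginv[OF B(1)] by (simp add: compact_open_bisection_iff)
qed

text \<open>Finitely many bisections with sources in \<open>V\<close> cover \<open>F\<close> by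
  their ranges. Their inverses carry pieces of \<open>F\<close> to sources that may overlap; these
  are kept apart on n levels and compressed into one compact open K \<subseteq> V. Doubling K
  provides the two disjoint targets.\<close>

lemma all_double_imp_purely_infinite:
  assumes H: all_double shows "purely_infinite_groupoid G"
  unfolding purely_infinite_groupoid_def open_below2_def
proof (intro allI impI)
  fix U V F
  assume UV: "openin (unit_top G) U \<and> openin (unit_top G) V \<and> U \<noteq> {} \<and> V \<noteq> {} \<and>
      U \<subseteq> rng G ` arrows_from G V" and F: "compactin (unit_top G) F \<and> F \<subseteq> U"
  have V: "openin X V" "V \<subseteq> units G" using UV by (simp_all add: openin_unit_top)
  have cont: "continuous_map X X s" using continuous_src unfolding unit_top_def
    using continuous_map_into_fulltopology by blast
  let ?D = "{x \<in> arrows G. s x \<in> V}"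
  have D: "openin X ?D" by (rule openin_continuous_map_preimage[OF cont V(1)])
  let ?B = "{B. compact_open_bisection G B \<and> B \<subseteq> ?D}"
  have "\<exists>\<F>. finite \<F> \<and> \<F> \<subseteq> (`) r ` ?B \<and> F \<subseteq> \<Union>\<F>"
  proof (rule compactinD)
    show "compactin X F" using F by (simp add: compactin_unit_top)
    show "openin X W" if "W \<in> (`) r ` ?B" for W
      using that compact_open_rng by (auto simp: compact_open_bisection_iff compact_open_def)
    show "F \<subseteq> \<Union>((`) r ` ?B)"
    proof
      fix u assume "u \<in> F"
      then obtain x where x: "x \<in> ?D" "r x = u" using F UV unfolding arrows_from_def by blast
      then obtain B where "compact_open_bisection G B" "x \<in> B" "B \<subseteq> ?D" using bisection_basis[OF D] by blast
      then show "u \<in> \<Union>((`) r ` ?B)" using x(2) by blast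
    qed
  qed
  then obtain \<F> where FF: "finite \<F>" "\<F> \<subseteq> (`) r ` ?B" "F \<subseteq> \<Union>\<F>" by blast
  obtain \<B> where \<B>: "\<B> \<subseteq> ?B" "finite \<B>" "\<F> = (`) r ` \<B>" using finite_subset_image[OF FF(1,2)] by blast
  obtain n :: nat and f where f: "\<B> = f ` {i. i < n}" using \<B>(2) finite_conv_nat_seg_image by metis
  have fB: "compact_open_bisection G (f i)" "f i \<subseteq> ?D" if "i < n" for i using f \<B>(1) that by auto
  have fa: "f i \<subseteq> arrows G" if "i < n" for i using fB(2)[OF that] by blast
  obtain v where "v \<in> V" using UV by blast
  then obtain C where C: "compact_open_bisection G C" "v \<in> C" "C \<subseteq> V" using bisection_basis[OF V(1)] by blast
  define K where "K = C \<union> (\<Union>i<n. s ` f i)"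
  have K: "compact_open K" "K \<subseteq> V" "K \<noteq> {}"
    using C fB compact_open_src unfolding K_def
    by (auto intro!: compact_open_Un compact_open_UN simp: compact_open_bisection_iff)
  have Ku: "K \<subseteq> units G" using K(2) V(2) by blast
  define F' where "F' = (\<Union>i<n. r ` f i)"
  have "compact_open F'"
    using fB(1) compact_open_rng unfolding F'_def by (auto intro!: compact_open_UN simp: compact_open_bisection_iff)
  moreover have "F \<subseteq> F'" using FF(3) by (simp add: F'_def \<B>(3) f lessThan_def)
  ultimately have F': "compact_open F'" "F \<subseteq> F'" by simp_all
  have "subeq (F' \<times> {0}) (\<Union>i<n. r ` ginv G ` f i \<times> {i})"
  proof (rule subeq_of_cover)
    show "open_bisection G (ginv G ` f i)" if "i \<in> {..<n}" for i
      using inverse_bisection[OF fB(1)] that unfolding compact_open_bisection_def by blast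
    show "disjoint_family_on (\<lambda>i. r ` ginv G ` f i \<times> {i}) {..<n}" by (auto simp: disjoint_family_on_def)
    have "F' \<subseteq> units G" unfolding F'_def using fa by (auto simp: subset_iff)
    then show "unit_compact_open (F' \<times> {0})" using F'(1) by (intro unit_compact_open_Times) auto
    show "F' \<times> {0} \<subseteq> (\<Union>i<n. s ` ginv G ` f i \<times> {0})"
      unfolding F'_def using src_ginv_image[OF fa] by auto
  qed simp
  moreover have "(\<Union>i<n. r ` ginv G ` f i \<times> {i}) \<subseteq> K \<times> {..<n}"
    unfolding K_def using rng_ginv_image[OF fa] by auto
  ultimately have FK: "subeq (F' \<times> {0}) (K \<times> {0})"
    by (rule subeq_trans[OF subeq_mono subeq_multiples[OF H K(1) Ku]])
  have "subeq (K \<times> {0, 1}) (K \<times> {0})" using H K(1) Ku unfolding all_double_def by blast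
  then obtain W :: "nat \<Rightarrow> 'a set" where W: "\<forall>i. compact_open_bisection G (W i)" "\<forall>i\<in>{0, 1}. s ` W i = K"
    "\<forall>i. r ` W i \<subseteq> K" "r ` W 0 \<inter> r ` W 1 = {}" by (rule subeq_double_bisections)
  have *: "openin (unit_top G) (r ` W i) \<and> r ` W i \<noteq> {} \<and> r ` W i \<subseteq> V \<and> compact_below G F (r ` W i)"
    if i: "i \<in> {0, 1}" for i
  proof (intro conjI)
    have Wi: "compact_open_bisection G (W i)" using W(1) by blast
    then show "openin (unit_top G) (r ` W i)" by (simp add: compact_open_bisection_def open_bisection_def)
    show "r ` W i \<noteq> {}" using W(2) K(3) i by auto
    show "r ` W i \<subseteq> V" using W(3) K(2) by blast
    have "s ` W i = K" using W(2) i by blast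
    then have "subeq (K \<times> {0}) (r ` W i \<times> {0})"
      using subeq_bisection[of "W i" K 0 0] Wi K(1) by (simp add: compact_open_bisection_def)
    then have "subeq (F' \<times> {0}) (r ` W i \<times> {0})" by (rule subeq_trans[OF FK])
    then show "compact_below G F (r ` W i)" using F'(2) by (rule subeq_imp_compact_below)
  qed
  show "\<exists>O1 O2. openin (unit_top G) O1 \<and> openin (unit_top G) O2 \<and> O1 \<noteq> {} \<and> O2 \<noteq> {} \<and>
           O1 \<inter> O2 = {} \<and> O1 \<subseteq> V \<and> O2 \<subseteq> V \<and> compact_below G F O1 \<and> compact_below G F O2"
    using *[of 0] *[of 1] W(4) by (intro exI[of _ "r ` W 0"] exI[of _ "r ` W 1"]) simp
qed

section \<open>Weak pure infiniteness without global fixed units\<close>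

lemma purely_infinite_imp_weakly:
  assumes "purely_infinite_groupoid G" shows "weakly_purely_infinite_groupoid G"
  unfolding weakly_purely_infinite_groupoid_def open_below_def
proof (intro allI impI)
  fix U V K
  assume UV: "openin (unit_top G) U \<and> openin (unit_top G) V \<and> U \<noteq> {} \<and> V \<noteq> {} \<and>
      U \<subseteq> rng G ` arrows_from G V" and K: "compactin (unit_top G) K \<and> K \<subseteq> U"
  have "open_below2 G U V" using assms UV unfolding purely_infinite_groupoid_def by simp
  then obtain O1 where "O1 \<subseteq> V" "compact_below G K O1"
    using K unfolding open_below2_def by metis
  then show "compact_below G K V" unfolding compact_below_def by (meson subset_trans)
qed

text \<open>Since the source and the range of \<open>B\<close> are disjoint, \<open>s(B) \<squnion> r(B) \<prec> s(B)\<close> says that two copies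
  of \<open>s(B)\<close> embed into one.\<close>

lemma double_of_moving_bisection:
  assumes weak: "weakly_purely_infinite_groupoid G"
    and B: "compact_open_bisection G B" and disj: "s ` B \<inter> r ` B = {}"
  shows "subeq (s ` B \<times> {0, 1}) (s ` B \<times> {0})"
proof (cases "B = {}")
  case True
  then show ?thesis using subeq_refl[OF unit_compact_open_empty] by simp
next
  case False
  have cB: "compact_open B" using B compact_open_bisection_iff by blast
  have Ba: "B \<subseteq> arrows G" by (rule compact_open_arrows[OF cB])
  let ?D = "s ` B" let ?K = "s ` B \<union> r ` B"
  have c: "compact_open ?D" "compact_open ?K" "?D \<subseteq> units G" "?K \<subseteq> units G"
    using cB Ba by (auto intro: compact_open_src compact_open_Un compact_open_rng)
  \<comment> \<open>A unit in \<open>?D\<close> is reached by itself, and r x by the arrow x, which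
    starts in \<open>?D\<close>.\<close>
  have "?K \<subseteq> rng G ` arrows_from G ?D"
  proof
    fix u assume "u \<in> ?K"
    then consider x where "x \<in> B" "u = s x" | x where "x \<in> B" "u = r x" by blast
    then show "u \<in> rng G ` arrows_from G ?D"
    proof cases
      case 1
      then have "s x \<in> arrows_from G ?D" "u = r (s x)" using Ba by (auto simp: arrows_from_def)
      then show ?thesis by blast
    next
      case 2
      then have "x \<in> arrows_from G ?D" using Ba by (auto simp: arrows_from_def)
      then show ?thesis using 2 by blast
    qed
  qed
  moreover have "openin (unit_top G) ?K" "openin (unit_top G) ?D" "compactin (unit_top G) ?K"
    using c by (simp_all add: openin_unit_top compactin_unit_top compact_open_def)
  ultimately have "open_below G ?K ?D"
    using weak[unfolded weakly_purely_infinite_groupoid_def, THEN spec, THEN spec, of ?K ?D] False by simp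
  then have "compact_below G ?K ?D"
    using \<open>compactin (unit_top G) ?K\<close> unfolding open_below_def by blast
  then have 1: "subeq (?K \<times> {0}) (?D \<times> {0})" by (rule compact_below_imp_subeq[OF _ c(2,4)])
  \<comment> \<open>The copy on level 0 stays in place while \<open>B\<close> carries the copy on
    level 1 to the range of \<open>B\<close>.\<close>
  have "equidec (?D \<times> {0} \<union> ?D \<times> {1}) (?D \<times> {0} \<union> r ` B \<times> {0})"
    by (rule equidec_Un[OF equidec_refl[OF unit_compact_open_Times] equidec_bisection[OF B]]) (use c disj in auto)
  moreover have "?D \<times> {0} \<union> ?D \<times> {1} = ?D \<times> {0, 1 :: nat}" by auto
  moreover have "?D \<times> {0} \<union> r ` B \<times> {0} = ?K \<times> {0 :: nat}" by auto
  ultimately have "subeq (?D \<times> {0, 1}) (?K \<times> {0})" using equidec_imp_subeq by simp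
  then show ?thesis by (rule subeq_trans[OF _ 1])
qed

lemma weakly_imp_all_double:
  assumes weak: "weakly_purely_infinite_groupoid G" and nofix: "\<not> (\<exists>u. global_fixed_unit G u)"
  shows all_double
proof -
  let ?M = "{B. compact_open_bisection G B \<and> s ` B \<inter> r ` B = {}}"
  have cover: "\<exists>B\<in>?M. u \<in> s ` B" if u: "u \<in> units G" for u
  proof -
    obtain x where x: "x \<in> arrows G" "s x = u" "r x \<noteq> u" using nofix u unfolding global_fixed_unit_def by blast
    have "u \<in> arrows G" "r x \<in> arrows G" using u x units_arrows by auto
    \<comment> \<open>Neighbourhoods separating u from r x are pulled back along \<open>s\<close>
      and \<open>r\<close>; a bisection around x inside the result has disjoint source and
      range.\<close>
    then obtain N1 N2 where N: "openin X N1" "openin X N2" "u \<in> N1" "r x \<in> N2" "disjnt N1 N2"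
      using Hausdorff x(3) unfolding Hausdorff_space_def by metis
    have cont: "continuous_map X X s" "continuous_map X X r"
      using continuous_src continuous_rng unfolding unit_top_def by (auto intro: continuous_map_into_fulltopology)
    let ?O = "{y \<in> {y \<in> arrows G. s y \<in> N1}. r y \<in> N2}"
    have "openin X ?O"
      by (intro openin_continuous_map_preimage_gen[OF cont(2)] openin_continuous_map_preimage[OF cont(1)] N)
    moreover have "x \<in> ?O" using x N by simp
    ultimately obtain B where B: "compact_open_bisection G B" "x \<in> B" "B \<subseteq> ?O"
      using bisection_basis by meson
    have "s ` B \<subseteq> N1" "r ` B \<subseteq> N2" using B(3) by auto
    then have "s ` B \<inter> r ` B = {}" using N(5) unfolding disjnt_def by blast
    then show ?thesis using B x(2) by blast
  qed
  \<comment> \<open>Doubling passes to compact open parts of a moved source, since \<open>B\<close>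
    can be restricted to the arrows starting in \<open>A\<close>. The induction below needs such
    parts, because the covering sources overlap and must be cut.\<close>
  have dbl: "subeq (A \<times> {0, 1}) (A \<times> {0})" if A: "compact_open A" "A \<subseteq> s ` B" and B: "B \<in> ?M" for A B
  proof -
    have B': "compact_open B" "inj_on s B" "inj_on r B" "s ` B \<inter> r ` B = {}" using B compact_open_bisection_iff by auto
    let ?B = "{x \<in> B. s x \<in> A}"
    have "compact_open ?B" by (rule compact_open_restrict_src[OF _ B'(2) A]) (use B'(1) in \<open>simp add: compact_open_def\<close>)
    moreover have "inj_on s ?B" by (rule inj_on_subset[OF B'(2)]) blast
    moreover have "inj_on r ?B" by (rule inj_on_subset[OF B'(3)]) blast
    ultimately have "compact_open_bisection G ?B" by (simp add: compact_open_bisection_iff)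
    moreover have "s ` ?B \<inter> r ` ?B = {}" using B'(4) by blast
    moreover have "s ` ?B = A" using A(2) by blast
    ultimately show ?thesis using double_of_moving_bisection[OF weak, of ?B] by simp
  qed
  have fin: "subeq (A \<times> {0, 1}) (A \<times> {0})"
    if "finite \<B>" "\<B> \<subseteq> ?M" "compact_open A" "A \<subseteq> (\<Union>B\<in>\<B>. s ` B)" for \<B> A
    using that
  proof (induction \<B> arbitrary: A rule: finite_induct)
    case empty
    then show ?case using subeq_refl[OF unit_compact_open_empty] by simp
  next
    case (insert B \<B>)
    have cB: "compact_open (s ` B)" using insert.prems(1) compact_open_src by (simp add: compact_open_bisection_iff)
    have 1: "subeq ((A \<inter> s ` B) \<times> {0, 1}) ((A \<inter> s ` B) \<times> {0})"
      by (rule dbl[of _ B]) (use insert.prems cB compact_open_Int in auto)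
    have 2: "subeq ((A - s ` B) \<times> {0, 1}) ((A - s ` B) \<times> {0})"
      by (rule insert.IH) (use insert.prems cB compact_open_Diff in auto)
    have "subeq ((A \<inter> s ` B) \<times> {0, 1} \<union> (A - s ` B) \<times> {0, 1}) ((A \<inter> s ` B) \<times> {0} \<union> (A - s ` B) \<times> {0})"
      by (rule subeq_Un[OF 1 2]) auto
    moreover have "(A \<inter> s ` B) \<times> J \<union> (A - s ` B) \<times> J = A \<times> J" for J :: "nat set" by auto
    ultimately show ?case by simp
  qed
  show ?thesis unfolding all_double_def
  proof (intro allI impI)
    fix A assume A: "compact_open A \<and> A \<subseteq> units G"
    have "\<exists>\<F>. finite \<F> \<and> \<F> \<subseteq> (`) s ` ?M \<and> A \<subseteq> \<Union>\<F>"
    proof (rule compactinD)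
      show "compactin X A" using A by (simp add: compact_open_def)
      show "openin X W" if "W \<in> (`) s ` ?M" for W
        using that compact_open_src by (auto simp: compact_open_bisection_iff compact_open_def)
      show "A \<subseteq> \<Union>((`) s ` ?M)" using cover A by blast
    qed
    then obtain \<F> where FF: "finite \<F>" "\<F> \<subseteq> (`) s ` ?M" "A \<subseteq> \<Union>\<F>" by blast
    obtain \<B> where \<B>: "\<B> \<subseteq> ?M" "finite \<B>" "\<F> = (`) s ` \<B>" using finite_subset_image[OF FF(1,2)] by blast
    show "subeq (A \<times> {0, 1}) (A \<times> {0})"
      by (rule fin[OF \<B>(2,1)]) (use A FF(3) \<B>(3) in auto)
  qed
qed

end

theorem theoremC:
  fixes G :: "'a groupoid"
  assumes "topological_groupoid G"
    and "infinite (units G)"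
    and "locally_compact_space (arrow_top G)"
    and "Hausdorff_space (arrow_top G)"
    and "etale G"
    and "ample G"
  shows "(purely_infinite_groupoid G \<longleftrightarrow> paradoxical_comparison G) \<and>
    (purely_infinite_groupoid G \<longleftrightarrow>
       (\<forall>A. compact_open_unit_set G A \<and> A \<noteq> {} \<longrightarrow> two_one_paradoxical G A)) \<and>
    (purely_infinite_groupoid G \<longleftrightarrow> purely_infinite_monoid (groupoid_semigroup G)) \<and>
    (purely_infinite_groupoid G \<longleftrightarrow> purely_infinite_monoid (type_semigroup G)) \<and>
    (purely_infinite_groupoid G \<longleftrightarrow>
       almost_unperforated (groupoid_semigroup G) \<and>
       \<not> (\<exists>f. nontrivial_state (groupoid_semigroup G) f)) \<and>
    (purely_infinite_groupoid G \<longleftrightarrow>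
       almost_unperforated (type_semigroup G) \<and>
       \<not> (\<exists>f. nontrivial_state (type_semigroup G) f)) \<and>
    (\<not> (\<exists>u. global_fixed_unit G u) \<longrightarrow>
       (purely_infinite_groupoid G \<longleftrightarrow> weakly_purely_infinite_groupoid G))"
proof -
  interpret ample_groupoid G
    using assms by (intro ample_groupoid.intro ample_groupoid_axioms.intro)
  \<comment> \<open>A cycle: pure infiniteness gives paradoxical comparison, which gives doubling,
    which gives pure infiniteness back.\<close>
  have pi: "purely_infinite_groupoid G \<longleftrightarrow> all_double"
    using purely_infinite_imp_paradoxical paradoxical_imp_all_double all_double_imp_purely_infinite by blast
  have "paradoxical_comparison G \<longleftrightarrow> all_double"
    using pi purely_infinite_imp_paradoxical paradoxical_imp_all_double by blast
  moreover have "weakly_purely_infinite_groupoid G \<longleftrightarrow> all_double" if "\<not> (\<exists>u. global_fixed_unit G u)"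
    using pi purely_infinite_imp_weakly weakly_imp_all_double[OF _ that] by blast
  ultimately show ?thesis
    unfolding groupoid_semigroup_states[symmetric] type_semigroup_states[symmetric]
      groupoid_semigroup_all_double type_semigroup_all_double two_one_iff_all_double pi
    by blast
qed

end
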